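(* Let $(\mathcal E,D(\mathcal E))$ be a quasi-regular semi-Dirichlet form on $L^2(E;m)$, let $\phi\in L^2(E;m)$ with $0<\phi\le1$ $m$-a.e., and define $$\hat S^*_{00}:=\{\mu\in S_0\,:\,\hat U_1\mu\le c\,\hat G_1\phi\ \text{ for some constant }c>0\}.$$ Let $A\in\mathcal B(E)$. If $\mu(A)=0$ for all $\mu\in\hat S^*_{00}$, then $\mathrm{cap}_\phi(A)=0$.
   Context: $E$ is a metrizable Lusin space, $m$ a $\sigma$-finite positive measure on $\mathcal B(E)$, $(\cdot,\cdot)$ the inner product of $L^2(E;m)$. A semi-Dirichlet form $(\mathcal E,D(\mathcal E))$ on $L^2(E;m)$ is a nonnegative bilinear form with dense domain such that, with $\mathcal E_\alpha(u,v):=\mathcal E(u,v)+\alpha(u,v)$: $D(\mathcal E)$ is complete for $\mathcal E_1(u,u)^{1/2}$; $|\mathcal E_1(u,v)|\le K\mathcal E_1(u,u)^{1/2}\mathcal E_1(v,v)^{1/2}$ for some constant $K>0$; and for $u\in D(\mathcal E)$, $u^+\wedge1\in D(\mathcal E)$ and $\mathcal E(u+u^+\wedge1,u-u^+\wedge1)\ge0$. $(G_\alpha)$ and $(\hat G_\alpha)$ are the resolvent and co-resolvent: $\mathcal E_\alpha(G_\alpha f,u)=(f,u)=\mathcal E_\alpha(u,\hat G_\alpha f)$. An $\mathcal E$-nest is an increasing sequence of closed sets $F_k$ such that $\bigcup_k\{u\in D(\mathcal E):u=0\ m\text{-a.e. on }F_k^c\}$ is $\mathcal E_1^{1/2}$-dense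 in $D(\mathcal E)$. A set is $\mathcal E$-exceptional if contained in $\bigcap_kF_k^c$ for some $\mathcal E$-nest. A function is $\mathcal E$-quasi-continuous if its restriction to each $F_k$ is continuous for some $\mathcal E$-nest; $\tilde u$ denotes an $\mathcal E$-quasi-continuous $m$-version of $u$. Quasi-regular: there is an $\mathcal E$-nest of compacts, an $\mathcal E_1^{1/2}$-dense subset of $D(\mathcal E)$ whose elements have $\mathcal E$-quasi-continuous $m$-versions, and countably many $u_n\in D(\mathcal E)$ with $\mathcal E$-quasi-continuous $m$-versions separating points outside an $\mathcal E$-exceptional set. $S_0$ (measures of finite energy integral) is the set of positive measures $\mu$ on $(E,\mathcal B(E))$ with $\mu(N)=0$ for each $\mathcal E$-exceptional $N\in\mathcal B(E)$ and such that for some constant $C>0$, $\int_E|\tilde v|d\mu\le C\mathcal E_1(v,v)^{1/2}$ for all $v\in D(\mathcal E)$. For $\mu\in S_0$, the $1$-co-potential $\hat U_1\mu\in D(\mathcal E)$ is the unique element with $\mathcal E_1(v,\hat U_1\mu)=\int_E\tilde v\,d\mu$ for all $v\in D(\mathcal E)$. The inequality $\hat U_1\mu\le c\,\hat G_1\phi$ is meant $m$-a.e. Capacity: let $h:=G_1\phi$. For $U\subset E$ open, $h_U$ is the $1$-balayaged function of $h$ on $U$, i.e. the unique element of $L_U:=\{w\in D(\mathcal E):w\ge h\ m\text{-a.e. on }U\}$ with $\mathcal E_1(h_U,w-h_U)\ge0$ for all $w\in L_U$; $\mathrm{cap}_\phi(U):=(h_U,\phi)$. For arbitrary $A\subset E$,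 $\mathrm{cap}_\phi(A):=\inf\{\mathrm{cap}_\phi(U): A\subset U,\ U\text{ open}\}$. *)

theory Defs
  imports "HOL-Analysis.Analysis"
begin

text \<open>
  Elements of \<open>L\<^sup>2(E;m)\<close> are represented by Borel functions on the whole type; equality
  in \<open>L\<^sup>2\<close> is equality \<open>m\<close>-a.e., and all sets of and maps on such functions are required
  to respect it.
\<close>

definition L2 :: "'a measure \<Rightarrow> ('a \<Rightarrow> real) set" where
  "L2 m = {u \<in> borel_measurable m. integrable m (\<lambda>x. (u x)\<^sup>2)}"

definition inner_L2 :: "'a measure \<Rightarrow> ('a \<Rightarrow> real) \<Rightarrow> ('a \<Rightarrow> real) \<Rightarrow> real" where
  "inner_L2 m u v = (\<integral>x. u x * v x \<partial>m)"

text \<open>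
  A metrizable Lusin space is one homeomorphic to a Borel subset of a Polish space. The Polish
  space is a type, so the homeomorphism appears as an argument.
\<close>

definition lusin_embedding :: "('a::topological_space \<Rightarrow> 'p::polish_space) \<Rightarrow> bool" where
  "lusin_embedding e \<longleftrightarrow>
     range e \<in> sets borel \<and> (\<exists>g. homeomorphism UNIV (range e) e g)"

definition energy ::
  "'a measure \<Rightarrow> (('a \<Rightarrow> real) \<Rightarrow> ('a \<Rightarrow> real) \<Rightarrow> real) \<Rightarrow> real \<Rightarrow> ('a \<Rightarrow> real) \<Rightarrow> ('a \<Rightarrow> real) \<Rightarrow> real"
  where "energy m \<E> \<alpha> u v = \<E> u v + \<alpha> * inner_L2 m u v"

definition norm1 ::
  "'a measure \<Rightarrow> (('a \<Rightarrow> real) \<Rightarrow> ('a \<Rightarrow> real) \<Rightarrow> real) \<Rightarrow> ('a \<Rightarrow> real) \<Rightarrow> real"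
  where "norm1 m \<E> u = sqrt (energy m \<E> 1 u u)"

locale semi_dirichlet_form = sigma_finite_measure m
  for m :: "'a::topological_space measure" +
  fixes D :: "('a \<Rightarrow> real) set" and \<E> :: "('a \<Rightarrow> real) \<Rightarrow> ('a \<Rightarrow> real) \<Rightarrow> real"
  assumes sets_m: "sets m = sets borel"
    and D_subset_L2: "D \<subseteq> L2 m"
    and D_cong_AE: "\<And>u v. u \<in> D \<Longrightarrow> v \<in> borel_measurable m \<Longrightarrow> (AE x in m. u x = v x) \<Longrightarrow> v \<in> D"
    and form_cong_AE: "\<And>u u' v v'. u \<in> D \<Longrightarrow> u' \<in> D \<Longrightarrow> v \<in> D \<Longrightarrow> v' \<in> D \<Longrightarrow>
          (AE x in m. u x = u' x) \<Longrightarrow> (AE x in m. v x = v' x) \<Longrightarrow> \<E> u v = \<E> u' v'"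
    and D_lincomb: "\<And>a b u v. u \<in> D \<Longrightarrow> v \<in> D \<Longrightarrow> (\<lambda>x. a * u x + b * v x) \<in> D"
    and form_linear_left: "\<And>a b u v w. u \<in> D \<Longrightarrow> v \<in> D \<Longrightarrow> w \<in> D \<Longrightarrow>
          \<E> (\<lambda>x. a * u x + b * v x) w = a * \<E> u w + b * \<E> v w"
    and form_linear_right: "\<And>a b u v w. u \<in> D \<Longrightarrow> v \<in> D \<Longrightarrow> w \<in> D \<Longrightarrow>
          \<E> w (\<lambda>x. a * u x + b * v x) = a * \<E> w u + b * \<E> w v"
    and form_nonneg: "\<And>u. u \<in> D \<Longrightarrow> 0 \<le> \<E> u u"
    and D_dense: "\<And>f \<epsilon>. f \<in> L2 m \<Longrightarrow> 0 < \<epsilon> \<Longrightarrow>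
          \<exists>u\<in>D. sqrt (\<integral>x. (f x - u x)\<^sup>2 \<partial>m) < \<epsilon>"
    and D_complete: "\<And>u. (\<And>n::nat. u n \<in> D) \<Longrightarrow>
          (\<And>\<epsilon>. 0 < \<epsilon> \<Longrightarrow> \<exists>N. \<forall>i\<ge>N. \<forall>j\<ge>N. norm1 m \<E> (\<lambda>x. u i x - u j x) < \<epsilon>) \<Longrightarrow>
          \<exists>v\<in>D. (\<lambda>n. norm1 m \<E> (\<lambda>x. u n x - v x)) \<longlonglongrightarrow> 0"
    and sector: "\<exists>K>0. \<forall>u\<in>D. \<forall>v\<in>D. \<bar>energy m \<E> 1 u v\<bar> \<le> K * norm1 m \<E> u * norm1 m \<E> v"
    and unit_contraction_in_D: "\<And>u. u \<in> D \<Longrightarrow> (\<lambda>x. min (max (u x) 0) 1) \<in> D"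
    and unit_contraction: "\<And>u. u \<in> D \<Longrightarrow>
          0 \<le> \<E> (\<lambda>x. u x + min (max (u x) 0) 1) (\<lambda>x. u x - min (max (u x) 0) 1)"

text \<open>
  Resolvent, co-resolvent, co-potential and balayaged function are determined by their defining
  properties only up to \<open>m\<close>-a.e. equality; \<open>SOME\<close> picks a representative.
\<close>

definition resolvent ::
  "'a measure \<Rightarrow> ('a \<Rightarrow> real) set \<Rightarrow> (('a \<Rightarrow> real) \<Rightarrow> ('a \<Rightarrow> real) \<Rightarrow> real) \<Rightarrow> real \<Rightarrow> ('a \<Rightarrow> real) \<Rightarrow> 'a \<Rightarrow> real"
  where "resolvent m D \<E> \<alpha> f =
    (SOME g. g \<in> D \<and> (\<forall>u\<in>D. energy m \<E> \<alpha> g u = inner_L2 m f u))"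

definition coresolvent ::
  "'a measure \<Rightarrow> ('a \<Rightarrow> real) set \<Rightarrow> (('a \<Rightarrow> real) \<Rightarrow> ('a \<Rightarrow> real) \<Rightarrow> real) \<Rightarrow> real \<Rightarrow> ('a \<Rightarrow> real) \<Rightarrow> 'a \<Rightarrow> real"
  where "coresolvent m D \<E> \<alpha> f =
    (SOME g. g \<in> D \<and> (\<forall>u\<in>D. energy m \<E> \<alpha> u g = inner_L2 m f u))"

definition nest ::
  "'a::topological_space measure \<Rightarrow> ('a \<Rightarrow> real) set \<Rightarrow> (('a \<Rightarrow> real) \<Rightarrow> ('a \<Rightarrow> real) \<Rightarrow> real) \<Rightarrow> (nat \<Rightarrow> 'a set) \<Rightarrow> bool"
  where "nest m D \<E> F \<longleftrightarrow>
    incseq F \<and> (\<forall>k. closed (F k)) \<and>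
    (\<forall>u\<in>D. \<forall>\<epsilon>>0. \<exists>v\<in>D. (\<exists>k. AE x in m. x \<notin> F k \<longrightarrow> v x = 0) \<and>
       norm1 m \<E> (\<lambda>x. u x - v x) < \<epsilon>)"

definition exceptional ::
  "'a::topological_space measure \<Rightarrow> ('a \<Rightarrow> real) set \<Rightarrow> (('a \<Rightarrow> real) \<Rightarrow> ('a \<Rightarrow> real) \<Rightarrow> real) \<Rightarrow> 'a set \<Rightarrow> bool"
  where "exceptional m D \<E> N \<longleftrightarrow> (\<exists>F. nest m D \<E> F \<and> N \<subseteq> (\<Inter>k. - F k))"

definition quasi_continuous ::
  "'a::topological_space measure \<Rightarrow> ('a \<Rightarrow> real) set \<Rightarrow> (('a \<Rightarrow> real) \<Rightarrow> ('a \<Rightarrow> real) \<Rightarrow> real) \<Rightarrow> ('a \<Rightarrow> real) \<Rightarrow> bool"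
  where "quasi_continuous m D \<E> w \<longleftrightarrow> (\<exists>F. nest m D \<E> F \<and> (\<forall>k. continuous_on (F k) w))"

definition qc_version ::
  "'a::topological_space measure \<Rightarrow> ('a \<Rightarrow> real) set \<Rightarrow> (('a \<Rightarrow> real) \<Rightarrow> ('a \<Rightarrow> real) \<Rightarrow> real) \<Rightarrow> ('a \<Rightarrow> real) \<Rightarrow> ('a \<Rightarrow> real) \<Rightarrow> bool"
  where "qc_version m D \<E> u w \<longleftrightarrow> quasi_continuous m D \<E> w \<and> (AE x in m. w x = u x)"

definition quasi_regular ::
  "'a::topological_space measure \<Rightarrow> ('a \<Rightarrow> real) set \<Rightarrow> (('a \<Rightarrow> real) \<Rightarrow> ('a \<Rightarrow> real) \<Rightarrow> real) \<Rightarrow> bool"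
  where "quasi_regular m D \<E> \<longleftrightarrow>
    (\<exists>F. nest m D \<E> F \<and> (\<forall>k. compact (F k))) \<and>
    (\<exists>D0\<subseteq>D. (\<forall>u\<in>D. \<forall>\<epsilon>>0. \<exists>v\<in>D0. norm1 m \<E> (\<lambda>x. u x - v x) < \<epsilon>) \<and>
       (\<forall>v\<in>D0. \<exists>w. qc_version m D \<E> v w)) \<and>
    (\<exists>(u :: nat \<Rightarrow> 'a \<Rightarrow> real) w N.
       (\<forall>n. u n \<in> D \<and> qc_version m D \<E> (u n) (w n)) \<and> exceptional m D \<E> N \<and>
       (\<forall>x y. x \<notin> N \<longrightarrow> y \<notin> N \<longrightarrow> x \<noteq> y \<longrightarrow> (\<exists>n. w n x \<noteq> w n y)))"

text \<open>
  A quasi-continuous function is Borel only off a Borel exceptional set. Since that set is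
  \<open>\<mu>\<close>-null for the measures considered here, the function is measurable for the completion of
  \<open>\<mu>\<close>, with respect to which all integrals of quasi-continuous versions are taken.
\<close>

definition S0 ::
  "'a::topological_space measure \<Rightarrow> ('a \<Rightarrow> real) set \<Rightarrow> (('a \<Rightarrow> real) \<Rightarrow> ('a \<Rightarrow> real) \<Rightarrow> real) \<Rightarrow> 'a measure set"
  where "S0 m D \<E> = {\<mu>. sets \<mu> = sets borel \<and>
    (\<forall>N \<in> sets borel. exceptional m D \<E> N \<longrightarrow> emeasure \<mu> N = 0) \<and>
    (\<exists>C>0. \<forall>v\<in>D. \<forall>w. qc_version m D \<E> v w \<longrightarrow>
       (\<integral>\<^sup>+x. ennreal \<bar>w x\<bar> \<partial>completion \<mu>) \<le> ennreal (C * norm1 m \<E> v))}"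

definition co_potential ::
  "'a::topological_space measure \<Rightarrow> ('a \<Rightarrow> real) set \<Rightarrow> (('a \<Rightarrow> real) \<Rightarrow> ('a \<Rightarrow> real) \<Rightarrow> real) \<Rightarrow> 'a measure \<Rightarrow> 'a \<Rightarrow> real"
  where "co_potential m D \<E> \<mu> =
    (SOME g. g \<in> D \<and> (\<forall>v\<in>D. \<forall>w. qc_version m D \<E> v w \<longrightarrow>
       energy m \<E> 1 v g = (\<integral>x. w x \<partial>completion \<mu>)))"

definition S00_hat ::
  "'a::topological_space measure \<Rightarrow> ('a \<Rightarrow> real) set \<Rightarrow> (('a \<Rightarrow> real) \<Rightarrow> ('a \<Rightarrow> real) \<Rightarrow> real) \<Rightarrow> ('a \<Rightarrow> real) \<Rightarrow> 'a measure set"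
  where "S00_hat m D \<E> \<phi> = {\<mu> \<in> S0 m D \<E>.
    \<exists>c>0. AE x in m. co_potential m D \<E> \<mu> x \<le> c * coresolvent m D \<E> 1 \<phi> x}"

definition above_on ::
  "'a measure \<Rightarrow> ('a \<Rightarrow> real) set \<Rightarrow> ('a \<Rightarrow> real) \<Rightarrow> 'a set \<Rightarrow> ('a \<Rightarrow> real) set"
  where "above_on m D h U = {w \<in> D. AE x in m. x \<in> U \<longrightarrow> h x \<le> w x}"

definition balayaged ::
  "'a measure \<Rightarrow> ('a \<Rightarrow> real) set \<Rightarrow> (('a \<Rightarrow> real) \<Rightarrow> ('a \<Rightarrow> real) \<Rightarrow> real) \<Rightarrow> ('a \<Rightarrow> real) \<Rightarrow> 'a set \<Rightarrow> 'a \<Rightarrow> real"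
  where "balayaged m D \<E> h U =
    (SOME g. g \<in> above_on m D h U \<and>
       (\<forall>w \<in> above_on m D h U. 0 \<le> energy m \<E> 1 g (\<lambda>x. w x - g x)))"

definition cap_open ::
  "'a measure \<Rightarrow> ('a \<Rightarrow> real) set \<Rightarrow> (('a \<Rightarrow> real) \<Rightarrow> ('a \<Rightarrow> real) \<Rightarrow> real) \<Rightarrow> ('a \<Rightarrow> real) \<Rightarrow> 'a set \<Rightarrow> real"
  where "cap_open m D \<E> \<phi> U = inner_L2 m (balayaged m D \<E> (resolvent m D \<E> 1 \<phi>) U) \<phi>"

definition cap ::
  "'a::topological_space measure \<Rightarrow> ('a \<Rightarrow> real) set \<Rightarrow> (('a \<Rightarrow> real) \<Rightarrow> ('a \<Rightarrow> real) \<Rightarrow> real) \<Rightarrow> ('a \<Rightarrow> real) \<Rightarrow> 'a set \<Rightarrow> real"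
  where "cap m D \<E> \<phi> A = (INF U \<in> {U. open U \<and> A \<subseteq> U}. cap_open m D \<E> \<phi> U)"

end

theory Submission
  imports Defs "HOL-Library.Function_Algebras"
begin

text \<open>
  Suppose that \<open>A\<close> has positive capacity; a measure \<open>\<mu>\<close> in \<open>S00_hat\<close> that charges \<open>A\<close> has to
  be found. Write \<open>B\<close> for \<open>\<E>\<^sub>1\<close>, \<open>h\<close> for \<open>G\<^sub>1 \<phi>\<close> and \<open>h'\<close> for its dual counterpart.

  \<^emph>\<open>Compact subsets.\<close> The capacity is outer regular by definition. It is also continuous from
  below along arbitrary increasing sequences (\<open>ucap_incseq_le\<close>), because balayaged functions are
  strongly subadditive (\<open>balayage_strong_subadditive\<close>). Choquet's argument, run on a representation
  of Borel sets as projections of closed sets, then gives a compact set \<open>X \<subseteq> A\<close> of positive capacity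
  (\<open>capacitability\<close>). All comparisons of balayaged functions come from one maximum principle
  (\<open>domination\<close>), which holds because \<open>B u\<^sup>+ u\<^sup>- \<le> 0\<close>. That inequality is drawn from the
  semi-Dirichlet property by noting that all points on the ray from the truncation of \<open>u\<close> through
  \<open>u\<close> have the same truncation (\<open>unit_truncation_form\<close>). It passes to the dual form, so that the
  same theory applies to co-balayage.

  \<^emph>\<open>A functional living on \<open>X\<close>.\<close> For every \<open>U\<close>, the capacity of \<open>U\<close> equals \<open>(\<phi>, h'\<^sub>U)\<close>, where
  \<open>h'\<^sub>U\<close> is the co-balayage of \<open>h'\<close> on \<open>U\<close>. Along decreasing open neighbourhoods of \<open>X\<close> whose
  capacities tend to that of \<open>X\<close> these functions decrease to some \<open>g \<le> h'\<close> with \<open>(\<phi>, g)\<close>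
  equal to the capacity of \<open>X\<close>, and the functional \<open>l v = B v g\<close> is nonnegative on every \<open>v\<close> that is nonnegative a.e. on some
  neighbourhood of \<open>X\<close> (\<open>co_equilibrium\<close>).

  \<^emph>\<open>The measure.\<close> Let \<open>w\<close> be a version of \<open>v \<le> C h\<close> that is continuous on the closed set \<open>F\<close> and
  negative on \<open>X \<inter> F\<close>. The points of \<open>F\<close> where \<open>w < 0\<close> form, together with the complement of \<open>F\<close>, an
  open neighbourhood of \<open>X\<close> on which \<open>v\<close> is at most \<open>C\<close> times the balayaged function of \<open>-F\<close>. Hence
  \<open>l v\<close> is at most \<open>C\<close> times the value of \<open>l\<close> at that function (\<open>l_le_red\<close>), which tends to zero
  when \<open>F\<close> runs through a nest. So \<open>l v\<close> depends only on the quasi-continuous version of \<open>v\<close> on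
  \<open>X\<close> and is positive there; with Dini's theorem on the compact sets of a nest, \<open>l\<close> even satisfies
  the continuity condition of Daniell (\<open>l_Daniell\<close>). The Daniell-Stone theorem represents \<open>l\<close> by a
  measure \<open>\<mu>\<close> carried by \<open>X\<close>; Borel sets are measurable for it because countably many
  quasi-continuous functions separate the points. The co-potential of \<open>\<mu>\<close> is \<open>g \<le> h'\<close>, so \<open>\<mu>\<close> belongs to
  \<open>S00_hat\<close>, and the integral of \<open>h\<close> against \<open>\<mu>\<close> is \<open>l h = (\<phi>, g)\<close>, the positive capacity of \<open>X\<close>.
\<close>

section \<open>Coercive forms and variational inequalities\<close>

text \<open>With pointwise scalar multiplication, form domains are subspaces of a real vector space, and the
  Hilbert space arguments can be made in the abstract.\<close>

instantiation "fun" :: (type, real_vector) real_vector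
begin

definition scaleR_fun_def: "c *\<^sub>R f = (\<lambda>x. c *\<^sub>R f x)"

instance
  by standard (simp_all add: fun_eq_iff scaleR_fun_def algebra_simps)

end

lemma scaleR_fun_apply [simp]: "(c *\<^sub>R f) x = c *\<^sub>R f x"
  by (simp add: scaleR_fun_def)

text \<open>\<open>sqrt (B u u)\<close> is only a seminorm: functions that agree almost everywhere will have distance
  zero. Completeness is therefore stated for Cauchy sequences of vectors, and limits are not
  unique.\<close>

locale coercive_form =
  fixes V :: "'v::real_vector set" and B :: "'v \<Rightarrow> 'v \<Rightarrow> real" and K :: real
  assumes subspace_V: "subspace V"
    and add_left: "\<And>u v w. u \<in> V \<Longrightarrow> v \<in> V \<Longrightarrow> w \<in> V \<Longrightarrow> B (u + v) w = B u w + B v w"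
    and add_right: "\<And>u v w. u \<in> V \<Longrightarrow> v \<in> V \<Longrightarrow> w \<in> V \<Longrightarrow> B w (u + v) = B w u + B w v"
    and scale_left: "\<And>c u w. u \<in> V \<Longrightarrow> w \<in> V \<Longrightarrow> B (c *\<^sub>R u) w = c * B u w"
    and scale_right: "\<And>c u w. u \<in> V \<Longrightarrow> w \<in> V \<Longrightarrow> B w (c *\<^sub>R u) = c * B w u"
    and B_nonneg: "\<And>u. u \<in> V \<Longrightarrow> 0 \<le> B u u"
    and K_pos: "0 < K"
    and sector: "\<And>u v. u \<in> V \<Longrightarrow> v \<in> V \<Longrightarrow> \<bar>B u v\<bar> \<le> K * sqrt (B u u) * sqrt (B v v)"
    and complete: "\<And>u. (\<And>n::nat. u n \<in> V) \<Longrightarrow>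
          (\<And>\<epsilon>. 0 < \<epsilon> \<Longrightarrow> \<exists>N. \<forall>i\<ge>N. \<forall>j\<ge>N. sqrt (B (u i - u j) (u i - u j)) < \<epsilon>) \<Longrightarrow>
          \<exists>v\<in>V. (\<lambda>n. sqrt (B (u n - v) (u n - v))) \<longlonglongrightarrow> 0"
begin

definition nrm :: "'v \<Rightarrow> real" where "nrm u = sqrt (B u u)"

lemma dual: "coercive_form V (\<lambda>u v. B v u) K"
proof
  show "\<bar>B v u\<bar> \<le> K * sqrt (B u u) * sqrt (B v v)" if "u \<in> V" "v \<in> V" for u v
    using sector[OF that(2,1)] by (simp add: ac_simps)
qed (use subspace_V add_left add_right scale_left scale_right B_nonneg K_pos complete in auto)

lemma V_add [simp, intro]: "u \<in> V \<Longrightarrow> v \<in> V \<Longrightarrow> u + v \<in> V"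
  and V_diff [simp, intro]: "u \<in> V \<Longrightarrow> v \<in> V \<Longrightarrow> u - v \<in> V"
  and V_scale [simp, intro]: "u \<in> V \<Longrightarrow> c *\<^sub>R u \<in> V"
  and V_zero [simp, intro]: "0 \<in> V"
  and V_minus [simp, intro]: "u \<in> V \<Longrightarrow> - u \<in> V"
  using subspace_V by (auto simp: subspace_add subspace_diff subspace_scale subspace_0 subspace_neg)

lemma diff_left: "u \<in> V \<Longrightarrow> v \<in> V \<Longrightarrow> w \<in> V \<Longrightarrow> B (u - v) w = B u w - B v w"
  using add_left[of u "(-1) *\<^sub>R v" w] scale_left[of v w "-1"] by simp

lemma diff_right: "u \<in> V \<Longrightarrow> v \<in> V \<Longrightarrow> w \<in> V \<Longrightarrow> B w (u - v) = B w u - B w v"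
  using add_right[of u "(-1) *\<^sub>R v" w] scale_right[of v w "-1"] by simp

lemma minus_left: "u \<in> V \<Longrightarrow> w \<in> V \<Longrightarrow> B (- u) w = - B u w"
  using scale_left[of u w "-1"] by simp

lemma minus_right: "u \<in> V \<Longrightarrow> w \<in> V \<Longrightarrow> B w (- u) = - B w u"
  using scale_right[of u w "-1"] by simp

lemma zero_left [simp]: "w \<in> V \<Longrightarrow> B 0 w = 0"
  using scale_left[of 0 w 0] by simp

lemma zero_right [simp]: "w \<in> V \<Longrightarrow> B w 0 = 0"
  using scale_right[of 0 w 0] by simp

lemmas bilinear_simps = add_left add_right diff_left diff_right scale_left scale_right
  minus_left minus_right

lemma nrm_nonneg [simp]: "u \<in> V \<Longrightarrow> 0 \<le> nrm u"
  by (simp add: nrm_def B_nonneg)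

lemma nrm_square: "u \<in> V \<Longrightarrow> (nrm u)\<^sup>2 = B u u"
  by (simp add: nrm_def B_nonneg)

lemma nrm_zero [simp]: "nrm 0 = 0"
  by (simp add: nrm_def)

lemma nrm_scale: "u \<in> V \<Longrightarrow> nrm (c *\<^sub>R u) = \<bar>c\<bar> * nrm u"
  by (simp add: nrm_def scale_left scale_right real_sqrt_mult flip: mult.assoc)

lemma nrm_minus [simp]: "u \<in> V \<Longrightarrow> nrm (- u) = nrm u"
  by (simp add: nrm_def bilinear_simps)

lemma nrm_diff_commute: "u \<in> V \<Longrightarrow> v \<in> V \<Longrightarrow> nrm (u - v) = nrm (v - u)"
  using nrm_minus[of "u - v"] by simp

lemma sector_nrm: "u \<in> V \<Longrightarrow> v \<in> V \<Longrightarrow> \<bar>B u v\<bar> \<le> K * nrm u * nrm v"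
  using sector by (simp add: nrm_def)

text \<open>The symmetric part of \<open>B\<close> is a semi-inner product, so it obeys the Cauchy-Schwarz inequality.
  The case of a null vector is settled by the sector condition.\<close>

lemma symmetric_part_bound:
  assumes "u \<in> V" "v \<in> V"
  shows "B u v + B v u \<le> 2 * nrm u * nrm v"
proof (cases "nrm v = 0")
  case True
  then show ?thesis
    using sector_nrm[OF assms] sector_nrm[OF assms(2,1)] by simp
next
  case False
  define b where "b = nrm v"
  define a where "a = nrm u"
  have b: "b > 0" using False nrm_nonneg[OF assms(2)] by (simp add: b_def)
  have "0 \<le> B (b *\<^sub>R u - a *\<^sub>R v) (b *\<^sub>R u - a *\<^sub>R v)"
    using assms by (intro B_nonneg) auto
  also have "\<dots> = b * b * (nrm u)\<^sup>2 - a * b * (B u v + B v u) + a * a * (nrm v)\<^sup>2"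
    using assms by (simp add: bilinear_simps nrm_square algebra_simps)
  also have "\<dots> = a * b * (2 * a * b - (B u v + B v u))"
    by (simp add: a_def b_def power2_eq_square algebra_simps)
  finally have 0: "0 \<le> a * b * (2 * a * b - (B u v + B v u))" .
  show ?thesis
  proof (cases "a = 0")
    case True
    then show ?thesis
      using sector_nrm[OF assms] sector_nrm[OF assms(2,1)] by (simp add: a_def)
  next
    case False
    then have "a > 0" using nrm_nonneg[OF assms(1)] by (simp add: a_def)
    then have "0 \<le> 2 * a * b - (B u v + B v u)"
      using 0 b mult_le_cancel_left_pos[of "a * b" 0 "2 * a * b - (B u v + B v u)"] by simp
    then show ?thesis by (simp add: a_def b_def)
  qed
qed

lemma nrm_triangle:
  assumes "u \<in> V" "v \<in> V"
  shows "nrm (u + v) \<le> nrm u + nrm v"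
proof (rule power2_le_imp_le)
  have "(nrm (u + v))\<^sup>2 = (nrm u)\<^sup>2 + (B u v + B v u) + (nrm v)\<^sup>2"
    using assms by (simp add: nrm_square bilinear_simps)
  also have "\<dots> \<le> (nrm u + nrm v)\<^sup>2"
    using symmetric_part_bound[OF assms] by (simp add: power2_sum)
  finally show "(nrm (u + v))\<^sup>2 \<le> (nrm u + nrm v)\<^sup>2" .
qed (use assms in simp)

lemma nrm_triangle_diff:
  assumes "u \<in> V" "v \<in> V" "w \<in> V"
  shows "nrm (u - w) \<le> nrm (u - v) + nrm (v - w)"
  using nrm_triangle[of "u - v" "v - w"] assms by simp

lemma nrm_le_diff: "u \<in> V \<Longrightarrow> v \<in> V \<Longrightarrow> nrm u \<le> nrm (u - v) + nrm v"
  using nrm_triangle[of "u - v" v] by simp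

lemma zero_of_sector_square:
  assumes "u \<in> V" "v \<in> V" "0 \<le> K'" "(nrm u)\<^sup>2 \<le> K' * nrm v * nrm u"
  shows "nrm u \<le> K' * nrm v"
  using assms nrm_nonneg[OF assms(1)]
  by (cases "nrm u = 0") (auto simp: power2_eq_square)

definition bdd_linear :: "('v \<Rightarrow> real) \<Rightarrow> bool" where
  "bdd_linear l \<longleftrightarrow> (\<forall>u\<in>V. \<forall>v\<in>V. l (u + v) = l u + l v) \<and>
     (\<forall>u\<in>V. \<forall>c. l (c *\<^sub>R u) = c * l u) \<and> (\<exists>M\<ge>0. \<forall>u\<in>V. \<bar>l u\<bar> \<le> M * nrm u)"

lemma bdd_linear_add: "bdd_linear l \<Longrightarrow> u \<in> V \<Longrightarrow> v \<in> V \<Longrightarrow> l (u + v) = l u + l v"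
  and bdd_linear_scale: "bdd_linear l \<Longrightarrow> u \<in> V \<Longrightarrow> l (c *\<^sub>R u) = c * l u"
  by (auto simp: bdd_linear_def)

lemma bdd_linear_diff: "bdd_linear l \<Longrightarrow> u \<in> V \<Longrightarrow> v \<in> V \<Longrightarrow> l (u - v) = l u - l v"
  using bdd_linear_add[of l u "(-1) *\<^sub>R v"] bdd_linear_scale[of l v "-1"] by simp

lemma bdd_linear_left: "w \<in> V \<Longrightarrow> bdd_linear (\<lambda>u. B u w)"
  unfolding bdd_linear_def
  by (auto simp: bilinear_simps intro!: exI[of _ "K * nrm w"] mult_nonneg_nonneg less_imp_le[OF K_pos])
    (metis sector_nrm mult.assoc mult.commute)

lemma bdd_linear_right: "w \<in> V \<Longrightarrow> bdd_linear (\<lambda>u. B w u)"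
  unfolding bdd_linear_def
  by (auto simp: bilinear_simps sector_nrm intro!: exI[of _ "K * nrm w"] mult_nonneg_nonneg less_imp_le[OF K_pos])

lemma bdd_linear_combine:
  assumes "bdd_linear l" "bdd_linear l'"
  shows "bdd_linear (\<lambda>u. l u - c * l' u)"
proof -
  obtain M where M: "M \<ge> 0" "\<And>u. u \<in> V \<Longrightarrow> \<bar>l u\<bar> \<le> M * nrm u" using assms(1) by (auto simp: bdd_linear_def)
  obtain M' where M': "M' \<ge> 0" "\<And>u. u \<in> V \<Longrightarrow> \<bar>l' u\<bar> \<le> M' * nrm u" using assms(2) by (auto simp: bdd_linear_def)
  have "\<bar>l u - c * l' u\<bar> \<le> (M + \<bar>c\<bar> * M') * nrm u" if "u \<in> V" for u
  proof -
    have "\<bar>l u - c * l' u\<bar> \<le> \<bar>l u\<bar> + \<bar>c\<bar> * \<bar>l' u\<bar>" by (metis abs_triangle_ineq4 abs_mult)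
    also have "\<dots> \<le> M * nrm u + \<bar>c\<bar> * (M' * nrm u)"
      using M(2)[OF that] M'(2)[OF that] by (intro add_mono mult_left_mono) auto
    finally show ?thesis by (simp add: algebra_simps)
  qed
  then show ?thesis
    using M M' assms unfolding bdd_linear_def
    by (intro conjI) (auto simp: algebra_simps intro!: exI[of _ "M + \<bar>c\<bar> * M'"])
qed

lemma bdd_linear_LIMSEQ:
  assumes l: "bdd_linear l" and "\<And>n. u n \<in> V" "v \<in> V" and lim: "(\<lambda>n. nrm (u n - v)) \<longlonglongrightarrow> 0"
  shows "(\<lambda>n. l (u n)) \<longlonglongrightarrow> l v"
proof -
  obtain M where M: "\<And>u. u \<in> V \<Longrightarrow> \<bar>l u\<bar> \<le> M * nrm u" using l unfolding bdd_linear_def by blast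
  have "(\<lambda>n. l (u n) - l v) \<longlonglongrightarrow> 0"
  proof (rule Lim_null_comparison)
    show "\<forall>\<^sub>F n in sequentially. norm (l (u n) - l v) \<le> M * nrm (u n - v)"
      using assms M[of "u _ - v"] by (auto simp: bdd_linear_diff[symmetric])
    show "(\<lambda>n. M * nrm (u n - v)) \<longlonglongrightarrow> 0"
      using tendsto_mult_right_zero[OF lim] .
  qed
  then show ?thesis by (simp add: LIM_zero_iff)
qed

lemma B_self_LIMSEQ:
  assumes "\<And>n. u n \<in> V" "v \<in> V" and lim: "(\<lambda>n. nrm (u n - v)) \<longlonglongrightarrow> 0"
  shows "(\<lambda>n. nrm (u n)) \<longlonglongrightarrow> nrm v"
proof -
  have "(\<lambda>n. nrm (u n) - nrm v) \<longlonglongrightarrow> 0"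
  proof (rule Lim_null_comparison[OF _ lim])
    show "\<forall>\<^sub>F n in sequentially. norm (nrm (u n) - nrm v) \<le> nrm (u n - v)"
      using assms nrm_le_diff[of "u _" v] nrm_le_diff[of v "u _"] nrm_diff_commute[of v "u _"]
      by (intro always_eventually allI) (simp add: abs_le_iff algebra_simps)
  qed
  then show ?thesis by (simp add: LIM_zero_iff)
qed

text \<open>By the parallelogram law, two nearly minimal points of a set closed under midpoints are close to
  each other. Decreasing sets are allowed in order to cover two uses: a constant sequence yields
  minimizers, and shrinking neighbourhoods of a weak limit yield Mazur's lemma.\<close>

lemma Cauchy_selection:
  assumes l: "bdd_linear l" and CV: "\<And>n. C n \<subseteq> V" and dec: "decseq C"
    and mid: "\<And>n u v. u \<in> C n \<Longrightarrow> v \<in> C n \<Longrightarrow> (1/2) *\<^sub>R (u + v) \<in> C n"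
    and bd: "\<And>n. \<exists>v\<in>C n. B v v / 2 - l v \<le> R"
  obtains v u where "\<And>n. v n \<in> C n" "u \<in> V" "(\<lambda>n. nrm (v n - u)) \<longlonglongrightarrow> 0"
    "\<And>n w. w \<in> C n \<Longrightarrow> B (v n) (v n) / 2 - l (v n) \<le> B w w / 2 - l w + 1 / real (Suc n)"
proof -
  define J where "J u = B u u / 2 - l u" for u
  obtain M where M: "M \<ge> 0" "\<And>u. u \<in> V \<Longrightarrow> \<bar>l u\<bar> \<le> M * nrm u" using l by (auto simp: bdd_linear_def)
  have J_lower: "- (M\<^sup>2 / 2) \<le> J u" if "u \<in> V" for u
  proof -
    have "0 \<le> (nrm u - M)\<^sup>2 / 2" by simp
    also have "\<dots> = (nrm u)\<^sup>2 / 2 - M * nrm u + M\<^sup>2 / 2"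
      by (simp add: power2_diff field_simps)
    also have "\<dots> \<le> J u + M\<^sup>2 / 2"
      using M(2)[OF that] by (simp add: J_def nrm_square that)
    finally show ?thesis by simp
  qed
  define d where "d n = Inf (J ` C n)" for n
  have bdb: "bdd_below (J ` C n)" for n
    using J_lower CV by (intro bdd_belowI[of _ "- (M\<^sup>2 / 2)"]) auto
  have ne: "C n \<noteq> {}" for n using bd[of n] by auto
  have d_le: "d n \<le> J w" if "w \<in> C n" for n w
    unfolding d_def by (rule cInf_lower[OF _ bdb]) (use that in auto)
  have d_R: "d n \<le> R" for n
    using bd[of n] d_le by (auto simp: J_def intro: order_trans)
  have "incseq d"
    unfolding d_def
  proof (rule monoI, rule cInf_mono)
    fix i j :: nat assume "i \<le> j"
    then have sub: "C j \<subseteq> C i" using dec by (auto simp: decseq_def)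
    show "J ` C j \<noteq> {}" using ne by auto
    show "bdd_below (J ` C i)" by (rule bdb)
    show "\<exists>a\<in>J ` C i. a \<le> b" if "b \<in> J ` C j" for b using that sub by auto
  qed
  then obtain e where e: "d \<longlonglongrightarrow> e" and d_e: "\<And>n. d n \<le> e"
    using incseq_convergent[of d R] d_R by metis
  have "\<exists>w\<in>C n. J w < d n + 1 / real (Suc n)" for n
  proof -
    have "Inf (J ` C n) < d n + 1 / real (Suc n)" by (simp add: d_def)
    then show ?thesis using cInf_less_iff[OF _ bdb, of n] ne by auto
  qed
  then obtain v where v: "\<And>n. v n \<in> C n" "\<And>n. J (v n) < d n + 1 / real (Suc n)" by metis
  have vV: "v n \<in> V" for n using v CV by auto
  have sq: "(nrm (v i - v j))\<^sup>2 \<le> 8 * (e + 1 / real (Suc n) - d n)" if "i \<ge> n" "j \<ge> n" for i j n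
  proof -
    have "v i \<in> C n" "v j \<in> C n" using that v(1)[of i] v(1)[of j] decseqD[OF dec] by blast+
    then have "d n \<le> J ((1/2) *\<^sub>R (v i + v j))" using mid d_le by blast
    also have "\<dots> = (J (v i) + J (v j)) / 2 - (nrm (v i - v j))\<^sup>2 / 8"
      using vV by (simp add: J_def bilinear_simps nrm_square bdd_linear_scale[OF l] bdd_linear_add[OF l] field_simps)
    finally have "(nrm (v i - v j))\<^sup>2 \<le> 4 * (J (v i) + J (v j)) - 8 * d n" by argo
    moreover have "J (v i) \<le> e + 1 / real (Suc n)" "J (v j) \<le> e + 1 / real (Suc n)"
      using v(2)[of i] v(2)[of j] d_e[of i] d_e[of j] that
        frac_le[of 1 1 "real (Suc n)" "real (Suc i)"] frac_le[of 1 1 "real (Suc n)" "real (Suc j)"]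
      by auto
    ultimately show ?thesis by simp
  qed
  have lim0: "(\<lambda>n. 8 * (e + 1 / real (Suc n) - d n)) \<longlonglongrightarrow> 8 * (e + 0 - e)"
    by (intro tendsto_intros e LIMSEQ_inverse_real_of_nat[unfolded inverse_eq_divide])
  have "\<exists>u\<in>V. (\<lambda>n. nrm (v n - u)) \<longlonglongrightarrow> 0"
    unfolding nrm_def
  proof (rule complete[OF vV])
    fix \<epsilon> :: real assume "\<epsilon> > 0"
    then have "\<forall>\<^sub>F n in sequentially. 8 * (e + 1 / real (Suc n) - d n) < \<epsilon>\<^sup>2"
      using order_tendstoD(2)[OF lim0] by simp
    then obtain N where "8 * (e + 1 / real (Suc N) - d N) < \<epsilon>\<^sup>2"
      by (auto simp: eventually_sequentially)
    then have "(nrm (v i - v j))\<^sup>2 < \<epsilon>\<^sup>2" if "i \<ge> N" "j \<ge> N" for i j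
      using sq[OF that] by simp
    then show "\<exists>N. \<forall>i\<ge>N. \<forall>j\<ge>N. sqrt (B (v i - v j) (v i - v j)) < \<epsilon>"
      using \<open>\<epsilon> > 0\<close> by (auto simp: nrm_def[symmetric] intro!: exI[of _ N] intro: power2_less_imp_less)
  qed
  then obtain u where "u \<in> V" "(\<lambda>n. nrm (v n - u)) \<longlonglongrightarrow> 0" by auto
  moreover have "B (v n) (v n) / 2 - l (v n) \<le> B w w / 2 - l w + 1 / real (Suc n)" if "w \<in> C n" for n w
    using v(2)[of n] d_le[OF that] by (simp add: J_def)
  ultimately show ?thesis using that v(1) by blast
qed

definition norm_closed :: "'v set \<Rightarrow> bool" where
  "norm_closed C \<longleftrightarrow> (\<forall>u v. (\<forall>n::nat. u n \<in> C) \<and> v \<in> V \<and> (\<lambda>n. nrm (u n - v)) \<longlonglongrightarrow> 0 \<longrightarrow> v \<in> C)"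

text \<open>The solution minimizes \<open>B w w / 2 - l w\<close> over \<open>C\<close>; the inequality says that the one-sided
  derivatives at the minimum are nonnegative.\<close>

lemma symmetric_variational_inequality:
  assumes C: "C \<subseteq> V" "C \<noteq> {}" "convex C" "norm_closed C" and l: "bdd_linear l"
  shows "\<exists>u\<in>C. \<forall>w\<in>C. l (w - u) \<le> (B u (w - u) + B (w - u) u) / 2"
proof -
  obtain c where c: "c \<in> C" using C by auto
  have mid: "(1/2) *\<^sub>R (u + v) \<in> C" if "u \<in> C" "v \<in> C" for u v
    using convexD[OF C(3) that, of "1/2" "1/2"] by (simp add: scaleR_add_right)
  obtain v u where v: "\<And>n. v n \<in> C" and u: "u \<in> V" and lim: "(\<lambda>n. nrm (v n - u)) \<longlonglongrightarrow> 0"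
    and opt: "\<And>(n::nat) w. w \<in> C \<Longrightarrow> B (v n) (v n) / 2 - l (v n) \<le> B w w / 2 - l w + 1 / real (Suc n)"
    using Cauchy_selection[OF l, of "\<lambda>n. C" "B c c / 2 - l c"] C c mid by (auto simp: decseq_def)
  have uC: "u \<in> C" using C(4) v u lim by (auto simp: norm_closed_def)
  have vV: "v n \<in> V" for n using v C by auto
  have opt': "B u u / 2 - l u \<le> B w w / 2 - l w" if w: "w \<in> C" for w
  proof (rule LIMSEQ_le)
    have "(\<lambda>n. (nrm (v n))\<^sup>2 / 2 - l (v n)) \<longlonglongrightarrow> (nrm u)\<^sup>2 / 2 - l u"
      by (intro tendsto_intros B_self_LIMSEQ bdd_linear_LIMSEQ[OF l] vV u lim) auto
    then show "(\<lambda>n. B (v n) (v n) / 2 - l (v n)) \<longlonglongrightarrow> B u u / 2 - l u"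
      using vV u by (simp add: nrm_square)
    have "(\<lambda>n. B w w / 2 - l w + 1 / real (Suc n)) \<longlonglongrightarrow> B w w / 2 - l w + 0"
      by (intro tendsto_intros LIMSEQ_inverse_real_of_nat[unfolded inverse_eq_divide])
    then show "(\<lambda>n. B w w / 2 - l w + 1 / real (Suc n)) \<longlonglongrightarrow> B w w / 2 - l w" by simp
  qed (use opt[OF w] in auto)
  have "l (w - u) \<le> (B u (w - u) + B (w - u) u) / 2" if w: "w \<in> C" for w
  proof -
    define z where "z = w - u"
    have zV: "z \<in> V" using w u C by (auto simp: z_def)
    have "0 \<le> (B u z + B z u) / 2 - l z + t * (B z z / 2)" if t: "0 < t" "t < 1" for t
    proof -
      have "u + t *\<^sub>R z = (1 - t) *\<^sub>R u + t *\<^sub>R w" by (simp add: z_def algebra_simps)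
      then have "u + t *\<^sub>R z \<in> C" using convexD[OF C(3) uC w, of "1 - t" t] t by simp
      from opt'[OF this] have "0 \<le> t * ((B u z + B z u) / 2 - l z + t * (B z z / 2))"
        using u zV by (simp add: bilinear_simps bdd_linear_add[OF l] bdd_linear_scale[OF l] field_simps)
      then show ?thesis using t by (simp add: zero_le_mult_iff)
    qed
    moreover have "((\<lambda>t. (B u z + B z u) / 2 - l z + t * (B z z / 2)) \<longlongrightarrow> (B u z + B z u) / 2 - l z + 0 * (B z z / 2)) (at_right 0)"
      by (intro tendsto_intros)
    moreover have "\<forall>\<^sub>F t in at_right (0::real). 0 < t \<and> t < 1"
      by (rule eventually_at_rightI[of 0 1]) auto
    ultimately have "0 \<le> (B u z + B z u) / 2 - l z + 0 * (B z z / 2)"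
      by (intro tendsto_lowerbound[where F = "at_right (0::real)"]) (auto elim: eventually_mono)
    then show ?thesis by (simp add: z_def)
  qed
  with uC show ?thesis by blast
qed

text \<open>The theorem of Lions and Stampacchia by the continuity method. The forms \<open>a + t b\<close>, with \<open>a\<close> the
  symmetric and \<open>b\<close> the antisymmetric part of \<open>B\<close>, join \<open>a\<close> to \<open>B\<close>. As \<open>b u u = 0\<close>, they all have
  the same quadratic form, so that passing from \<open>t\<close> to \<open>t + \<delta>\<close> is a fixed point problem for a
  contraction as soon as \<open>\<delta> K \<le> 1/2\<close>, however large \<open>t\<close> is. Finitely many steps lead to \<open>B\<close>.\<close>

theorem variational_inequality:
  assumes C: "C \<subseteq> V" "C \<noteq> {}" "convex C" "norm_closed C" and l: "bdd_linear l"
  shows "\<exists>u\<in>C. \<forall>w\<in>C. l (w - u) \<le> B u (w - u)"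
proof -
  define a where "a u v = (B u v + B v u) / 2" for u v
  define b where "b u v = (B u v - B v u) / 2" for u v
  have b_linear: "bdd_linear (b u)" if "u \<in> V" for u
  proof -
    have "bdd_linear (\<lambda>v. B u v / 2 - (1/2) * B v u)"
    proof (rule bdd_linear_combine)
      show "bdd_linear (\<lambda>v. B v u)" by (rule bdd_linear_left[OF that])
      show "bdd_linear (\<lambda>v. B u v / 2)"
        using bdd_linear_right[of "(1/2) *\<^sub>R u"] that by (simp add: scale_left bdd_linear_def)
    qed
    then show ?thesis by (simp add: b_def[abs_def] diff_divide_distrib)
  qed
  have b_bound: "\<bar>b u v\<bar> \<le> K * nrm u * nrm v" if "u \<in> V" "v \<in> V" for u v
    using sector_nrm[OF that] sector_nrm[OF that(2,1)] by (auto simp: b_def ac_simps)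
  define N where "N = nat \<lceil>2 * K\<rceil>"
  have N: "real N \<ge> 2 * K" "N > 0" using K_pos by (auto simp: N_def)
  define \<delta> where "\<delta> = 1 / real N"
  have \<delta>: "0 < \<delta>" "\<delta> * K \<le> 1/2" using N K_pos by (auto simp: \<delta>_def field_simps)
  have "\<forall>l. bdd_linear l \<longrightarrow> (\<exists>u\<in>C. \<forall>w\<in>C. l (w - u) \<le> a u (w - u) + (real n * \<delta>) * b u (w - u))" for n
  proof (induction n)
    case 0
    then show ?case using symmetric_variational_inequality[OF C] by (simp add: a_def)
  next
    case (Suc n)
    define t where "t = real n * \<delta>"
    show ?case
    proof (intro allI impI)
      fix l assume l: "bdd_linear l"
      have "\<exists>u\<in>C. \<forall>w\<in>C. l (w - u) - \<delta> * b p (w - u) \<le> a u (w - u) + t * b u (w - u)" if "p \<in> V" for p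
        using Suc.IH bdd_linear_combine[OF l b_linear[OF that], of \<delta>] by (auto simp: t_def)
      then obtain T where T: "\<And>p. p \<in> V \<Longrightarrow> T p \<in> C"
          "\<And>p w. p \<in> V \<Longrightarrow> w \<in> C \<Longrightarrow> l (w - T p) - \<delta> * b p (w - T p) \<le> a (T p) (w - T p) + t * b (T p) (w - T p)"
        by metis
      have contr: "nrm (T p - T q) \<le> (1/2) * nrm (p - q)" if p: "p \<in> V" and q: "q \<in> V" for p q
      proof -
        define d where "d = T p - T q"
        have V: "T p \<in> V" "T q \<in> V" "d \<in> V" using T(1) p q C(1) by (auto simp: d_def)
        have "l (- d) - \<delta> * b p (- d) \<le> a (T p) (- d) + t * b (T p) (- d)"
          using T(2)[OF p T(1)[OF q]] by (simp add: d_def)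
        moreover have "l d - \<delta> * b q d \<le> a (T q) d + t * b (T q) d"
          using T(2)[OF q T(1)[OF p]] by (simp add: d_def)
        moreover have "l (- d) = - l d" using bdd_linear_scale[OF l V(3), of "-1"] by simp
        ultimately have "a (T p) d - a (T q) d + t * (b (T p) d - b (T q) d) \<le> \<delta> * (b q d - b p d)"
          using V p q by (simp add: a_def b_def bilinear_simps field_simps)
        moreover have "a (T p) d - a (T q) d + t * (b (T p) d - b (T q) d) = B d d"
          using V by (simp add: a_def b_def d_def bilinear_simps field_simps)
        moreover have "b q d - b p d = b (q - p) d"
          using V p q by (simp add: b_def bilinear_simps field_simps)
        ultimately have "(nrm d)\<^sup>2 \<le> \<delta> * b (q - p) d" using V by (simp add: nrm_square)
        also have "\<dots> \<le> \<delta> * (K * nrm (q - p) * nrm d)"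
          using b_bound[of "q - p" d] V p q \<delta> by (intro mult_left_mono) auto
        also have "\<dots> = (\<delta> * K) * (nrm (p - q) * nrm d)" using p q by (simp add: nrm_diff_commute)
        also have "\<dots> \<le> (1/2) * (nrm (p - q) * nrm d)"
          using \<delta> V p q by (intro mult_right_mono mult_nonneg_nonneg) auto
        finally have "(nrm d)\<^sup>2 \<le> (1/2) * nrm (p - q) * nrm d" by simp
        then have "nrm d \<le> (1/2) * nrm (p - q)"
          using zero_of_sector_square[of d "p - q" "1/2"] V p q by simp
        then show ?thesis by (simp add: d_def)
      qed
      obtain c where c: "c \<in> C" using C(2) by auto
      define u where "u n = (T ^^ n) c" for n
      have uC: "u n \<in> C" for n using c T(1) C(1) by (induction n) (auto simp: u_def)
      have uV: "u n \<in> V" for n using uC C(1) by auto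
      have uSuc: "u (Suc n) = T (u n)" for n by (simp add: u_def)
      define D0 where "D0 = nrm (u 1 - u 0)"
      have step: "nrm (u (Suc n) - u n) \<le> (1/2)^n * D0" for n
      proof (induction n)
        case 0 then show ?case by (simp add: D0_def)
      next
        case (Suc n)
        have "nrm (u (Suc (Suc n)) - u (Suc n)) \<le> (1/2) * nrm (u (Suc n) - u n)"
          using contr[OF uV uV] uSuc by metis
        then show ?case using Suc by simp
      qed
      have tail: "nrm (u (n + k) - u n) \<le> (1/2)^n * (2 * D0) - (1/2)^(n+k) * (2 * D0)" for n k
      proof (induction k)
        case 0 then show ?case by simp
      next
        case (Suc k)
        have "nrm (u (n + Suc k) - u n) \<le> nrm (u (n + Suc k) - u (n + k)) + nrm (u (n + k) - u n)"
          by (rule nrm_triangle_diff[OF uV uV uV])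
        also have "\<dots> \<le> (1/2)^(n+k) * D0 + ((1/2)^n * (2 * D0) - (1/2)^(n+k) * (2 * D0))"
          using step[of "n + k"] Suc by (intro add_mono) auto
        finally show ?case by (simp add: mult.commute)
      qed
      have D0: "D0 \<ge> 0" using uV by (simp add: D0_def)
      have tail': "nrm (u i - u j) \<le> (1/2)^N * (4 * D0)" if "i \<ge> N" "j \<ge> N" for i j N
      proof -
        have *: "nrm (u i - u N) \<le> (1/2)^N * (2 * D0)" if "i \<ge> N" for i
        proof -
          have "nrm (u (N + (i - N)) - u N) \<le> (1/2)^N * (2 * D0)"
            by (rule order_trans[OF tail[of N "i - N"]]) (simp add: D0)
          then show ?thesis using that by simp
        qed
        show ?thesis
          using nrm_triangle_diff[of "u i" "u N" "u j"] uV *[OF that(1)] *[OF that(2)] nrm_diff_commute[OF uV uV, of N j]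
          by simp
      qed
      have pow0: "(\<lambda>n. (1/2)^n * (4 * D0)) \<longlonglongrightarrow> 0"
        by (rule tendsto_mult_left_zero, rule LIMSEQ_realpow_zero) auto
      have "\<exists>v\<in>V. (\<lambda>n. nrm (u n - v)) \<longlonglongrightarrow> 0"
        unfolding nrm_def
      proof (rule complete[OF uV])
        fix \<epsilon> :: real assume "\<epsilon> > 0"
        then obtain N where "(1/2)^N * (4 * D0) < \<epsilon>"
          using order_tendstoD(2)[OF pow0, of \<epsilon>] by (auto simp: eventually_sequentially)
        then show "\<exists>N. \<forall>i\<ge>N. \<forall>j\<ge>N. sqrt (B (u i - u j) (u i - u j)) < \<epsilon>"
          using tail'[of N] unfolding nrm_def[symmetric] by (intro exI[of _ N]) (meson order_le_less_trans)
      qed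
      then obtain v where v: "v \<in> V" and lim: "(\<lambda>n. nrm (u n - v)) \<longlonglongrightarrow> 0" by auto
      have vC: "v \<in> C" using C(4) uC v lim by (auto simp: norm_closed_def)
      have "nrm (T v - v) \<le> 0"
      proof (rule LIMSEQ_le_const)
        have "(\<lambda>n. (1/2) * nrm (u n - v) + nrm (u (Suc n) - v)) \<longlonglongrightarrow> (1/2) * 0 + 0"
          by (intro tendsto_intros lim LIMSEQ_Suc[OF lim])
        then show "(\<lambda>n. (1/2) * nrm (u n - v) + nrm (u (Suc n) - v)) \<longlonglongrightarrow> 0" by simp
        have "nrm (T v - v) \<le> (1/2) * nrm (u n - v) + nrm (u (Suc n) - v)" for n
        proof -
          have "T v \<in> V" using T(1)[OF v] C(1) by auto
          from nrm_triangle_diff[OF this uV[of "Suc n"] v] show ?thesis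
            using contr[OF v uV[of n]] nrm_diff_commute[OF v uV[of n]] by (simp add: uSuc)
        qed
        then show "\<exists>N. \<forall>n\<ge>N. nrm (T v - v) \<le> (1/2) * nrm (u n - v) + nrm (u (Suc n) - v)" by auto
      qed
      moreover have TV: "T v \<in> V" using T(1)[OF v] C(1) by auto
      ultimately have fix0: "nrm (v - T v) = 0"
        using nrm_nonneg[OF V_diff[OF TV v]] nrm_diff_commute[OF v TV] by linarith
      \<comment> \<open>the fixed point is one only up to vectors of norm zero, which the forms do not see\<close>
      have "b v z = b (T v) z" if "z \<in> V" for z
      proof -
        have "b (v - T v) z = b v z - b (T v) z" using v TV that by (simp add: b_def bilinear_simps field_simps)
        then show ?thesis using b_bound[of "v - T v" z] v TV that fix0 by simp
      qed
      then have "l (w - T v) \<le> a (T v) (w - T v) + (real (Suc n) * \<delta>) * b (T v) (w - T v)" if "w \<in> C" for w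
        using T(2)[OF v that] that C(1) TV by (auto simp: t_def algebra_simps)
      then show "\<exists>u\<in>C. \<forall>w\<in>C. l (w - u) \<le> a u (w - u) + (real (Suc n) * \<delta>) * b u (w - u)"
        using T(1)[OF v] by blast
    qed
  qed
  from this[of N] l have "\<exists>u\<in>C. \<forall>w\<in>C. l (w - u) \<le> a u (w - u) + (real N * \<delta>) * b u (w - u)" by blast
  moreover have "a u v + (real N * \<delta>) * b u v = B u v" for u v
    using N by (simp add: a_def b_def \<delta>_def field_simps)
  ultimately show ?thesis by simp
qed

corollary Lax_Milgram:
  assumes l: "bdd_linear l"
  shows "\<exists>u\<in>V. \<forall>w\<in>V. B u w = l w"
proof -
  have "convex V" by (rule subspace_imp_convex[OF subspace_V])
  moreover have "V \<noteq> {}" by auto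
  moreover have "norm_closed V" by (auto simp: norm_closed_def)
  ultimately obtain u where u: "u \<in> V" "\<And>w. w \<in> V \<Longrightarrow> l (w - u) \<le> B u (w - u)"
    using variational_inequality[OF _ _ _ _ l, of V] by blast
  have "B u w = l w" if "w \<in> V" for w
  proof (rule antisym)
    show "l w \<le> B u w" using u(2)[of "u + w"] u(1) that by simp
    show "B u w \<le> l w"
      using u(2)[of "u - w"] u(1) that bdd_linear_scale[OF l that, of "-1"] by (simp add: bilinear_simps)
  qed
  with u(1) show ?thesis by blast
qed

end

section \<open>Weak limits in form domains\<close>

lemma square_add_le: "(a + b)\<^sup>2 \<le> 2 * a\<^sup>2 + 2 * (b::real)\<^sup>2"
proof -
  have "0 \<le> (a - b)\<^sup>2" by simp
  then show ?thesis by (simp add: power2_sum power2_diff)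
qed

lemma L2_measurable: "u \<in> L2 m \<Longrightarrow> u \<in> borel_measurable m"
  and L2_integrable: "u \<in> L2 m \<Longrightarrow> integrable m (\<lambda>x. (u x)\<^sup>2)"
  by (auto simp: L2_def)

lemma L2_dominated:
  assumes f: "f \<in> L2 m" and u: "u \<in> borel_measurable m" and le: "AE x in m. \<bar>u x\<bar> \<le> \<bar>f x\<bar>"
  shows "u \<in> L2 m"
  unfolding L2_def
proof (safe intro!: u Bochner_Integration.integrable_bound[OF L2_integrable[OF f]])
  show "AE x in m. norm ((u x)\<^sup>2) \<le> norm ((f x)\<^sup>2)"
    using le by eventually_elim (simp add: abs_le_square_iff)
qed (use u in measurable)

lemma L2_add:
  assumes "u \<in> L2 m" "v \<in> L2 m"
  shows "(\<lambda>x. u x + v x) \<in> L2 m"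
proof -
  have [measurable]: "u \<in> borel_measurable m" "v \<in> borel_measurable m" using assms by (auto simp: L2_def)
  have "integrable m (\<lambda>x. (u x + v x)\<^sup>2)"
  proof (rule Bochner_Integration.integrable_bound)
    show "integrable m (\<lambda>x. 2 * (u x)\<^sup>2 + 2 * (v x)\<^sup>2)"
      using assms by (intro Bochner_Integration.integrable_add integrable_mult_right L2_integrable)
  qed (auto simp: square_add_le)
  then show ?thesis by (simp add: L2_def)
qed

lemma L2_scale: "u \<in> L2 m \<Longrightarrow> (\<lambda>x. c * u x) \<in> L2 m"
  by (auto simp: L2_def power_mult_distrib)

lemma L2_diff: "u \<in> L2 m \<Longrightarrow> v \<in> L2 m \<Longrightarrow> (\<lambda>x. u x - v x) \<in> L2 m"
  using L2_add[of u m "\<lambda>x. (-1) * v x"] L2_scale[of v m "-1"] by simp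

lemma L2_mult_integrable:
  assumes "u \<in> L2 m" "v \<in> L2 m"
  shows "integrable m (\<lambda>x. u x * v x)"
proof (rule Bochner_Integration.integrable_bound)
  show "integrable m (\<lambda>x. (u x)\<^sup>2 + (v x)\<^sup>2)"
    using assms by (intro Bochner_Integration.integrable_add L2_integrable)
  have "\<bar>u x * v x\<bar> \<le> (u x)\<^sup>2 + (v x)\<^sup>2" for x
  proof -
    have "0 \<le> (\<bar>u x\<bar> - \<bar>v x\<bar>)\<^sup>2" by simp
    moreover have "0 \<le> (u x)\<^sup>2" "0 \<le> (v x)\<^sup>2" by auto
    moreover have "0 \<le> \<bar>u x\<bar> * \<bar>v x\<bar>" by simp
    ultimately show ?thesis unfolding power2_diff abs_mult power2_abs by argo
  qed
  then show "AE x in m. norm (u x * v x) \<le> norm ((u x)\<^sup>2 + (v x)\<^sup>2)" by simp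
qed (use assms in \<open>auto simp: L2_def\<close>)

lemma L2_dominated_convergence:
  assumes u: "\<And>n. u n \<in> L2 m" and w: "w \<in> borel_measurable m" and f: "f \<in> L2 m"
    and le: "\<And>n. AE x in m. \<bar>u n x\<bar> \<le> f x" and lim: "AE x in m. (\<lambda>n. u n x) \<longlonglongrightarrow> w x"
  shows "w \<in> L2 m" "(\<lambda>n. \<integral>x. (u n x - w x)\<^sup>2 \<partial>m) \<longlonglongrightarrow> 0"
proof -
  have le': "AE x in m. \<forall>n. \<bar>u n x\<bar> \<le> f x" using le by (simp add: AE_all_countable)
  have w_le: "AE x in m. \<bar>w x\<bar> \<le> f x"
    using le' lim
  proof eventually_elim
    case (elim x)
    show ?case
      by (rule LIMSEQ_le_const2[OF tendsto_rabs[OF elim(2)]]) (use elim in auto)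
  qed
  have [measurable]: "u n \<in> borel_measurable m" for n using u by (auto simp: L2_def)
  note [measurable] = w
  show wL2: "w \<in> L2 m"
    by (rule L2_dominated[OF f w]) (use w_le in \<open>auto elim: eventually_mono\<close>)
  have "(\<lambda>n. \<integral>x. (u n x - w x)\<^sup>2 \<partial>m) \<longlonglongrightarrow> (\<integral>x. 0 \<partial>m)"
  proof (rule integral_dominated_convergence)
    show "integrable m (\<lambda>x. 4 * (f x)\<^sup>2)" using L2_integrable[OF f] by simp
    show "AE x in m. (\<lambda>n. (u n x - w x)\<^sup>2) \<longlonglongrightarrow> 0"
      using lim
    proof eventually_elim
      case (elim x)
      have "(\<lambda>n. (u n x - w x)\<^sup>2) \<longlonglongrightarrow> (w x - w x)\<^sup>2" by (intro tendsto_intros elim)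
      then show ?case by simp
    qed
    show "AE x in m. norm ((u n x - w x)\<^sup>2) \<le> 4 * (f x)\<^sup>2" for n
      using le[of n] w_le
    proof eventually_elim
      case (elim x)
      then have "\<bar>u n x - w x\<bar> \<le> \<bar>2 * f x\<bar>" by linarith
      then show ?case by (simp add: abs_le_square_iff power_mult_distrib)
    qed
  qed auto
  then show "(\<lambda>n. \<integral>x. (u n x - w x)\<^sup>2 \<partial>m) \<longlonglongrightarrow> 0" by simp
qed

lemma AE_zero_of_integral_square:
  assumes "u \<in> L2 m" "(\<integral>x. (u x)\<^sup>2 \<partial>m) \<le> 0"
  shows "AE x in m. u x = 0"
proof -
  have "(\<integral>x. (u x)\<^sup>2 \<partial>m) = 0" using assms(2) by (simp add: antisym)
  then have "AE x in m. (u x)\<^sup>2 = 0"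
    using integral_nonneg_eq_0_iff_AE[OF L2_integrable[OF assms(1)]] by simp
  then show ?thesis by simp
qed

definition pos_part :: "('a \<Rightarrow> real) \<Rightarrow> 'a \<Rightarrow> real" where
  "pos_part u = (\<lambda>x. max (u x) 0)"

lemma pos_part_apply [simp]: "pos_part u x = max (u x) 0"
  by (simp add: pos_part_def)

locale L2_form = coercive_form V B K
  for V :: "('a \<Rightarrow> real) set" and B :: "('a \<Rightarrow> real) \<Rightarrow> ('a \<Rightarrow> real) \<Rightarrow> real" and K :: real +
  fixes m :: "'a measure"
  assumes V_L2: "V \<subseteq> L2 m"
    and V_cong_AE: "\<And>u v. u \<in> V \<Longrightarrow> v \<in> borel_measurable m \<Longrightarrow> (AE x in m. u x = v x) \<Longrightarrow> v \<in> V"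
    and B_cong_AE: "\<And>u u' v v'. u \<in> V \<Longrightarrow> u' \<in> V \<Longrightarrow> v \<in> V \<Longrightarrow> v' \<in> V \<Longrightarrow>
          (AE x in m. u x = u' x) \<Longrightarrow> (AE x in m. v x = v' x) \<Longrightarrow> B u v = B u' v'"
    and L2_le_B: "\<And>u. u \<in> V \<Longrightarrow> (\<integral>x. (u x)\<^sup>2 \<partial>m) \<le> B u u"
begin

lemma V_in_L2 [intro]: "u \<in> V \<Longrightarrow> u \<in> L2 m"
  using V_L2 by auto

lemma V_measurable [measurable_dest]: "u \<in> V \<Longrightarrow> u \<in> borel_measurable m"
  using V_L2 by (auto simp: L2_def)

lemma AE_zero_of_B_zero: "u \<in> V \<Longrightarrow> B u u \<le> 0 \<Longrightarrow> AE x in m. u x = 0"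
  using AE_zero_of_integral_square[of u m] L2_le_B[of u] by auto

lemma nrm_zero_AE: "u \<in> V \<Longrightarrow> AE x in m. u x = 0 \<Longrightarrow> nrm u = 0"
  using B_cong_AE[of u 0 u 0] by (simp add: nrm_def)

lemma nrm_cong_AE: "u \<in> V \<Longrightarrow> v \<in> V \<Longrightarrow> AE x in m. u x = v x \<Longrightarrow> nrm u = nrm v"
  using B_cong_AE[of u v u v] by (simp add: nrm_def)

lemma bdd_linear_cong_AE:
  assumes l: "bdd_linear l" and "u \<in> V" "v \<in> V" "AE x in m. u x = v x"
  shows "l u = l v"
proof -
  have "nrm (u - v) = 0" using assms by (intro nrm_zero_AE) auto
  moreover obtain M where "\<bar>l (u - v)\<bar> \<le> M * nrm (u - v)"
    using l assms(2,3) unfolding bdd_linear_def by blast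
  ultimately show ?thesis using bdd_linear_diff[OF l assms(2,3)] by simp
qed

lemma L2_LIMSEQ_of_nrm:
  assumes "\<And>n. u n \<in> V" "v \<in> V" and lim: "(\<lambda>n. nrm (u n - v)) \<longlonglongrightarrow> 0"
  shows "(\<lambda>n. \<integral>x. (u n x - v x)\<^sup>2 \<partial>m) \<longlonglongrightarrow> 0"
proof (rule Lim_null_comparison)
  show "\<forall>\<^sub>F n in sequentially. norm (\<integral>x. (u n x - v x)\<^sup>2 \<partial>m) \<le> (nrm (u n - v))\<^sup>2"
    using L2_le_B[of "u _ - v"] assms by (auto simp: nrm_square intro!: always_eventually)
  show "(\<lambda>n. (nrm (u n - v))\<^sup>2) \<longlonglongrightarrow> 0"
    using tendsto_power[OF lim, of 2] by simp
qed

lemma AE_subsequence: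
  assumes "\<And>n. u n \<in> V" "v \<in> V" and lim: "(\<lambda>n. nrm (u n - v)) \<longlonglongrightarrow> 0"
  obtains r :: "nat \<Rightarrow> nat" where "strict_mono r" "AE x in m. (\<lambda>n. u (r n) x) \<longlonglongrightarrow> v x"
proof -
  have "\<exists>r::nat\<Rightarrow>nat. strict_mono r \<and> (AE x in m. (\<lambda>n. (u (r n) x - v x)\<^sup>2) \<longlonglongrightarrow> 0)"
  proof (rule tendsto_L1_AE_subseq)
    show "integrable m (\<lambda>x. (u n x - v x)\<^sup>2)" for n
      using assms(1,2) by (intro L2_integrable L2_diff) auto
    show "(\<lambda>n. \<integral>x. norm ((u n x - v x)\<^sup>2) \<partial>m) \<longlonglongrightarrow> 0"
      using L2_LIMSEQ_of_nrm[OF assms] by simp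
  qed
  then obtain r where r: "strict_mono r" and ae: "AE x in m. (\<lambda>n. (u (r n) x - v x)\<^sup>2) \<longlonglongrightarrow> 0" by auto
  have "AE x in m. (\<lambda>n. u (r n) x) \<longlonglongrightarrow> v x"
    using ae
  proof eventually_elim
    case (elim x)
    then have "(\<lambda>n. sqrt ((u (r n) x - v x)\<^sup>2)) \<longlonglongrightarrow> sqrt 0" by (intro tendsto_intros)
    then have "(\<lambda>n. u (r n) x - v x) \<longlonglongrightarrow> 0" by (simp add: tendsto_rabs_zero_iff)
    then show ?case by (simp add: LIM_zero_iff)
  qed
  with r that show ?thesis by blast
qed

text \<open>The vectors with property \<open>P\<close> at \<open>L\<^sup>2\<close> distance at most \<open>1 / (n + 1)\<close> from \<open>u\<close> form decreasing
  midpoint-convex sets that contain vectors of bounded energy, so a norm convergent sequence can be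
  selected from them. Its limit is a version of \<open>u\<close>.\<close>

lemma Mazur:
  assumes u: "u \<in> L2 m"
    and mid: "\<And>v w. v \<in> V \<Longrightarrow> w \<in> V \<Longrightarrow> P v \<Longrightarrow> P w \<Longrightarrow> P ((1/2) *\<^sub>R (v + w))"
    and approx: "\<And>\<epsilon>. 0 < \<epsilon> \<Longrightarrow> \<exists>v\<in>V. P v \<and> nrm v \<le> R \<and> (\<integral>x. (v x - u x)\<^sup>2 \<partial>m) \<le> \<epsilon>"
  shows "u \<in> V" "\<exists>v. (\<forall>n::nat. v n \<in> V \<and> P (v n)) \<and> (\<lambda>n. nrm (v n - u)) \<longlonglongrightarrow> 0"
proof -
  define C where "C n = {v \<in> V. P v \<and> (\<integral>x. (v x - u x)\<^sup>2 \<partial>m) \<le> 1 / real (Suc n)}" for n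
  have l0: "bdd_linear (\<lambda>_. 0)" by (auto simp: bdd_linear_def)
  obtain v w where v: "\<And>n. v n \<in> C n" and w: "w \<in> V" and lim: "(\<lambda>n. nrm (v n - w)) \<longlonglongrightarrow> 0"
  proof (rule Cauchy_selection[OF l0, of C "R\<^sup>2 / 2"])
    show "C n \<subseteq> V" for n by (auto simp: C_def)
    show "decseq C"
    proof (rule antimonoI, rule subsetI)
      fix i j :: nat and x assume "i \<le> j" "x \<in> C j"
      moreover have "1 / real (Suc j) \<le> 1 / real (Suc i)" using \<open>i \<le> j\<close> by (intro frac_le) auto
      ultimately show "x \<in> C i" by (auto simp: C_def)
    qed
    show "(1/2) *\<^sub>R (p + q) \<in> C n" if p: "p \<in> C n" and q: "q \<in> C n" for p q n
    proof -
      have pq: "p \<in> V" "q \<in> V" using p q by (auto simp: C_def)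
      have i: "integrable m (\<lambda>x. (p x - u x)\<^sup>2)" "integrable m (\<lambda>x. (q x - u x)\<^sup>2)"
        using pq u by (auto intro!: L2_integrable L2_diff)
      have "(1/2) *\<^sub>R (p + q) \<in> V" using pq by auto
      from L2_integrable[OF L2_diff[OF V_in_L2[OF this] u]]
      have i': "integrable m (\<lambda>x. (((1/2) *\<^sub>R (p + q)) x - u x)\<^sup>2)" .
      have "(\<integral>x. (((1/2) *\<^sub>R (p + q)) x - u x)\<^sup>2 \<partial>m)
          \<le> (\<integral>x. (1/2) * (p x - u x)\<^sup>2 + (1/2) * (q x - u x)\<^sup>2 \<partial>m)"
      proof (rule integral_mono[OF i'])
        fix x
        have "((1/2) *\<^sub>R (p + q)) x - u x = (p x - u x) / 2 + (q x - u x) / 2"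
          by (simp add: field_simps)
        then show "(((1/2) *\<^sub>R (p + q)) x - u x)\<^sup>2 \<le> (1/2) * (p x - u x)\<^sup>2 + (1/2) * (q x - u x)\<^sup>2"
          using square_add_le[of "(p x - u x) / 2" "(q x - u x) / 2"] by (simp add: power_divide)
      qed (use i in auto)
      also have "\<dots> = (1/2) * (\<integral>x. (p x - u x)\<^sup>2 \<partial>m) + (1/2) * (\<integral>x. (q x - u x)\<^sup>2 \<partial>m)"
        using i by simp
      also have "\<dots> \<le> 1 / real (Suc n)" using p q by (simp add: C_def field_simps)
      finally show ?thesis using p q mid pq by (auto simp: C_def)
    qed
    show "\<exists>v\<in>C n. B v v / 2 - 0 \<le> R\<^sup>2 / 2" for n
    proof -
      obtain v where v: "v \<in> V" "P v" "nrm v \<le> R" "(\<integral>x. (v x - u x)\<^sup>2 \<partial>m) \<le> 1 / real (Suc n)"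
        using approx[of "1 / real (Suc n)"] by auto
      then have "B v v \<le> R\<^sup>2" using power_mono[of "nrm v" R 2] by (simp add: nrm_square)
      with v show ?thesis by (auto simp: C_def)
    qed
  qed auto
  have vV: "v n \<in> V" for n using v by (auto simp: C_def)
  have "(\<integral>x. (w x - u x)\<^sup>2 \<partial>m) \<le> 0"
  proof (rule LIMSEQ_le_const)
    have "(\<lambda>n. 2 * (\<integral>x. (v n x - w x)\<^sup>2 \<partial>m) + 2 * (1 / real (Suc n))) \<longlonglongrightarrow> 2 * 0 + 2 * 0"
      by (intro tendsto_intros L2_LIMSEQ_of_nrm vV w lim LIMSEQ_inverse_real_of_nat[unfolded inverse_eq_divide])
    then show "(\<lambda>n. 2 * (\<integral>x. (v n x - w x)\<^sup>2 \<partial>m) + 2 * (1 / real (Suc n))) \<longlonglongrightarrow> 0" by simp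
    have "(\<integral>x. (w x - u x)\<^sup>2 \<partial>m) \<le> 2 * (\<integral>x. (v n x - w x)\<^sup>2 \<partial>m) + 2 * (1 / real (Suc n))" for n
    proof -
      have i: "integrable m (\<lambda>x. (v n x - w x)\<^sup>2)" "integrable m (\<lambda>x. (v n x - u x)\<^sup>2)"
         "integrable m (\<lambda>x. (w x - u x)\<^sup>2)"
        using vV w u by (auto intro!: L2_integrable L2_diff)
      have "(\<integral>x. (w x - u x)\<^sup>2 \<partial>m) \<le> (\<integral>x. 2 * (v n x - w x)\<^sup>2 + 2 * (v n x - u x)\<^sup>2 \<partial>m)"
      proof (rule integral_mono)
        show "(w x - u x)\<^sup>2 \<le> 2 * (v n x - w x)\<^sup>2 + 2 * (v n x - u x)\<^sup>2" for x
          using square_add_le[of "w x - v n x" "v n x - u x"] by (simp add: power2_commute)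
      qed (use i in auto)
      also have "\<dots> = 2 * (\<integral>x. (v n x - w x)\<^sup>2 \<partial>m) + 2 * (\<integral>x. (v n x - u x)\<^sup>2 \<partial>m)" using i by simp
      also have "\<dots> \<le> 2 * (\<integral>x. (v n x - w x)\<^sup>2 \<partial>m) + 2 * (1 / real (Suc n))"
        using v[of n] by (simp add: C_def)
      finally show ?thesis .
    qed
    then show "\<exists>N. \<forall>n\<ge>N. (\<integral>x. (w x - u x)\<^sup>2 \<partial>m) \<le> 2 * (\<integral>x. (v n x - w x)\<^sup>2 \<partial>m) + 2 * (1 / real (Suc n))"
      by auto
  qed
  then have "AE x in m. w x - u x = 0" using w u by (intro AE_zero_of_integral_square L2_diff) auto
  then have wu: "AE x in m. w x = u x" by simp
  show uV: "u \<in> V" by (rule V_cong_AE[OF w L2_measurable[OF u] wu])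
  have "nrm (v n - w) = nrm (v n - u)" for n
    using wu vV w uV by (intro nrm_cong_AE) (auto elim: eventually_mono)
  with lim vV v show "\<exists>v. (\<forall>n::nat. v n \<in> V \<and> P (v n)) \<and> (\<lambda>n. nrm (v n - u)) \<longlonglongrightarrow> 0"
    by (auto simp: C_def intro!: exI[of _ v])
qed

lemma Mazur_AE:
  assumes uV: "\<And>n::nat. u n \<in> V" and P: "\<And>n. P (u n)"
    and mid: "\<And>v w. v \<in> V \<Longrightarrow> w \<in> V \<Longrightarrow> P v \<Longrightarrow> P w \<Longrightarrow> P ((1/2) *\<^sub>R (v + w))"
    and R: "\<And>n. nrm (u n) \<le> R"
    and w: "w \<in> borel_measurable m" and f: "f \<in> L2 m"
    and le: "\<And>n. AE x in m. \<bar>u n x\<bar> \<le> f x" and lim: "AE x in m. (\<lambda>n. u n x) \<longlonglongrightarrow> w x"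
  shows "\<exists>v. (\<forall>n::nat. v n \<in> V \<and> P (v n)) \<and> (\<lambda>n. nrm (v n - w)) \<longlonglongrightarrow> 0"
proof (rule Mazur(2))
  have L2lim: "w \<in> L2 m" "(\<lambda>n. \<integral>x. (u n x - w x)\<^sup>2 \<partial>m) \<longlonglongrightarrow> 0"
    using L2_dominated_convergence[OF _ w f le lim] uV by auto
  show "w \<in> L2 m" by (rule L2lim)
  show "P ((1/2) *\<^sub>R (v + w))" if "v \<in> V" "w \<in> V" "P v" "P w" for v w by (rule mid[OF that])
  fix \<epsilon> :: real assume "\<epsilon> > 0"
  then obtain n where "(\<integral>x. (u n x - w x)\<^sup>2 \<partial>m) < \<epsilon>"
    using order_tendstoD(2)[OF L2lim(2)] by (auto simp: eventually_sequentially)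
  then show "\<exists>v\<in>V. P v \<and> nrm v \<le> R \<and> (\<integral>x. (v x - w x)\<^sup>2 \<partial>m) \<le> \<epsilon>"
    using uV R P by (intro bexI[of _ "u n"]) auto
qed

text \<open>If \<open>l (u n)\<close> did not converge to \<open>l w\<close>, infinitely many \<open>u n\<close> would satisfy
  \<open>l w + e \<le> l (u n)\<close>, or the same for \<open>-l\<close>. By Mazur's lemma \<open>w\<close> would be a norm limit of vectors in
  this half space.\<close>

lemma weak_limit:
  assumes uV: "\<And>n. u n \<in> V" and R: "\<And>n. nrm (u n) \<le> R"
    and w: "w \<in> borel_measurable m" and f: "f \<in> L2 m"
    and le: "\<And>n. AE x in m. \<bar>u n x\<bar> \<le> f x" and lim: "AE x in m. (\<lambda>n. u n x) \<longlonglongrightarrow> w x"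
  shows "w \<in> V" "\<And>l. bdd_linear l \<Longrightarrow> (\<lambda>n. l (u n)) \<longlonglongrightarrow> l w"
proof -
  have wL2: "w \<in> L2 m" and L2lim: "(\<lambda>n. \<integral>x. (u n x - w x)\<^sup>2 \<partial>m) \<longlonglongrightarrow> 0"
    using L2_dominated_convergence[OF _ w f le lim] uV by auto
  have ev: "\<forall>\<^sub>F n in sequentially. (\<integral>x. (u n x - w x)\<^sup>2 \<partial>m) < \<epsilon>" if "\<epsilon> > 0" for \<epsilon>
    using order_tendstoD(2)[OF L2lim that] .
  show wV: "w \<in> V"
  proof (rule Mazur(1)[OF wL2, of "\<lambda>_. True" R])
    fix \<epsilon> :: real assume "\<epsilon> > 0"
    then obtain n where "(\<integral>x. (u n x - w x)\<^sup>2 \<partial>m) < \<epsilon>"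
      using ev by (auto simp: eventually_sequentially)
    then show "\<exists>v\<in>V. True \<and> nrm v \<le> R \<and> (\<integral>x. (v x - w x)\<^sup>2 \<partial>m) \<le> \<epsilon>"
      using uV R by (intro bexI[of _ "u n"]) auto
  qed auto
  have half: "\<forall>\<^sub>F n in sequentially. l (u n) < l w + e" if l: "bdd_linear l" and e: "e > 0" for l e
  proof (rule ccontr)
    assume "\<not> ?thesis"
    then have fr: "\<exists>\<^sub>F n in sequentially. \<not> l (u n) < l w + e" by (simp add: frequently_def)
    have "\<exists>v. (\<forall>n::nat. v n \<in> V \<and> l w + e \<le> l (v n)) \<and> (\<lambda>n. nrm (v n - w)) \<longlonglongrightarrow> 0"
    proof (rule Mazur(2)[OF wL2, of "\<lambda>v. l w + e \<le> l v" R])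
      show "l w + e \<le> l ((1/2) *\<^sub>R (p + q))" if "p \<in> V" "q \<in> V" "l w + e \<le> l p" "l w + e \<le> l q" for p q
        using that bdd_linear_scale[OF l, of "p + q" "1/2"] bdd_linear_add[OF l that(1,2)] by simp
      fix \<epsilon> :: real assume "\<epsilon> > 0"
      have "\<exists>\<^sub>F n in sequentially. \<not> l (u n) < l w + e \<and> (\<integral>x. (u n x - w x)\<^sup>2 \<partial>m) < \<epsilon>"
        using fr ev[OF \<open>\<epsilon> > 0\<close>] by (rule frequently_eventually_frequently)
      then obtain n where "\<not> l (u n) < l w + e" "(\<integral>x. (u n x - w x)\<^sup>2 \<partial>m) < \<epsilon>"
        by (auto dest: frequently_ex)
      then show "\<exists>v\<in>V. l w + e \<le> l v \<and> nrm v \<le> R \<and> (\<integral>x. (v x - w x)\<^sup>2 \<partial>m) \<le> \<epsilon>"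
        using uV R by (intro bexI[of _ "u n"]) auto
    qed
    then obtain v where v: "\<And>n::nat. v n \<in> V" "\<And>n. l w + e \<le> l (v n)" "(\<lambda>n. nrm (v n - w)) \<longlonglongrightarrow> 0"
      by auto
    have "l w + e \<le> l w"
      by (rule LIMSEQ_le_const[OF bdd_linear_LIMSEQ[OF l v(1) wV v(3)]]) (use v in auto)
    with e show False by simp
  qed
  fix l assume l: "bdd_linear l"
  have l': "bdd_linear (\<lambda>u. - l u)"
    using l unfolding bdd_linear_def by (auto simp: algebra_simps)
  show "(\<lambda>n. l (u n)) \<longlonglongrightarrow> l w"
  proof (rule order_tendstoI)
    show "\<forall>\<^sub>F n in sequentially. l (u n) < a" if "l w < a" for a
      using half[OF l, of "a - l w"] that by simp
    show "\<forall>\<^sub>F n in sequentially. a < l (u n)" if "a < l w" for a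
      using half[OF l', of "l w - a"] that by simp
  qed
qed

end

section \<open>Excessive functions and balayage\<close>

text \<open>The inequality for \<open>-u\<close> is the one for \<open>u\<close> with its arguments exchanged, so the dual form is a
  lattice form as well.\<close>

locale lattice_form = L2_form V B K m
  for V :: "('a \<Rightarrow> real) set" and B :: "('a \<Rightarrow> real) \<Rightarrow> ('a \<Rightarrow> real) \<Rightarrow> real" and K :: real
    and m :: "'a measure" +
  assumes V_pos_part: "\<And>u. u \<in> V \<Longrightarrow> pos_part u \<in> V"
    and B_pos_neg: "\<And>u. u \<in> V \<Longrightarrow> B (pos_part u) (pos_part (- u)) \<le> 0"
begin

lemma dual_lattice_form: "lattice_form V (\<lambda>u v. B v u) K m"
proof -
  interpret dual: coercive_form V "\<lambda>u v. B v u" K by (rule dual)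
  show ?thesis
  proof
    show "B (pos_part (- u)) (pos_part u) \<le> 0" if "u \<in> V" for u
      using B_pos_neg[of "- u"] that by simp
    show "B v u = B v' u'" if "u \<in> V" "u' \<in> V" "v \<in> V" "v' \<in> V"
      "AE x in m. u x = u' x" "AE x in m. v x = v' x" for u u' v v'
      by (rule B_cong_AE) fact+
  qed (fact V_L2 V_cong_AE L2_le_B V_pos_part)+
qed

lemma pos_neg_decomp: "u = pos_part u - pos_part (- u)"
  by (auto simp: fun_eq_iff)

lemma nrm_pos_part_le_right:
  assumes "u \<in> V" shows "(nrm (pos_part u))\<^sup>2 \<le> B u (pos_part u)"
proof -
  have V: "pos_part u \<in> V" "pos_part (- u) \<in> V" using assms by (auto intro: V_pos_part)
  have "B u (pos_part u) = B (pos_part u - pos_part (- u)) (pos_part u)"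
    using pos_neg_decomp[of u] by simp
  also have "\<dots> = B (pos_part u) (pos_part u) - B (pos_part (- u)) (pos_part u)"
    by (rule diff_left) (use V in auto)
  finally show ?thesis using B_pos_neg[of "- u"] assms V by (simp add: nrm_square)
qed

lemma nrm_pos_part_le:
  assumes "u \<in> V" shows "nrm (pos_part u) \<le> K * nrm u"
proof (rule zero_of_sector_square)
  have "(nrm (pos_part u))\<^sup>2 \<le> B u (pos_part u)" by (rule nrm_pos_part_le_right[OF assms])
  also have "\<dots> \<le> K * nrm u * nrm (pos_part u)"
    using sector_nrm[of u "pos_part u"] assms V_pos_part by auto
  finally show "(nrm (pos_part u))\<^sup>2 \<le> K * nrm u * nrm (pos_part u)" .
qed (use assms V_pos_part K_pos in auto)

lemma V_min: "u \<in> V \<Longrightarrow> v \<in> V \<Longrightarrow> (\<lambda>x. min (u x) (v x)) \<in> V"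
proof -
  assume "u \<in> V" "v \<in> V"
  then have "u - pos_part (u - v) \<in> V" by (auto intro: V_pos_part)
  moreover have "u - pos_part (u - v) = (\<lambda>x. min (u x) (v x))" by (auto simp: fun_eq_iff)
  ultimately show ?thesis by simp
qed

text \<open>The maximum principle: the energy of \<open>(p - s)\<^sup>+\<close> is at most \<open>B (p - s) (p - s)\<^sup>+\<close>, which the
  hypothesis makes nonpositive.\<close>

lemma domination:
  assumes p: "p \<in> V" and s: "s \<in> V" and le: "B p (pos_part (p - s)) \<le> B s (pos_part (p - s))"
  shows "AE x in m. p x \<le> s x"
proof -
  have V: "pos_part (p - s) \<in> V" using p s by (auto intro: V_pos_part)
  have "(nrm (pos_part (p - s)))\<^sup>2 \<le> B (p - s) (pos_part (p - s))"
    using p s by (intro nrm_pos_part_le_right) auto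
  also have "\<dots> = B p (pos_part (p - s)) - B s (pos_part (p - s))"
    by (rule diff_left) (use p s V in auto)
  also have "\<dots> \<le> 0" using le by simp
  finally have "B (pos_part (p - s)) (pos_part (p - s)) \<le> 0" using V by (simp add: nrm_square)
  from AE_zero_of_B_zero[OF V this] show ?thesis
    by eventually_elim (auto simp: max_def split: if_splits)
qed

definition excessive :: "('a \<Rightarrow> real) \<Rightarrow> bool" where
  "excessive s \<longleftrightarrow> s \<in> V \<and> (\<forall>w\<in>V. (AE x in m. 0 \<le> w x) \<longrightarrow> 0 \<le> B s w)"

lemma excessiveD: "excessive s \<Longrightarrow> s \<in> V" "excessive s \<Longrightarrow> w \<in> V \<Longrightarrow> AE x in m. 0 \<le> w x \<Longrightarrow> 0 \<le> B s w"
  by (auto simp: excessive_def)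

lemma excessive_nonneg:
  assumes "excessive s" shows "AE x in m. 0 \<le> s x"
proof -
  note sV = excessiveD(1)[OF assms]
  have V: "pos_part (0 - s) \<in> V" by (intro V_pos_part V_diff sV V_zero)
  have "AE x in m. 0 x \<le> s x"
  proof (rule domination[OF V_zero sV])
    show "B 0 (pos_part (0 - s)) \<le> B s (pos_part (0 - s))"
      using excessiveD(2)[OF assms V] V by simp
  qed
  then show ?thesis by simp
qed

text \<open>The constraint is one almost everywhere, so \<open>U\<close> may be any set; the capacity below profits from
  being subadditive on sets that are not open.\<close>

definition balayage :: "('a \<Rightarrow> real) \<Rightarrow> 'a set \<Rightarrow> ('a \<Rightarrow> real) \<Rightarrow> bool" where
  "balayage h U g \<longleftrightarrow> g \<in> above_on m V h U \<and> (\<forall>w\<in>above_on m V h U. 0 \<le> B g (w - g))"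

text \<open>Testing \<open>u - r s\<close> with its own positive part bounds the energy of this part for all \<open>r\<close> at once
  and forces its pairing with \<open>s\<close> to decay like \<open>1 / r\<close>.\<close>

lemma nrm_excess_le:
  assumes u: "u \<in> V" and s: "excessive s" and r: "0 \<le> r"
  shows "nrm (pos_part (u - r *\<^sub>R s)) \<le> K * nrm u"
    and "r * B s (pos_part (u - r *\<^sub>R s)) \<le> (K * nrm u)\<^sup>2"
proof -
  define v where "v = pos_part (u - r *\<^sub>R s)"
  note sV = excessiveD(1)[OF s]
  have vV: "v \<in> V" using u sV by (auto simp: v_def intro: V_pos_part)
  have "(nrm v)\<^sup>2 \<le> B (u - r *\<^sub>R s) v"
    unfolding v_def by (rule nrm_pos_part_le_right) (use u sV in auto)
  also have "\<dots> = B u v - r * B s v" using u sV vV by (simp add: diff_left scale_left)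
  finally have key: "(nrm v)\<^sup>2 + r * B s v \<le> K * nrm u * nrm v"
    using sector_nrm[OF u vV] by linarith
  have "0 \<le> r * B s v" using r excessiveD(2)[OF s vV] by (simp add: v_def)
  then have *: "nrm v \<le> K * nrm u"
    using key K_pos by (intro zero_of_sector_square[OF vV u]) auto
  then show "nrm (pos_part (u - r *\<^sub>R s)) \<le> K * nrm u" by (simp add: v_def)
  have "K * nrm u * nrm v \<le> (K * nrm u)\<^sup>2"
    unfolding power2_eq_square using * K_pos u by (intro mult_left_mono) auto
  moreover have "0 \<le> (nrm v)\<^sup>2" by simp
  ultimately have "r * B s v \<le> (K * nrm u)\<^sup>2" using key by linarith
  then show "r * B s (pos_part (u - r *\<^sub>R s)) \<le> (K * nrm u)\<^sup>2" by (simp add: v_def)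
qed

lemma balayage_exists:
  assumes h: "h \<in> V" shows "\<exists>g. balayage h U g"
proof -
  let ?C = "above_on m V h U"
  have "\<exists>u\<in>?C. \<forall>w\<in>?C. (\<lambda>_. 0) (w - u) \<le> B u (w - u)"
  proof (rule variational_inequality)
    show "?C \<subseteq> V" by (auto simp: above_on_def)
    show "?C \<noteq> {}" using h by (auto simp: above_on_def)
    show "bdd_linear (\<lambda>_. 0)" by (auto simp: bdd_linear_def)
    show "convex ?C"
    proof (rule convexI)
      fix p q and a b :: real
      assume pq: "p \<in> ?C" "q \<in> ?C" and ab: "0 \<le> a" "0 \<le> b" "a + b = 1"
      have "AE x in m. x \<in> U \<longrightarrow> h x \<le> p x" "AE x in m. x \<in> U \<longrightarrow> h x \<le> q x"
        using pq by (auto simp: above_on_def)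
      then have "AE x in m. x \<in> U \<longrightarrow> h x \<le> (a *\<^sub>R p + b *\<^sub>R q) x"
      proof eventually_elim
        case (elim x)
        show ?case
        proof
          assume "x \<in> U"
          then have "a * h x + b * h x \<le> a * p x + b * q x"
            using elim ab by (intro add_mono mult_left_mono) auto
          then show "h x \<le> (a *\<^sub>R p + b *\<^sub>R q) x" using ab by (simp flip: distrib_right)
        qed
      qed
      then show "a *\<^sub>R p + b *\<^sub>R q \<in> ?C" using pq by (auto simp: above_on_def)
    qed
    show "norm_closed ?C"
      unfolding norm_closed_def
    proof (intro allI impI, elim conjE)
      fix u v assume u: "\<forall>n::nat. u n \<in> ?C" and v: "v \<in> V" and lim: "(\<lambda>n. nrm (u n - v)) \<longlonglongrightarrow> 0"
      have uV: "u n \<in> V" for n using u by (auto simp: above_on_def)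
      obtain r :: "nat \<Rightarrow> nat" where r: "AE x in m. (\<lambda>n. u (r n) x) \<longlonglongrightarrow> v x"
        using AE_subsequence[OF uV v lim] by blast
      have "AE x in m. \<forall>n. x \<in> U \<longrightarrow> h x \<le> u n x"
        unfolding AE_all_countable using u by (simp add: above_on_def)
      with r have "AE x in m. x \<in> U \<longrightarrow> h x \<le> v x"
        by eventually_elim (auto intro: LIMSEQ_le_const)
      with v show "v \<in> ?C" by (simp add: above_on_def)
    qed
  qed
  then show ?thesis by (auto simp: balayage_def)
qed

context
  fixes h U g
  assumes h: "excessive h" and g: "balayage h U g"
begin

lemma balayage_V: "g \<in> V" and balayage_above: "AE x in m. x \<in> U \<longrightarrow> h x \<le> g x"
  using g by (auto simp: balayage_def above_on_def)

lemma balayage_test_nonneg: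
  assumes "w \<in> V" "AE x in m. x \<in> U \<longrightarrow> 0 \<le> w x" shows "0 \<le> B g w"
proof -
  have "g + w \<in> above_on m V h U"
    using balayage_V balayage_above assms by (auto simp: above_on_def elim: eventually_elim2)
  then show ?thesis using g by (auto simp: balayage_def)
qed

lemma balayage_test_zero:
  assumes "w \<in> V" "AE x in m. x \<in> U \<longrightarrow> w x = 0" shows "B g w = 0"
proof (rule antisym)
  show "0 \<le> B g w" by (rule balayage_test_nonneg[OF assms(1)]) (use assms(2) in \<open>auto elim: eventually_mono\<close>)
  have "0 \<le> B g (- w)"
    by (rule balayage_test_nonneg) (use assms in \<open>auto elim: eventually_mono\<close>)
  then show "B g w \<le> 0" using assms balayage_V by (simp add: minus_right)
qed

lemma balayage_excessive: "excessive g"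
  unfolding excessive_def
proof (intro conjI balayage_V ballI impI)
  fix w assume "w \<in> V" "AE x in m. 0 \<le> w x"
  then show "0 \<le> B g w" by (intro balayage_test_nonneg) (auto elim: eventually_mono)
qed

lemma balayage_le: "AE x in m. g x \<le> h x"
proof (rule domination[OF balayage_V excessiveD(1)[OF h]])
  let ?w = "pos_part (g - h)"
  have hV: "h \<in> V" using excessiveD(1)[OF h] .
  have w: "?w \<in> V" using hV balayage_V by (auto intro: V_pos_part)
  have "g - ?w = (\<lambda>x. min (g x) (h x))" by (auto simp: fun_eq_iff)
  moreover have "(\<lambda>x. min (g x) (h x)) \<in> above_on m V h U"
    using balayage_above V_min[OF balayage_V hV] by (auto simp: above_on_def elim: eventually_mono)
  ultimately have "g - ?w \<in> above_on m V h U" by simp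
  then have "0 \<le> B g (g - ?w - g)" using g unfolding balayage_def by blast
  then have "B g ?w \<le> 0" using w balayage_V by (simp add: minus_right)
  also have "0 \<le> B h ?w" by (rule excessiveD(2)[OF h w]) simp
  finally show "B g ?w \<le> B h ?w" .
qed

lemma balayage_eq: "AE x in m. x \<in> U \<longrightarrow> g x = h x"
  using balayage_le balayage_above by eventually_elim auto

lemma balayage_nonneg: "AE x in m. 0 \<le> g x"
  by (rule excessive_nonneg[OF balayage_excessive])

lemma balayage_nrm: "nrm g \<le> K * nrm h"
proof (rule zero_of_sector_square[OF balayage_V excessiveD(1)[OF h]])
  have hV: "h \<in> V" using excessiveD(1)[OF h] .
  have "0 \<le> B g (h - g)"
    using hV g by (auto simp: balayage_def above_on_def)
  then have "(nrm g)\<^sup>2 \<le> B g h" using hV balayage_V by (simp add: nrm_square diff_right)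
  also have "\<dots> \<le> K * nrm g * nrm h" using sector_nrm[OF balayage_V hV] by simp
  finally show "(nrm g)\<^sup>2 \<le> K * nrm h * nrm g" by (simp add: ac_simps)
qed (use K_pos in simp)

lemma balayage_least:
  assumes s: "excessive s" and le: "AE x in m. x \<in> U \<longrightarrow> h x \<le> s x"
  shows "AE x in m. g x \<le> s x"
proof (rule domination[OF balayage_V excessiveD(1)[OF s]])
  let ?w = "pos_part (g - s)"
  have w: "?w \<in> V" using balayage_V excessiveD(1)[OF s] by (auto intro: V_pos_part)
  have "B g ?w = 0"
    by (rule balayage_test_zero[OF w]) (use le balayage_le in eventually_elim, auto)
  also have "0 \<le> B s ?w" by (rule excessiveD(2)[OF s w]) simp
  finally show "B g ?w \<le> B s ?w" .
qed

end

lemma balayage_mono: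
  assumes h: "excessive h" and g: "balayage h U g" "balayage h U' g'"
    and sub: "AE x in m. x \<in> U \<longrightarrow> x \<in> U'"
  shows "AE x in m. g x \<le> g' x"
  by (rule balayage_least[OF h g(1) balayage_excessive[OF h g(2)]])
    (use sub balayage_above[OF h g(2)] in eventually_elim, auto)

text \<open>On \<open>U\<close> one has \<open>gu = g = h\<close> and \<open>gi \<le> g'\<close>, and symmetrically on \<open>U'\<close>. So the positive part of the
  difference of the two sides vanishes on \<open>U \<union> U'\<close>; the left side is orthogonal to it, while the
  right side is excessive.\<close>

lemma balayage_strong_subadditive:
  assumes h: "excessive h" and g: "balayage h U g" "balayage h U' g'"
    "balayage h (U \<union> U') gu" "balayage h (U \<inter> U') gi"
  shows "AE x in m. gu x + gi x \<le> g x + g' x"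
proof -
  note V = g[THEN balayage_V[OF h]]
  let ?w = "pos_part ((gu + gi) - (g + g'))"
  have w: "?w \<in> V" by (intro V_pos_part V_diff V_add V)
  have "AE x in m. gi x \<le> g x" "AE x in m. gi x \<le> g' x"
    by (rule balayage_mono[OF h g(4) g(1)], simp) (rule balayage_mono[OF h g(4) g(2)], simp)
  then have zero: "AE x in m. x \<in> U \<union> U' \<longrightarrow> ?w x = 0"
    using g[THEN balayage_eq[OF h]]
    by eventually_elim auto
  have "AE x in m. (gu + gi) x \<le> (g + g') x"
  proof (rule domination[of "gu + gi" "g + g'"])
    have "B gu ?w = 0" by (rule balayage_test_zero[OF h g(3) w zero])
    moreover have "B gi ?w = 0" by (rule balayage_test_zero[OF h g(4) w]) (use zero in eventually_elim, auto)
    ultimately have "B (gu + gi) ?w = 0" using add_left[OF V(3,4) w] by linarith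
    also have "0 \<le> B g ?w + B g' ?w"
      using excessiveD(2)[OF balayage_excessive[OF h g(1)] w] excessiveD(2)[OF balayage_excessive[OF h g(2)] w]
      by simp
    also have "\<dots> = B (g + g') ?w" by (intro add_left[symmetric] V w)
    finally show "B (gu + gi) ?w \<le> B (g + g') ?w" .
  qed (use V in auto)
  then show ?thesis by simp
qed

lemma balayage_monotone_limit:
  assumes h: "excessive h" and g: "\<And>n::nat. balayage h (U n) (g n)"
    and mono: "incseq U \<or> decseq U"
  obtains w where "w \<in> V" "AE x in m. (\<lambda>n. g n x) \<longlonglongrightarrow> w x" "AE x in m. 0 \<le> w x \<and> w x \<le> h x"
    "\<forall>l. bdd_linear l \<longrightarrow> (\<lambda>n. l (g n)) \<longlonglongrightarrow> l w"
proof -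
  have gV: "g n \<in> V" for n by (rule balayage_V[OF h g])
  have hV: "h \<in> V" using excessiveD(1)[OF h] .
  have bounds: "AE x in m. \<forall>n. 0 \<le> g n x \<and> g n x \<le> h x"
    using balayage_nonneg[OF h g] balayage_le[OF h g] by (simp add: AE_all_countable AE_conj_iff)
  have "AE x in m. (\<forall>n. g n x \<le> g (Suc n) x) \<or> (\<forall>n. g (Suc n) x \<le> g n x)"
    using mono
  proof
    assume "incseq U"
    then have "AE x in m. g n x \<le> g (Suc n) x" for n
      by (intro balayage_mono[OF h g g]) (auto simp: incseq_Suc_iff)
    then have "AE x in m. \<forall>n. g n x \<le> g (Suc n) x" by (simp add: AE_all_countable)
    then show ?thesis by eventually_elim auto
  next
    assume "decseq U"
    then have "AE x in m. g (Suc n) x \<le> g n x" for n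
      by (intro balayage_mono[OF h g g]) (auto simp: decseq_Suc_iff)
    then have "AE x in m. \<forall>n. g (Suc n) x \<le> g n x" by (simp add: AE_all_countable)
    then show ?thesis by eventually_elim auto
  qed
  then have conv: "AE x in m. (\<lambda>n. g n x) \<longlonglongrightarrow> lim (\<lambda>n. g n x)"
    using bounds
  proof eventually_elim
    case (elim x)
    have bd: "Bseq (\<lambda>n. g n x)" using elim(2) by (intro BseqI'[of _ "h x"]) auto
    have "monoseq (\<lambda>n. g n x)" using elim(1) by (auto simp: monoseq_Suc)
    then show ?case using Bseq_monoseq_convergent[OF bd] by (simp add: convergent_LIMSEQ_iff)
  qed
  have [measurable]: "g n \<in> borel_measurable m" for n using gV V_measurable by auto
  have meas: "(\<lambda>x. lim (\<lambda>n. g n x)) \<in> borel_measurable m" by measurable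
  have le: "AE x in m. \<bar>g n x\<bar> \<le> h x" for n using bounds by eventually_elim auto
  note wl = weak_limit[OF gV balayage_nrm[OF h g] meas _ le conv]
  have hL: "h \<in> L2 m" using hV by auto
  have "AE x in m. 0 \<le> lim (\<lambda>n. g n x) \<and> lim (\<lambda>n. g n x) \<le> h x"
    using conv bounds by eventually_elim (auto intro: LIMSEQ_le_const LIMSEQ_le_const2)
  moreover have "\<forall>l. bdd_linear l \<longrightarrow> (\<lambda>n. l (g n)) \<longlonglongrightarrow> l (\<lambda>x. lim (\<lambda>n. g n x))"
    using wl(2)[OF hL] by blast
  ultimately show ?thesis by (rule that[OF wl(1)[OF hL] conv])
qed

text \<open>The limit of the \<open>g n\<close> is excessive and equals \<open>h\<close> on the union, hence dominates \<open>p\<close>; it lies below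
  \<open>p\<close> because every \<open>g n\<close> does.\<close>

lemma balayage_increasing:
  assumes h: "excessive h" and g: "\<And>n::nat. balayage h (U n) (g n)"
    and inc: "incseq U" and gU: "balayage h (\<Union>n. U n) p"
  shows "\<And>l. bdd_linear l \<Longrightarrow> (\<lambda>n. l (g n)) \<longlonglongrightarrow> l p"
proof -
  obtain w where w: "w \<in> V" and lim: "AE x in m. (\<lambda>n. g n x) \<longlonglongrightarrow> w x"
    and bd: "AE x in m. 0 \<le> w x \<and> w x \<le> h x"
    and weak': "\<forall>l. bdd_linear l \<longrightarrow> (\<lambda>n. l (g n)) \<longlonglongrightarrow> l w"
    by (rule balayage_monotone_limit[OF h g disjI1[OF inc]])
  note weak = weak'[rule_format]
  have wU: "AE x in m. x \<in> (\<Union>n. U n) \<longrightarrow> w x = h x"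
  proof -
    have "AE x in m. \<forall>n. x \<in> U n \<longrightarrow> g n x = h x"
      using balayage_eq[OF h g] by (simp add: AE_all_countable)
    with lim show ?thesis
    proof eventually_elim
      case (elim x)
      show ?case
      proof
        assume "x \<in> (\<Union>n. U n)"
        then obtain k where k: "x \<in> U k" by auto
        have "g n x = h x" if "n \<ge> k" for n using elim(2) incseqD[OF inc that] k by auto
        then have "(\<lambda>n. g n x) \<longlonglongrightarrow> h x" by (intro tendsto_eventually) (auto simp: eventually_sequentially)
        then show "w x = h x" using elim(1) LIMSEQ_unique by blast
      qed
    qed
  qed
  have pV: "p \<in> V" by (rule balayage_V[OF h gU])
  have "AE x in m. w x \<le> p x"
  proof -
    have "AE x in m. \<forall>n. g n x \<le> p x"
      unfolding AE_all_countable by (intro allI balayage_mono[OF h g gU]) auto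
    with lim show ?thesis by eventually_elim (auto intro: LIMSEQ_le_const2)
  qed
  moreover have "AE x in m. p x \<le> w x"
  proof (rule balayage_least[OF h gU])
    show "excessive w"
      unfolding excessive_def
    proof (intro conjI w ballI impI)
      fix v assume v: "v \<in> V" "AE x in m. 0 \<le> v x"
      show "0 \<le> B w v"
        by (rule LIMSEQ_le_const[OF weak[OF bdd_linear_left[OF v(1)]]])
          (use excessiveD(2)[OF balayage_excessive[OF h g] v] in auto)
    qed
    show "AE x in m. x \<in> (\<Union>n. U n) \<longrightarrow> h x \<le> w x" using wU by eventually_elim simp
  qed
  ultimately have wp: "AE x in m. w x = p x" by eventually_elim auto
  fix l assume l: "bdd_linear l"
  show "(\<lambda>n. l (g n)) \<longlonglongrightarrow> l p"
    using weak[OF l] bdd_linear_cong_AE[OF l w pV wp] by simp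
qed

end

section \<open>Semi-Dirichlet forms as lattice forms\<close>

lemma inner_L2_add:
  assumes "f \<in> L2 m" "u \<in> L2 m" "v \<in> L2 m"
  shows "inner_L2 m f (u + v) = inner_L2 m f u + inner_L2 m f v"
  using L2_mult_integrable[OF assms(1,2)] L2_mult_integrable[OF assms(1,3)]
  by (simp add: inner_L2_def distrib_left)

lemma inner_L2_scale: "inner_L2 m f (c *\<^sub>R u) = c * inner_L2 m f u"
  by (simp add: inner_L2_def mult.left_commute)

lemma inner_L2_commute: "inner_L2 m u v = inner_L2 m v u"
  by (simp add: inner_L2_def mult.commute)

lemma inner_L2_mono:
  assumes "f \<in> L2 m" "u \<in> L2 m" "v \<in> L2 m" "AE x in m. 0 \<le> f x" "AE x in m. u x \<le> v x"
  shows "inner_L2 m f u \<le> inner_L2 m f v"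
  unfolding inner_L2_def
  by (rule integral_mono_AE) (use assms in \<open>auto intro: L2_mult_integrable elim!: eventually_elim2 intro: mult_left_mono\<close>)

lemma inner_L2_bound: "f \<in> L2 m \<Longrightarrow> u \<in> L2 m \<Longrightarrow>
  \<bar>inner_L2 m f u\<bar> \<le> ((\<integral>x. (f x)\<^sup>2 \<partial>m) + (\<integral>x. (u x)\<^sup>2 \<partial>m)) / 2"
proof -
  assume f: "f \<in> L2 m" and u: "u \<in> L2 m"
  have "\<bar>inner_L2 m f u\<bar> \<le> (\<integral>x. \<bar>f x * u x\<bar> \<partial>m)"
    unfolding inner_L2_def by (rule integral_abs_bound)
  also have "\<dots> \<le> (\<integral>x. (f x)\<^sup>2 / 2 + (u x)\<^sup>2 / 2 \<partial>m)"
  proof (rule integral_mono)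
    show "\<bar>f x * u x\<bar> \<le> (f x)\<^sup>2 / 2 + (u x)\<^sup>2 / 2" for x
    proof -
      have "0 \<le> (\<bar>f x\<bar> - \<bar>u x\<bar>)\<^sup>2" by simp
      then show ?thesis unfolding power2_diff abs_mult power2_abs by argo
    qed
  qed (use L2_mult_integrable[OF f u] L2_integrable[OF f] L2_integrable[OF u] in auto)
  also have "\<dots> = ((\<integral>x. (f x)\<^sup>2 \<partial>m) + (\<integral>x. (u x)\<^sup>2 \<partial>m)) / 2"
    using L2_integrable[OF f] L2_integrable[OF u] by simp
  finally show ?thesis .
qed

context semi_dirichlet_form
begin

definition sector_const :: real where
  "sector_const = (SOME K. 0 < K \<and> (\<forall>u\<in>D. \<forall>v\<in>D. \<bar>energy m \<E> 1 u v\<bar> \<le> K * norm1 m \<E> u * norm1 m \<E> v))"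

lemma sector_const: "0 < sector_const"
  "u \<in> D \<Longrightarrow> v \<in> D \<Longrightarrow> \<bar>energy m \<E> 1 u v\<bar> \<le> sector_const * norm1 m \<E> u * norm1 m \<E> v"
  using someI_ex[OF sector[unfolded Bex_def]] unfolding sector_const_def by blast+

lemma D_L2 [intro]: "u \<in> D \<Longrightarrow> u \<in> L2 m"
  using D_subset_L2 by auto

lemma D_add: "u \<in> D \<Longrightarrow> v \<in> D \<Longrightarrow> u + v \<in> D"
  and D_scale: "u \<in> D \<Longrightarrow> c *\<^sub>R u \<in> D"
  using D_lincomb[of u v 1 1] D_lincomb[of u u c 0] by (simp_all add: plus_fun_def scaleR_fun_def)

lemma form_add_left: "u \<in> D \<Longrightarrow> v \<in> D \<Longrightarrow> w \<in> D \<Longrightarrow> \<E> (u + v) w = \<E> u w + \<E> v w"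
  and form_add_right: "u \<in> D \<Longrightarrow> v \<in> D \<Longrightarrow> w \<in> D \<Longrightarrow> \<E> w (u + v) = \<E> w u + \<E> w v"
  and form_scale_left: "u \<in> D \<Longrightarrow> w \<in> D \<Longrightarrow> \<E> (c *\<^sub>R u) w = c * \<E> u w"
  and form_scale_right: "u \<in> D \<Longrightarrow> w \<in> D \<Longrightarrow> \<E> w (c *\<^sub>R u) = c * \<E> w u"
  using form_linear_left[of u v w 1 1] form_linear_right[of u v w 1 1]
    form_linear_left[of u u w c 0] form_linear_right[of u u w c 0]
  by (simp_all add: plus_fun_def scaleR_fun_def)

sublocale L2_form D "energy m \<E> 1" sector_const m
proof
  have "(\<lambda>_. 0) \<in> L2 m" by (simp add: L2_def)
  from D_dense[OF this zero_less_one] obtain u where "u \<in> D" by auto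
  from D_scale[OF this, of 0] have "0 \<in> D" by simp
  then show "subspace D" by (simp add: subspace_def D_add D_scale)
next
  fix u v w assume "u \<in> D" "v \<in> D" "w \<in> D"
  then show "energy m \<E> 1 (u + v) w = energy m \<E> 1 u w + energy m \<E> 1 v w"
    by (simp add: energy_def form_add_left inner_L2_commute[of m _ w] inner_L2_add D_L2)
next
  fix u v w assume "u \<in> D" "v \<in> D" "w \<in> D"
  then show "energy m \<E> 1 w (u + v) = energy m \<E> 1 w u + energy m \<E> 1 w v"
    by (simp add: energy_def form_add_right inner_L2_add D_L2)
next
  fix c u w assume "u \<in> D" "w \<in> D"
  then show "energy m \<E> 1 (c *\<^sub>R u) w = c * energy m \<E> 1 u w"
    by (simp add: energy_def form_scale_left inner_L2_commute[of m _ w] inner_L2_scale distrib_left)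
next
  fix c u w assume "u \<in> D" "w \<in> D"
  then show "energy m \<E> 1 w (c *\<^sub>R u) = c * energy m \<E> 1 w u"
    by (simp add: energy_def form_scale_right inner_L2_scale distrib_left)
next
  fix u assume u: "u \<in> D"
  have "0 \<le> inner_L2 m u u" by (simp add: inner_L2_def)
  then show "0 \<le> energy m \<E> 1 u u" using form_nonneg[OF u] by (simp add: energy_def)
  show "(\<integral>x. (u x)\<^sup>2 \<partial>m) \<le> energy m \<E> 1 u u"
    using form_nonneg[OF u] by (simp add: energy_def inner_L2_def power2_eq_square)
next
  show "0 < sector_const" by (rule sector_const)
  show "\<bar>energy m \<E> 1 u v\<bar> \<le> sector_const * sqrt (energy m \<E> 1 u u) * sqrt (energy m \<E> 1 v v)"
    if "u \<in> D" "v \<in> D" for u v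
    using sector_const(2)[OF that] by (simp add: norm1_def)
next
  fix u :: "nat \<Rightarrow> 'a \<Rightarrow> real"
  assume "\<And>n. u n \<in> D"
    "\<And>\<epsilon>. 0 < \<epsilon> \<Longrightarrow> \<exists>N. \<forall>i\<ge>N. \<forall>j\<ge>N. sqrt (energy m \<E> 1 (u i - u j) (u i - u j)) < \<epsilon>"
  then show "\<exists>v\<in>D. (\<lambda>n. sqrt (energy m \<E> 1 (u n - v) (u n - v))) \<longlonglongrightarrow> 0"
    using D_complete[of u] by (simp add: norm1_def fun_diff_def)
next
  show "D \<subseteq> L2 m" by (rule D_subset_L2)
  show "v \<in> D" if "u \<in> D" "v \<in> borel_measurable m" "AE x in m. u x = v x" for u v
    by (rule D_cong_AE[OF that])
  show "energy m \<E> 1 u v = energy m \<E> 1 u' v'" if "u \<in> D" "u' \<in> D" "v \<in> D" "v' \<in> D"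
    "AE x in m. u x = u' x" "AE x in m. v x = v' x" for u u' v v'
  proof -
    have "inner_L2 m u v = inner_L2 m u' v'"
      unfolding inner_L2_def
    proof (rule integral_cong_AE)
      have [measurable]: "u \<in> borel_measurable m" "u' \<in> borel_measurable m" "v \<in> borel_measurable m" "v' \<in> borel_measurable m"
        using that by (auto simp: L2_measurable D_L2)
      show "(\<lambda>x. u x * v x) \<in> borel_measurable m" "(\<lambda>x. u' x * v' x) \<in> borel_measurable m" by measurable
      show "AE x in m. u x * v x = u' x * v' x" using that(5,6) by eventually_elim simp
    qed
    then show ?thesis using form_cong_AE[OF that] by (simp add: energy_def)
  qed
qed

lemma nrm_eq_norm1: "nrm u = norm1 m \<E> u"
  by (simp add: nrm_def norm1_def)

lemma unit_truncation_D:
  assumes "u \<in> D" "0 < a" shows "(\<lambda>x. min (max (u x) 0) a) \<in> D"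
proof -
  have "a *\<^sub>R (\<lambda>x. min (max (((1/a) *\<^sub>R u) x) 0) 1) \<in> D"
    by (intro V_scale unit_contraction_in_D assms)
  moreover have "a *\<^sub>R (\<lambda>x. min (max (((1/a) *\<^sub>R u) x) 0) 1) = (\<lambda>x. min (max (u x) 0) a)"
    using assms(2) by (auto simp: fun_eq_iff min_def max_def field_simps)
  ultimately show ?thesis by simp
qed

text \<open>For \<open>t > 0\<close> the function \<open>P + t (u - P)\<close> has the same truncation \<open>P\<close> as \<open>u\<close>. The semi-Dirichlet
  inequality for it, divided by \<open>t\<close>, is \<open>0 \<le> 2 \<E> P (u - P) + t \<E> (u - P) (u - P)\<close>; let \<open>t\<close> tend
  to \<open>0\<close>.\<close>

lemma unit_truncation_form:
  assumes u: "u \<in> D" and P_def: "P = (\<lambda>x. min (max (u x) 0) 1)"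
  shows "0 \<le> \<E> P (u - P)"
proof -
  define z where "z = u - P"
  have P: "P \<in> D" unfolding P_def by (rule unit_contraction_in_D[OF u])
  have z: "z \<in> D" using u P by (simp add: z_def)
  have ineq: "0 \<le> 2 * \<E> P z + t * \<E> z z" if t: "0 < t" for t
  proof -
    have ut: "P + t *\<^sub>R z \<in> D" using P z by auto
    have "min (max ((P + t *\<^sub>R z) x) 0) 1 = P x" for x
    proof -
      consider "u x < 0" | "0 \<le> u x" "u x \<le> 1" | "1 < u x" by linarith
      then show ?thesis
      proof cases
        case 1
        then have "t * u x \<le> 0" using t by (simp add: mult_nonneg_nonpos)
        then show ?thesis using 1 by (simp add: P_def z_def)
      next
        case 2 then show ?thesis by (simp add: P_def z_def)
      next
        case 3
        then have "0 \<le> t * (u x - 1)" using t by simp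
        then show ?thesis using 3 by (simp add: P_def z_def)
      qed
    qed
    then have "0 \<le> \<E> (\<lambda>x. (P + t *\<^sub>R z) x + P x) (\<lambda>x. (P + t *\<^sub>R z) x - P x)"
      using unit_contraction[OF ut] by simp
    moreover have "(\<lambda>x. (P + t *\<^sub>R z) x + P x) = 2 *\<^sub>R P + t *\<^sub>R z" by (simp add: fun_eq_iff)
    moreover have "(\<lambda>x. (P + t *\<^sub>R z) x - P x) = t *\<^sub>R z" by (simp add: fun_eq_iff)
    ultimately have "0 \<le> \<E> (2 *\<^sub>R P + t *\<^sub>R z) (t *\<^sub>R z)" by simp
    also have "\<dots> = t * (2 * \<E> P z + t * \<E> z z)"
      using P z by (simp add: form_add_left form_scale_left form_scale_right D_scale)
    finally show ?thesis using t by (simp add: zero_le_mult_iff)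
  qed
  have "((\<lambda>t. 2 * \<E> P z + t * \<E> z z) \<longlongrightarrow> 2 * \<E> P z + 0 * \<E> z z) (at_right (0::real))"
    by (intro tendsto_intros)
  moreover have "\<forall>\<^sub>F t in at_right (0::real). 0 \<le> 2 * \<E> P z + t * \<E> z z"
    using ineq by (intro eventually_at_rightI[of 0 1]) auto
  ultimately have "0 \<le> 2 * \<E> P z + 0 * \<E> z z"
    by (intro tendsto_lowerbound[where F = "at_right (0::real)"]) auto
  then show ?thesis by (simp add: z_def)
qed

lemma truncation_energy:
  assumes u: "u \<in> D" and a: "0 < a" and Q_def: "Q = (\<lambda>x. min (max (u x) 0) a)"
  shows "0 \<le> energy m \<E> 1 Q (u - Q)"
proof -
  define P where "P = (\<lambda>x. min (max (((1/a) *\<^sub>R u) x) 0) 1)"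
  have Q: "Q = a *\<^sub>R P"
    using a by (auto simp: P_def Q_def fun_eq_iff min_def max_def field_simps)
  have PD: "P \<in> D" unfolding P_def by (intro unit_contraction_in_D V_scale u)
  have "u - Q = a *\<^sub>R ((1/a) *\<^sub>R u - P)" using a by (simp add: Q scaleR_diff_right)
  then have "\<E> Q (u - Q) = a * (a * \<E> P ((1/a) *\<^sub>R u - P))"
    using PD u by (simp add: Q form_scale_left form_scale_right D_scale)
  moreover have "0 \<le> \<E> P ((1/a) *\<^sub>R u - P)"
    by (rule unit_truncation_form) (use u in \<open>auto simp: P_def\<close>)
  ultimately have "0 \<le> \<E> Q (u - Q)" using a by simp
  moreover have "0 \<le> inner_L2 m Q (u - Q)"
    unfolding inner_L2_def
  proof (rule integral_nonneg_AE, rule AE_I2)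
    fix x show "0 \<le> Q x * (u - Q) x"
      using a by (auto simp: Q_def min_def max_def)
  qed
  ultimately show ?thesis by (simp add: energy_def)
qed

lemma truncation_nrm:
  assumes u: "u \<in> D" and a: "0 < a" and Q_def: "Q = (\<lambda>x. min (max (u x) 0) a)"
  shows "(nrm Q)\<^sup>2 \<le> energy m \<E> 1 Q u" "nrm Q \<le> sector_const * nrm u"
proof -
  have Q: "Q \<in> D" unfolding Q_def by (rule unit_truncation_D[OF u a])
  show *: "(nrm Q)\<^sup>2 \<le> energy m \<E> 1 Q u"
    using truncation_energy[OF assms] Q u by (simp add: nrm_square diff_right)
  show "nrm Q \<le> sector_const * nrm u"
    by (rule zero_of_sector_square[OF Q u])
      (use * sector_nrm[OF Q u] K_pos in \<open>auto simp: ac_simps\<close>)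
qed

text \<open>\<open>u\<^sup>+\<close> is the limit of the truncations of \<open>u\<close> at growing levels, whose energy is bounded. In the
  energy inequality the quadratic term is only lower semicontinuous, which is the right direction.\<close>

lemma pos_part_in_D_energy:
  assumes u: "u \<in> D"
  shows "pos_part u \<in> D" "0 \<le> energy m \<E> 1 (pos_part u) (u - pos_part u)"
proof -
  define P where "P n = (\<lambda>x. min (max (u x) 0) (real (Suc n)))" for n
  have PD: "P n \<in> D" for n unfolding P_def by (rule unit_truncation_D[OF u]) simp
  have bound: "nrm (P n) \<le> sector_const * nrm u" for n
    by (rule truncation_nrm(2)[OF u _ P_def]) simp
  have [measurable]: "u \<in> borel_measurable m" using V_measurable[OF u] .
  have meas: "pos_part u \<in> borel_measurable m" unfolding pos_part_def by measurable
  have absL2: "(\<lambda>x. \<bar>u x\<bar>) \<in> L2 m" using D_L2[OF u] by (auto simp: L2_def)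
  have conv: "AE x in m. (\<lambda>n. P n x) \<longlonglongrightarrow> pos_part u x"
  proof (rule AE_I2, rule tendsto_eventually)
    fix x
    obtain N where "u x \<le> real N" using real_arch_simple by blast
    then show "\<forall>\<^sub>F n in sequentially. P n x = pos_part u x"
      unfolding eventually_sequentially P_def by (intro exI[of _ N]) auto
  qed
  have le: "AE x in m. \<bar>P n x\<bar> \<le> \<bar>u x\<bar>" for n
    by (rule AE_I2) (auto simp: P_def min_def max_def)
  note wl = weak_limit[OF PD bound meas absL2 le conv]
  show pos_D: "pos_part u \<in> D" by (rule wl(1))
  let ?B = "energy m \<E> 1"
  define p where "p = pos_part u"
  have pD: "p \<in> D" using pos_D by (simp add: p_def)
  have weak: "(\<lambda>n. l (P n)) \<longlonglongrightarrow> l p" if "bdd_linear l" for l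
    using wl(2)[OF that] unfolding p_def .
  have "0 \<le> ?B p u - ?B p p - ?B p p + ?B p p"
  proof (rule LIMSEQ_le_const)
    show "(\<lambda>n. ?B (P n) u - ?B (P n) p - ?B p (P n) + ?B p p) \<longlonglongrightarrow> ?B p u - ?B p p - ?B p p + ?B p p"
      by (intro tendsto_intros weak[OF bdd_linear_left] weak[OF bdd_linear_right] u pD)
    have "0 \<le> ?B (P n) u - ?B (P n) p - ?B p (P n) + ?B p p" for n
    proof -
      have "0 \<le> ?B (P n - p) (P n - p)" using PD pD by (intro B_nonneg) auto
      also have "\<dots> = ?B (P n) (P n) - ?B (P n) p - ?B p (P n) + ?B p p"
        using PD[of n] pD by (simp add: diff_left diff_right)
      also have "?B (P n) (P n) \<le> ?B (P n) u"
        using truncation_nrm(1)[OF u _ P_def, of n] PD[of n] by (simp add: nrm_square)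
      finally show ?thesis by simp
    qed
    then show "\<exists>N. \<forall>n\<ge>N. 0 \<le> ?B (P n) u - ?B (P n) p - ?B p (P n) + ?B p p" by auto
  qed
  then show "0 \<le> ?B (pos_part u) (u - pos_part u)" using pD u by (simp add: diff_right p_def)
qed

sublocale lattice_form D "energy m \<E> 1" sector_const m
proof
  fix u assume u: "u \<in> D"
  show p: "pos_part u \<in> D" by (rule pos_part_in_D_energy[OF u])
  have n: "pos_part (- u) \<in> D" by (rule pos_part_in_D_energy) (use u in auto)
  have "u - pos_part u = - pos_part (- u)" by (auto simp: fun_eq_iff)
  then show "energy m \<E> 1 (pos_part u) (pos_part (- u)) \<le> 0"
    using pos_part_in_D_energy(2)[OF u] p n by (simp add: minus_right)
qed

sublocale co: lattice_form D "\<lambda>u v. energy m \<E> 1 v u" sector_const m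
  rewrites "coercive_form.nrm (\<lambda>u v. energy m \<E> 1 v u) = nrm"
    and "coercive_form.bdd_linear D (\<lambda>u v. energy m \<E> 1 v u) = bdd_linear"
proof -
  show "lattice_form D (\<lambda>u v. energy m \<E> 1 v u) sector_const m" by (rule dual_lattice_form)
  then interpret d: lattice_form D "\<lambda>u v. energy m \<E> 1 v u" sector_const m .
  show *: "d.nrm = nrm" by (simp add: fun_eq_iff d.nrm_def nrm_def)
  show "d.bdd_linear = bdd_linear"
    unfolding fun_eq_iff d.bdd_linear_def bdd_linear_def * by simp
qed

end

locale reference_form = semi_dirichlet_form m D \<E>
  for m :: "'a::topological_space measure" and D :: "('a \<Rightarrow> real) set"
    and \<E> :: "('a \<Rightarrow> real) \<Rightarrow> ('a \<Rightarrow> real) \<Rightarrow> real" +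
  fixes \<phi> :: "'a \<Rightarrow> real"
  assumes \<phi>_L2: "\<phi> \<in> L2 m" and \<phi>_bounds: "AE x in m. 0 < \<phi> x \<and> \<phi> x \<le> 1"
begin

abbreviation B where "B \<equiv> energy m \<E> 1"

definition h where "h = resolvent m D \<E> 1 \<phi>"

definition h' where "h' = coresolvent m D \<E> 1 \<phi>"

lemma bdd_linear_\<phi>: "bdd_linear (inner_L2 m \<phi>)"
proof -
  define M where "M = ((\<integral>x. (\<phi> x)\<^sup>2 \<partial>m) + 1) / 2"
  have "\<bar>inner_L2 m \<phi> u\<bar> \<le> M * nrm u" if u: "u \<in> D" for u
  proof (cases "nrm u = 0")
    case True
    then have "AE x in m. u x = 0" using AE_zero_of_B_zero[OF u] nrm_square[OF u] by simp
    then have "inner_L2 m \<phi> u = (\<integral>x. 0 \<partial>m)"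
      unfolding inner_L2_def
      by (intro integral_cong_AE) (use V_measurable[OF u] L2_measurable[OF \<phi>_L2] in \<open>auto elim: eventually_mono\<close>)
    then show ?thesis using True by simp
  next
    case False
    then have r: "nrm u > 0" using nrm_nonneg[OF u] by linarith
    define v where "v = (1 / nrm u) *\<^sub>R u"
    have v: "v \<in> D" using u by (auto simp: v_def)
    have "nrm v = 1" using r nrm_scale[OF u] by (simp add: v_def)
    then have "(\<integral>x. (v x)\<^sup>2 \<partial>m) \<le> 1" using L2_le_B[OF v] nrm_square[OF v] by simp
    moreover have "\<bar>inner_L2 m \<phi> v\<bar> \<le> ((\<integral>x. (\<phi> x)\<^sup>2 \<partial>m) + (\<integral>x. (v x)\<^sup>2 \<partial>m)) / 2"
      by (rule inner_L2_bound[OF \<phi>_L2 D_L2[OF v]])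
    ultimately have "\<bar>inner_L2 m \<phi> v\<bar> \<le> M"
      unfolding M_def by (elim order_trans) (simp add: divide_right_mono)
    then show ?thesis using r by (simp add: v_def inner_L2_scale abs_mult field_simps)
  qed
  moreover have "M \<ge> 0" by (simp add: M_def)
  ultimately show ?thesis
    unfolding bdd_linear_def by (auto simp: inner_L2_add inner_L2_scale \<phi>_L2 D_L2)
qed

lemma h_D: "h \<in> D" and B_h: "u \<in> D \<Longrightarrow> B h u = inner_L2 m \<phi> u"
proof -
  have "\<exists>g. g \<in> D \<and> (\<forall>u\<in>D. B g u = inner_L2 m \<phi> u)"
    using Lax_Milgram[OF bdd_linear_\<phi>] by blast
  from someI_ex[OF this] show "h \<in> D" "u \<in> D \<Longrightarrow> B h u = inner_L2 m \<phi> u"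
    by (auto simp: h_def resolvent_def)
qed

lemma h'_D: "h' \<in> D" and B_h': "u \<in> D \<Longrightarrow> B u h' = inner_L2 m \<phi> u"
proof -
  have "\<exists>g. g \<in> D \<and> (\<forall>u\<in>D. B u g = inner_L2 m \<phi> u)"
    using co.Lax_Milgram[OF bdd_linear_\<phi>] by blast
  from someI_ex[OF this] show "h' \<in> D" "u \<in> D \<Longrightarrow> B u h' = inner_L2 m \<phi> u"
    by (auto simp: h'_def coresolvent_def)
qed

lemma \<phi>_nonneg: "AE x in m. 0 \<le> \<phi> x"
  using \<phi>_bounds by eventually_elim simp

lemma inner_\<phi>_mono: "u \<in> D \<Longrightarrow> v \<in> D \<Longrightarrow> AE x in m. u x \<le> v x \<Longrightarrow> inner_L2 m \<phi> u \<le> inner_L2 m \<phi> v"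
  by (intro inner_L2_mono \<phi>_L2 D_L2 \<phi>_nonneg)

lemma inner_\<phi>_nonneg:
  assumes "AE x in m. 0 \<le> u x" shows "0 \<le> inner_L2 m \<phi> u"
  unfolding inner_L2_def
  by (rule integral_nonneg_AE) (use assms \<phi>_nonneg in eventually_elim, auto)

lemma AE_zero_of_inner_\<phi>:
  assumes u: "u \<in> D" "AE x in m. 0 \<le> u x" and z: "inner_L2 m \<phi> u \<le> 0"
  shows "AE x in m. u x = 0"
proof -
  have i: "integrable m (\<lambda>x. \<phi> x * u x)" by (intro L2_mult_integrable \<phi>_L2 D_L2 u)
  have nn: "AE x in m. 0 \<le> \<phi> x * u x" using u(2) \<phi>_nonneg by eventually_elim simp
  have "(\<integral>x. \<phi> x * u x \<partial>m) = 0" using z inner_\<phi>_nonneg[OF u(2)] by (simp add: inner_L2_def)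
  then have "AE x in m. \<phi> x * u x = 0" using integral_nonneg_eq_0_iff_AE[OF i nn] by simp
  with \<phi>_bounds show ?thesis by eventually_elim auto
qed

lemma excessive_h: "excessive h"
  by (auto simp: excessive_def h_D B_h inner_\<phi>_nonneg)

lemma coexcessive_h': "co.excessive h'"
  by (auto simp: co.excessive_def h'_D B_h' inner_\<phi>_nonneg)

text \<open>Test with the excess \<open>z\<close> of \<open>h\<close> over \<open>1\<close>: where \<open>z > 0\<close>, the truncation of \<open>h\<close> is \<open>1 \<ge> \<phi>\<close>.\<close>

lemma h_le_1: "AE x in m. h x \<le> 1"
proof -
  define Q where "Q = (\<lambda>x. min (max (h x) 0) 1)"
  define z where "z = h - Q"
  have Q: "Q \<in> D" unfolding Q_def by (rule unit_truncation_D[OF h_D]) simp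
  have z: "z \<in> D" using Q h_D by (simp add: z_def)
  have h0: "AE x in m. 0 \<le> h x" by (rule excessive_nonneg[OF excessive_h])
  have "0 \<le> \<E> Q z" unfolding z_def by (rule unit_truncation_form[OF h_D Q_def])
  then have "B z z \<le> inner_L2 m \<phi> z - inner_L2 m Q z"
    using B_h[OF z] diff_left[OF h_D Q z] by (simp add: z_def[symmetric] energy_def)
  also have "\<dots> \<le> 0"
  proof -
    have "inner_L2 m \<phi> z \<le> inner_L2 m Q z"
      unfolding inner_L2_def
    proof (rule integral_mono_AE)
      show "AE x in m. \<phi> x * z x \<le> Q x * z x"
        using \<phi>_bounds h0
        by eventually_elim (auto simp: Q_def z_def min_def max_def intro: mult_right_mono)
    qed (intro L2_mult_integrable \<phi>_L2 D_L2 z Q)+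
    then show ?thesis by simp
  qed
  finally have "AE x in m. z x = 0" by (rule AE_zero_of_B_zero[OF z])
  then show ?thesis by eventually_elim (auto simp: z_def Q_def min_def max_def split: if_splits)
qed

section \<open>The reference function and the capacity\<close>

lemma excess_limit:
  assumes u: "u \<in> D" and s: "excessive s" and w: "w \<in> borel_measurable m"
    and lim: "AE x in m. (\<lambda>n. pos_part (u - real n *\<^sub>R s) x) \<longlonglongrightarrow> w x"
  shows "w \<in> D" "\<And>l. bdd_linear l \<Longrightarrow> (\<lambda>n. l (pos_part (u - real n *\<^sub>R s))) \<longlonglongrightarrow> l w"
    "B s w \<le> 0"
proof -
  note sD = excessiveD(1)[OF s]
  have vD: "pos_part (u - real n *\<^sub>R s) \<in> D" for n using u sD by (auto intro: V_pos_part)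
  have absL2: "(\<lambda>x. \<bar>u x\<bar>) \<in> L2 m" using D_L2[OF u] by (auto simp: L2_def)
  have le: "AE x in m. \<bar>pos_part (u - real n *\<^sub>R s) x\<bar> \<le> \<bar>u x\<bar>" for n
    using excessive_nonneg[OF s]
  proof eventually_elim
    case (elim x)
    then have "0 \<le> real n * s x" by simp
    then show ?case by simp
  qed
  note wl = weak_limit[OF vD nrm_excess_le(1)[OF u s] w absL2 le lim]
  show "w \<in> D" by (rule wl(1)) simp
  show weak: "\<And>l. bdd_linear l \<Longrightarrow> (\<lambda>n. l (pos_part (u - real n *\<^sub>R s))) \<longlonglongrightarrow> l w"
    by (rule wl(2)) simp_all
  show "B s w \<le> 0"
  proof (rule LIMSEQ_le)
    show "(\<lambda>n. B s (pos_part (u - real n *\<^sub>R s))) \<longlonglongrightarrow> B s w"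
      by (rule weak[OF bdd_linear_right[OF sD]])
    show "(\<lambda>n. (sector_const * nrm u)\<^sup>2 / real n) \<longlonglongrightarrow> 0"
      by (rule real_tendsto_divide_at_top[OF tendsto_const filterlim_real_sequentially])
    show "\<exists>N. \<forall>n\<ge>N. B s (pos_part (u - real n *\<^sub>R s)) \<le> (sector_const * nrm u)\<^sup>2 / real n"
      using nrm_excess_le(2)[OF u s, of "real _"] by (intro exI[of _ 1]) (auto simp: field_simps)
  qed
qed

text \<open>Where \<open>h\<close> vanishes, the excess of \<open>u\<close> over multiples of \<open>h\<close> stays equal to \<open>u\<^sup>+\<close>. Its limit \<open>w\<close>
  satisfies \<open>(\<phi>, w) = B h w \<le> 0\<close>, so \<open>w = 0\<close>. Thus every function in \<open>D\<close> vanishes where \<open>h\<close> does, and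
  so does \<open>\<phi>\<close> by density of \<open>D\<close>.\<close>

lemma h_pos: "AE x in m. 0 < h x"
proof -
  have h0: "AE x in m. 0 \<le> h x" by (rule excessive_nonneg[OF excessive_h])
  have [measurable]: "h \<in> borel_measurable m" "\<phi> \<in> borel_measurable m"
    using V_measurable[OF h_D] L2_measurable[OF \<phi>_L2] .
  have zero: "AE x in m. h x = 0 \<longrightarrow> u x \<le> 0" if u: "u \<in> D" for u
  proof -
    have [measurable]: "u \<in> borel_measurable m" using V_measurable[OF u] .
    define w where "w = (\<lambda>x. if h x = 0 then pos_part u x else 0)"
    have [measurable]: "w \<in> borel_measurable m" unfolding w_def pos_part_apply by measurable
    have lim: "AE x in m. (\<lambda>n. pos_part (u - real n *\<^sub>R h) x) \<longlonglongrightarrow> w x"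
      using h0
    proof eventually_elim
      case (elim x)
      show ?case
      proof (cases "h x = 0")
        case False
        then have hx: "h x > 0" using elim by simp
        obtain N where N: "u x / h x \<le> real N" using real_arch_simple by blast
        have "pos_part (u - real n *\<^sub>R h) x = w x" if "n \<ge> N" for n
        proof -
          have "u x / h x \<le> real n" using N that by linarith
          then have "u x \<le> real n * h x" using hx by (simp add: divide_le_eq)
          then show ?thesis using False by (simp add: w_def)
        qed
        then show ?thesis by (intro tendsto_eventually) (auto simp: eventually_sequentially)
      qed (simp add: w_def)
    qed
    have w: "w \<in> D" "B h w \<le> 0"
      by (rule excess_limit[OF u excessive_h _ lim]; measurable)+
    have "AE x in m. w x = 0"
      by (rule AE_zero_of_inner_\<phi>) (use w B_h[OF w(1)] in \<open>auto simp: w_def\<close>)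
    then show ?thesis by eventually_elim (auto simp: w_def split: if_splits)
  qed
  have "(\<integral>x. (\<phi> x * indicator {x. h x = 0} x)\<^sup>2 \<partial>m) \<le> \<epsilon>" if \<epsilon>: "\<epsilon> > 0" for \<epsilon>
  proof -
    obtain u where u: "u \<in> D" "sqrt (\<integral>x. (\<phi> x - u x)\<^sup>2 \<partial>m) < sqrt \<epsilon>"
      using D_dense[OF \<phi>_L2, of "sqrt \<epsilon>"] \<epsilon> by auto
    have "(\<integral>x. (\<phi> x * indicator {x. h x = 0} x)\<^sup>2 \<partial>m) \<le> (\<integral>x. (\<phi> x - u x)\<^sup>2 \<partial>m)"
    proof (rule integral_mono_AE)
      show "integrable m (\<lambda>x. (\<phi> x - u x)\<^sup>2)" by (intro L2_integrable L2_diff \<phi>_L2 D_L2 u)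
      show "AE x in m. (\<phi> x * indicator {x. h x = 0} x)\<^sup>2 \<le> (\<phi> x - u x)\<^sup>2"
        using zero[OF u(1)] \<phi>_bounds
        by eventually_elim (auto simp: indicator_def intro!: power_mono)
      have "(\<lambda>x. \<phi> x * indicator {x. h x = 0} x) \<in> L2 m"
        by (rule L2_dominated[OF \<phi>_L2])
          (measurable, auto simp: indicator_def)
      then show "integrable m (\<lambda>x. (\<phi> x * indicator {x. h x = 0} x)\<^sup>2)" by (rule L2_integrable)
    qed
    also have "\<dots> \<le> \<epsilon>" using u(2) by simp
    finally show ?thesis .
  qed
  then have "(\<integral>x. (\<phi> x * indicator {x. h x = 0} x)\<^sup>2 \<partial>m) \<le> 0"
    using field_le_epsilon[of _ 0] by force
  moreover have "(\<lambda>x. \<phi> x * indicator {x. h x = 0} x) \<in> L2 m"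
    by (rule L2_dominated[OF \<phi>_L2]) (measurable, auto simp: indicator_def)
  ultimately have "AE x in m. \<phi> x * indicator {x. h x = 0} x = 0"
    by (intro AE_zero_of_integral_square)
  with h0 \<phi>_bounds show ?thesis by eventually_elim (auto simp: indicator_def split: if_splits)
qed

lemma excess_over_h_AE_null: "AE x in m. (\<lambda>n. pos_part (u - real n *\<^sub>R h) x) \<longlonglongrightarrow> 0"
  using h_pos
proof eventually_elim
  case (elim x)
  obtain N where N: "u x / h x \<le> real N" using real_arch_simple by blast
  have "pos_part (u - real n *\<^sub>R h) x = 0" if "n \<ge> N" for n
  proof -
    have "u x / h x \<le> real n" using N that by linarith
    then have "u x \<le> real n * h x" using elim by (simp add: divide_le_eq)
    then show ?thesis by simp
  qed
  then show ?case by (intro tendsto_eventually) (auto simp: eventually_sequentially)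
qed

lemma excess_over_h_weakly_null:
  assumes u: "u \<in> D" and l: "bdd_linear l"
  shows "(\<lambda>n. l (pos_part (u - real n *\<^sub>R h))) \<longlonglongrightarrow> 0"
proof -
  have "AE x in m. (\<lambda>n. pos_part (u - real n *\<^sub>R h) x) \<longlonglongrightarrow> 0 x"
    using excess_over_h_AE_null[of u] by simp
  from excess_limit(2)[OF u excessive_h _ this l]
  show ?thesis using bdd_linear_scale[OF l V_zero, of 0] by (simp add: zero_fun_def)
qed

definition red :: "'a set \<Rightarrow> 'a \<Rightarrow> real" where "red U = balayaged m D \<E> h U"

definition cored :: "'a set \<Rightarrow> 'a \<Rightarrow> real" where "cored U = (SOME g. co.balayage h' U g)"

lemma balayage_red: "balayage h U (red U)"
proof -
  have "\<exists>g. g \<in> above_on m D h U \<and> (\<forall>w\<in>above_on m D h U. 0 \<le> B g (\<lambda>x. w x - g x))"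
    using balayage_exists[OF h_D, of U] by (auto simp: balayage_def fun_diff_def)
  from someI_ex[OF this] show ?thesis
    by (auto simp: red_def balayaged_def balayage_def fun_diff_def)
qed

lemma balayage_cored: "co.balayage h' U (cored U)"
  unfolding cored_def by (rule someI_ex[OF co.balayage_exists[OF h'_D]])

lemmas red_D = balayage_V[OF excessive_h balayage_red]
  and red_eq = balayage_eq[OF excessive_h balayage_red]
  and red_le = balayage_le[OF excessive_h balayage_red]
  and red_nonneg = balayage_nonneg[OF excessive_h balayage_red]
  and red_test_zero = balayage_test_zero[OF excessive_h balayage_red]
  and cored_D = co.balayage_V[OF coexcessive_h' balayage_cored]
  and cored_eq = co.balayage_eq[OF coexcessive_h' balayage_cored]
  and cored_test_nonneg = co.balayage_test_nonneg[OF coexcessive_h' balayage_cored]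
  and cored_test_zero = co.balayage_test_zero[OF coexcessive_h' balayage_cored]
  and cored_nrm = co.balayage_nrm[OF coexcessive_h' balayage_cored]

abbreviation ocap where "ocap \<equiv> cap_open m D \<E> \<phi>"

lemma ocap_def: "ocap U = inner_L2 m \<phi> (red U)"
  by (simp add: cap_open_def red_def h_def inner_L2_commute)

text \<open>\<open>h' - cored U\<close> and \<open>h - red U\<close> vanish on \<open>U\<close>, so they are orthogonal to \<open>red U\<close> and to \<open>cored U\<close>;
  thus \<open>(red U, \<phi>) = B (red U) h' = B h (cored U) = (\<phi>, cored U)\<close>.\<close>

lemma ocap_cored: "ocap U = inner_L2 m \<phi> (cored U)"
proof -
  have "B (red U) (h' - cored U) = 0"
    by (rule red_test_zero) (use h'_D cored_D in blast, use cored_eq[of U] in eventually_elim, simp)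
  moreover have "B (h - red U) (cored U) = 0"
    by (rule cored_test_zero) (use h_D red_D in blast, use red_eq[of U] in eventually_elim, simp)
  ultimately have "B (red U) h' = B h (cored U)"
    using h_D h'_D red_D cored_D by (simp add: diff_left diff_right)
  then show ?thesis using B_h[OF cored_D] B_h'[OF red_D] by (simp add: ocap_def)
qed

lemma ocap_nonneg: "0 \<le> ocap U"
  unfolding ocap_def by (rule inner_\<phi>_nonneg[OF red_nonneg])

lemma ocap_mono_AE: "AE x in m. x \<in> U \<longrightarrow> x \<in> U' \<Longrightarrow> ocap U \<le> ocap U'"
  unfolding ocap_def
  by (intro inner_\<phi>_mono red_D balayage_mono[OF excessive_h balayage_red balayage_red])

lemma ocap_mono: "U \<subseteq> U' \<Longrightarrow> ocap U \<le> ocap U'"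
  by (intro ocap_mono_AE) auto

lemma ocap_strong_subadditive: "ocap (U \<union> U') + ocap (U \<inter> U') \<le> ocap U + ocap U'"
proof -
  have "inner_L2 m \<phi> (red (U \<union> U') + red (U \<inter> U')) \<le> inner_L2 m \<phi> (red U + red U')"
    by (rule inner_\<phi>_mono)
      (use balayage_strong_subadditive[OF excessive_h balayage_red balayage_red balayage_red balayage_red, of U U']
         red_D in auto)
  then show ?thesis
    using red_D by (simp add: ocap_def inner_L2_add \<phi>_L2 D_L2)
qed

lemma ocap_Un: "ocap (U \<union> U') \<le> ocap U + ocap U'"
  using ocap_strong_subadditive[of U U'] ocap_nonneg[of "U \<inter> U'"] by linarith

lemma ocap_incseq: "incseq U \<Longrightarrow> (\<lambda>n. ocap (U n)) \<longlonglongrightarrow> ocap (\<Union>n. U n)"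
  unfolding ocap_def
  by (rule balayage_increasing[OF excessive_h balayage_red _ balayage_red bdd_linear_\<phi>])

lemma ocap_UN_le:
  assumes le: "\<And>n::nat. ocap (U n) \<le> a n" and a: "summable a"
  shows "ocap (\<Union>n. U n) \<le> suminf a"
proof -
  have a0: "0 \<le> a n" for n using le ocap_nonneg order_trans by blast
  have part: "ocap (\<Union>i\<le>n. U i) \<le> (\<Sum>i\<le>n. a i)" for n
  proof (induction n)
    case (Suc n)
    have "ocap (\<Union>i\<le>Suc n. U i) \<le> ocap (\<Union>i\<le>n. U i) + ocap (U (Suc n))"
      using ocap_Un[of "\<Union>i\<le>n. U i" "U (Suc n)"] by (simp add: atMost_Suc Un_commute)
    with Suc le[of "Suc n"] show ?case by simp
  qed (simp add: le)
  have "(\<lambda>n. ocap (\<Union>i\<le>n. U i)) \<longlonglongrightarrow> ocap (\<Union>n. \<Union>i\<le>n. U i)"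
    by (intro ocap_incseq incseq_SucI) (auto simp: atMost_Suc)
  moreover have "(\<Union>n. \<Union>i\<le>n. U i) = (\<Union>n. U n)" by auto
  ultimately have lim: "(\<lambda>n. ocap (\<Union>i\<le>n. U i)) \<longlonglongrightarrow> ocap (\<Union>n. U n)" by simp
  show ?thesis
  proof (rule LIMSEQ_le_const2[OF lim])
    have "(\<Sum>i\<le>n. a i) \<le> suminf a" for n using sum_le_suminf[OF a, of "{..n}"] a0 by simp
    then show "\<exists>N. \<forall>n\<ge>N. ocap (\<Union>i\<le>n. U i) \<le> suminf a" using part order_trans by blast
  qed
qed

lemma AE_notin_of_ocap_zero:
  assumes "ocap N \<le> 0" shows "AE x in m. x \<notin> N"
proof -
  have "AE x in m. red N x = 0"
    by (rule AE_zero_of_inner_\<phi>[OF red_D red_nonneg]) (use assms in \<open>simp add: ocap_def\<close>)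
  with red_eq[of N] h_pos show ?thesis by eventually_elim auto
qed

text \<open>The summand \<open>1\<close> keeps the constant positive.\<close>

definition cap_const :: real where "cap_const = sector_const * (sector_const * nrm h') + 1"

lemma cap_const_pos: "0 < cap_const"
  using K_pos h'_D by (auto simp: cap_const_def intro!: add_nonneg_pos mult_nonneg_nonneg)

text \<open>Pair \<open>v - c h\<close>, which is nonnegative on \<open>U\<close>, with \<open>cored U\<close>, whose norm is bounded independently
  of \<open>U\<close>.\<close>

lemma ocap_Chebyshev:
  assumes v: "v \<in> D" and c: "0 \<le> c" and le: "AE x in m. x \<in> U \<longrightarrow> c * h x \<le> v x"
  shows "c * ocap U \<le> cap_const * nrm v"
proof -
  have "0 \<le> B (v - c *\<^sub>R h) (cored U)"
    by (rule cored_test_nonneg) (use le v h_D in \<open>auto elim: eventually_mono\<close>)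
  then have "c * ocap U \<le> B v (cored U)"
    using v h_D cored_D B_h[OF cored_D] by (simp add: diff_left scale_left ocap_cored)
  also have "\<dots> \<le> sector_const * nrm v * nrm (cored U)"
    using sector_nrm[OF v cored_D] by (rule order_trans[OF abs_ge_self])
  also have "\<dots> \<le> sector_const * nrm v * (sector_const * nrm h')"
    using K_pos v cored_nrm by (intro mult_left_mono) auto
  also have "\<dots> \<le> cap_const * nrm v"
    using v by (simp add: cap_const_def algebra_simps)
  finally show ?thesis .
qed

abbreviation ucap where "ucap \<equiv> cap m D \<E> \<phi>"

lemma bdd_below_ocap: "bdd_below (ocap ` S)"
  by (rule bdd_belowI[of _ 0]) (auto simp: ocap_nonneg)

lemma ucap_le_ocap: "open U \<Longrightarrow> A \<subseteq> U \<Longrightarrow> ucap A \<le> ocap U"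
  unfolding cap_def by (rule cINF_lower[OF bdd_below_ocap]) auto

lemma ucap_less_obtain:
  assumes "ucap A < c"
  obtains U where "open U" "A \<subseteq> U" "ocap U < c"
proof -
  have "UNIV \<in> {U. open U \<and> A \<subseteq> U}" by simp
  then have "{U. open U \<and> A \<subseteq> U} \<noteq> {}" by blast
  from iffD1[OF cINF_less_iff[OF this bdd_below_ocap] assms[unfolded cap_def]]
  obtain U where "U \<in> {U. open U \<and> A \<subseteq> U}" "ocap U < c" by (rule bexE)
  then show ?thesis by (intro that[of U]) auto
qed

lemma ucap_less_ex: "ucap A < c \<Longrightarrow> \<exists>U. open U \<and> A \<subseteq> U \<and> ocap U < c"
  by (erule ucap_less_obtain) blast

lemma le_ucapI:
  assumes "\<And>U. open U \<Longrightarrow> A \<subseteq> U \<Longrightarrow> c \<le> ocap U"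
  shows "c \<le> ucap A"
proof (rule ccontr)
  assume "\<not> c \<le> ucap A"
  then have "ucap A < c" by simp
  then obtain U where "open U" "A \<subseteq> U" "ocap U < c" by (rule ucap_less_obtain)
  with assms[of U] show False by simp
qed

lemma ucap_nonneg: "0 \<le> ucap A"
  by (rule le_ucapI) (rule ocap_nonneg)

lemma ucap_mono: "A \<subseteq> A' \<Longrightarrow> ucap A \<le> ucap A'"
  by (rule le_ucapI) (auto intro: ucap_le_ocap)

lemma ucap_Un_open: "open U \<Longrightarrow> ucap (A \<union> U) \<le> ucap A + ocap U"
proof (rule field_le_epsilon)
  fix e :: real assume U: "open U" and "0 < e"
  then obtain V where V: "open V" "A \<subseteq> V" "ocap V < ucap A + e"
    using ucap_less_ex[of A "ucap A + e"] by auto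
  have "ucap (A \<union> U) \<le> ocap (V \<union> U)" by (rule ucap_le_ocap) (use U V in auto)
  also have "\<dots> \<le> ocap V + ocap U" by (rule ocap_Un)
  finally show "ucap (A \<union> U) \<le> ucap A + ocap U + e" using V by simp
qed

text \<open>Open neighbourhoods \<open>U n\<close> of \<open>A n\<close> are chosen with errors \<open>e / 2 ^ (n + 1)\<close>. In passing from
  \<open>W n\<close> to \<open>W n \<union> U (n + 1)\<close>, strong subadditivity gives back the capacity of an intersection that
  contains \<open>A n\<close>, so that the errors merely add up.\<close>

lemma ucap_incseq_le:
  assumes inc: "incseq A" and le: "\<And>n::nat. ucap (A n) \<le> c"
  shows "ucap (\<Union>n. A n) \<le> c"
proof (rule field_le_epsilon)
  fix e :: real assume e: "0 < e"
  have "\<exists>U. open U \<and> A n \<subseteq> U \<and> ocap U < ucap (A n) + e / 2 ^ Suc n" for n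
    by (rule ucap_less_ex) (use e in simp)
  then obtain U where U: "\<And>n. open (U n)" "\<And>n. A n \<subseteq> U n" "\<And>n. ocap (U n) < ucap (A n) + e / 2 ^ Suc n"
    by metis
  define W where "W n = (\<Union>i\<le>n. U i)" for n
  have W_Suc: "W (Suc n) = W n \<union> U (Suc n)" for n by (simp add: W_def atMost_Suc Un_commute)
  have W: "ocap (W n) \<le> ucap (A n) + e * (1 - 1 / 2 ^ Suc n)" for n
  proof (induction n)
    case 0
    then show ?case using U(3)[of 0] by (simp add: W_def)
  next
    case (Suc n)
    have "A n \<subseteq> W n \<inter> U (Suc n)"
      using U(2)[of n] U(2)[of "Suc n"] incseq_SucD[OF inc, of n] by (auto simp: W_def)
    moreover have "open (W n \<inter> U (Suc n))" using U(1) by (auto simp: W_def)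
    ultimately have "ucap (A n) \<le> ocap (W n \<inter> U (Suc n))" by (intro ucap_le_ocap)
    then have "ocap (W (Suc n)) + ucap (A n) \<le> ocap (W n) + ocap (U (Suc n))"
      using ocap_strong_subadditive[of "W n" "U (Suc n)"] W_Suc by simp
    also have "\<dots> \<le> (ucap (A n) + e * (1 - 1 / 2 ^ Suc n)) + (ucap (A (Suc n)) + e / 2 ^ Suc (Suc n))"
      using Suc U(3)[of "Suc n"] by simp
    also have "\<dots> = ucap (A n) + (ucap (A (Suc n)) + e * (1 - 1 / 2 ^ Suc (Suc n)))"
      by (simp add: field_simps)
    finally show ?case by simp
  qed
  have "(\<lambda>n. ocap (W n)) \<longlonglongrightarrow> ocap (\<Union>n. W n)"
    by (rule ocap_incseq) (auto simp: incseq_Suc_iff W_Suc)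
  moreover have "ocap (W n) \<le> c + e" for n
  proof -
    have "e * (1 - 1 / 2 ^ Suc n) \<le> e * 1" using e by (intro mult_left_mono) auto
    then show ?thesis using W[of n] le[of n] by linarith
  qed
  ultimately have "ocap (\<Union>n. W n) \<le> c + e" by (intro LIMSEQ_le_const2) auto
  moreover have "ucap (\<Union>n. A n) \<le> ocap (\<Union>n. W n)"
    by (rule ucap_le_ocap) (use U(1) U(2) in \<open>fastforce simp: W_def\<close>)+
  ultimately show "ucap (\<Union>n. A n) \<le> c + e" by simp
qed

section \<open>Nests and quasi-continuity\<close>

abbreviation enest where "enest \<equiv> nest m D \<E>"

lemma nestD: "enest F \<Longrightarrow> incseq F" "enest F \<Longrightarrow> closed (F k)"
  "enest F \<Longrightarrow> u \<in> D \<Longrightarrow> 0 < \<epsilon> \<Longrightarrow> \<exists>v\<in>D. (\<exists>k. AE x in m. x \<notin> F k \<longrightarrow> v x = 0) \<and> nrm (u - v) < \<epsilon>"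
  unfolding nest_def nrm_eq_norm1 by (simp_all add: fun_diff_def)

lemma decseq_Compl: "incseq F \<Longrightarrow> decseq (\<lambda>k. - (F k :: 'a set))"
  unfolding incseq_def decseq_def by blast

lemma red_Compl_limit:
  assumes "incseq F"
  obtains w where "w \<in> D" "AE x in m. (\<lambda>n. red (- F n) x) \<longlonglongrightarrow> w x" "AE x in m. 0 \<le> w x"
    "\<forall>l. bdd_linear l \<longrightarrow> (\<lambda>n. l (red (- F n))) \<longlonglongrightarrow> l w"
proof -
  obtain w where w: "w \<in> D" "AE x in m. (\<lambda>n. red (- F n) x) \<longlonglongrightarrow> w x" "AE x in m. 0 \<le> w x \<and> w x \<le> h x"
    "\<forall>l. bdd_linear l \<longrightarrow> (\<lambda>n. l (red (- F n))) \<longlonglongrightarrow> l w"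
    by (rule balayage_monotone_limit[OF excessive_h balayage_red disjI2[OF decseq_Compl[OF assms]]])
  show ?thesis by (rule that[OF w(1,2) _ w(4)]) (use w(3) in eventually_elim, simp)
qed

text \<open>The limit of the balayaged functions is orthogonal to every function that vanishes off some
  \<open>F k\<close>, and these are dense.\<close>

lemma ocap_nest:
  assumes F: "enest F" shows "(\<lambda>k. ocap (- F k)) \<longlonglongrightarrow> 0"
proof -
  obtain w where w: "w \<in> D" "AE x in m. 0 \<le> w x"
    and weak: "\<forall>l. bdd_linear l \<longrightarrow> (\<lambda>n. l (red (- F n))) \<longlonglongrightarrow> l w"
    by (rule red_Compl_limit[OF nestD(1)[OF F]])
  have zero: "B w v = 0" if v: "v \<in> D" and k: "AE x in m. x \<notin> F k \<longrightarrow> v x = 0" for v k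
  proof -
    have "B (red (- F j)) v = 0" if "j \<ge> k" for j
    proof (rule red_test_zero[OF v])
      show "AE x in m. x \<in> - F j \<longrightarrow> v x = 0"
        using k incseqD[OF nestD(1)[OF F] that] by (auto elim: eventually_mono)
    qed
    then have "(\<lambda>j. B (red (- F j)) v) \<longlonglongrightarrow> 0"
      by (intro tendsto_eventually) (auto simp: eventually_sequentially)
    then show ?thesis using weak bdd_linear_left[OF v] LIMSEQ_unique by blast
  qed
  have "B w w \<le> 0"
  proof (rule field_le_epsilon)
    fix e :: real assume e: "0 < e"
    define \<delta> where "\<delta> = e / (sector_const * nrm w + 1)"
    have K: "0 < sector_const * nrm w + 1" using K_pos w by (intro add_nonneg_pos mult_nonneg_nonneg) auto
    have "0 < \<delta>" using K e by (simp add: \<delta>_def)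
    then obtain v k where v: "v \<in> D" "AE x in m. x \<notin> F k \<longrightarrow> v x = 0" "nrm (w - v) < \<delta>"
      using nestD(3)[OF F w(1)] by blast
    have "B w w = B w (w - v)" using zero[OF v(1,2)] w(1) v(1) by (simp add: diff_right)
    also have "\<dots> \<le> sector_const * nrm w * nrm (w - v)"
      using sector_nrm[of w "w - v"] w(1) v(1) by (auto intro: order_trans[OF abs_ge_self])
    also have "\<dots> \<le> (sector_const * nrm w + 1) * \<delta>"
      using v K_pos w(1) K by (intro mult_mono) auto
    also have "\<dots> = e" using K by (simp add: \<delta>_def)
    finally show "B w w \<le> 0 + e" by simp
  qed
  from AE_zero_of_B_zero[OF w(1) this] have "inner_L2 m \<phi> w = inner_L2 m \<phi> 0"
    by (intro bdd_linear_cong_AE[OF bdd_linear_\<phi>] w) auto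
  moreover have "(\<lambda>n. inner_L2 m \<phi> (red (- F n))) \<longlonglongrightarrow> inner_L2 m \<phi> w"
    using weak bdd_linear_\<phi> by blast
  ultimately show ?thesis by (simp add: ocap_def inner_L2_def)
qed

lemma red_Compl_null:
  assumes inc: "incseq F" and lim: "(\<lambda>k. ocap (- F k)) \<longlonglongrightarrow> 0"
  shows "AE x in m. (\<lambda>k. red (- F k) x) \<longlonglongrightarrow> 0"
    and "bdd_linear l \<Longrightarrow> (\<lambda>k. l (red (- F k))) \<longlonglongrightarrow> 0"
proof -
  obtain w where w: "w \<in> D" "AE x in m. (\<lambda>n. red (- F n) x) \<longlonglongrightarrow> w x" "AE x in m. 0 \<le> w x"
    and weak: "\<forall>l. bdd_linear l \<longrightarrow> (\<lambda>n. l (red (- F n))) \<longlonglongrightarrow> l w"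
    by (rule red_Compl_limit[OF inc])
  have "(\<lambda>n. inner_L2 m \<phi> (red (- F n))) \<longlonglongrightarrow> inner_L2 m \<phi> w" using weak bdd_linear_\<phi> by blast
  with lim have "inner_L2 m \<phi> w = 0" unfolding ocap_def using LIMSEQ_unique by blast
  then have zero: "AE x in m. w x = 0" by (intro AE_zero_of_inner_\<phi> w) simp
  with w(2) show "AE x in m. (\<lambda>k. red (- F k) x) \<longlonglongrightarrow> 0" by eventually_elim simp
  assume l: "bdd_linear l"
  have "l w = l 0" by (rule bdd_linear_cong_AE[OF l w(1) V_zero]) (use zero in simp)
  also have "l 0 = 0" using bdd_linear_scale[OF l V_zero, of 0] by simp
  finally have lw: "l w = 0" .
  have "(\<lambda>n. l (red (- F n))) \<longlonglongrightarrow> l w" using weak l by blast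
  then show "(\<lambda>k. l (red (- F k))) \<longlonglongrightarrow> 0" unfolding lw .
qed

lemma red_weakly_null: "enest F \<Longrightarrow> bdd_linear l \<Longrightarrow> (\<lambda>k. l (red (- F k))) \<longlonglongrightarrow> 0"
  by (rule red_Compl_null(2)[OF nestD(1) ocap_nest])

text \<open>For \<open>0 \<le> u \<le> r h\<close> the functions \<open>min u (r (h - red (- F k)))\<close> vanish off \<open>F k\<close>, have bounded energy
  and converge to \<open>u\<close>; Mazur's lemma turns this into norm approximation. General nonnegative \<open>u\<close> are
  reached through \<open>min u (n h)\<close>, again by Mazur's lemma.\<close>

lemma nest_of_ocap:
  assumes inc: "incseq F" and cl: "\<And>k. closed (F k)" and lim: "(\<lambda>k. ocap (- F k)) \<longlonglongrightarrow> 0"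
  shows "enest F"
proof -
  define van where "van v \<longleftrightarrow> (\<exists>k. AE x in m. x \<notin> F k \<longrightarrow> v x = 0)" for v :: "'a \<Rightarrow> real"
  have van_lincomb: "van (a *\<^sub>R v + b *\<^sub>R w)" if v: "van v" and w: "van w" for a b v w
  proof -
    obtain k where "AE x in m. x \<notin> F k \<longrightarrow> v x = 0" using v unfolding van_def by blast
    moreover obtain l where "AE x in m. x \<notin> F l \<longrightarrow> w x = 0" using w unfolding van_def by blast
    ultimately have "AE x in m. x \<notin> F (max k l) \<longrightarrow> (a *\<^sub>R v + b *\<^sub>R w) x = 0"
    proof eventually_elim
      case (elim x)
      then show ?case
        using incseqD[OF inc, of k "max k l"] incseqD[OF inc, of l "max k l"] by auto
    qed
    then show ?thesis unfolding van_def by blast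
  qed
  define S where "S = {u \<in> D. \<forall>\<epsilon>>0. \<exists>v\<in>D. van v \<and> nrm (u - v) < \<epsilon>}"
  have S_lincomb: "a *\<^sub>R u + b *\<^sub>R w \<in> S" if u: "u \<in> S" and w: "w \<in> S" for a b u w
  proof -
    have uD: "u \<in> D" "w \<in> D" using u w by (auto simp: S_def)
    have "\<exists>v\<in>D. van v \<and> nrm (a *\<^sub>R u + b *\<^sub>R w - v) < \<epsilon>" if e: "\<epsilon> > 0" for \<epsilon>
    proof -
      define c where "c = \<bar>a\<bar> + \<bar>b\<bar> + 1"
      have c: "c > 0" by (simp add: c_def add_nonneg_pos)
      have ec: "0 < \<epsilon> / c" using e c by simp
      obtain p where p: "p \<in> D" "van p" "nrm (u - p) < \<epsilon> / c"
        using u ec unfolding S_def by blast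
      obtain q where q: "q \<in> D" "van q" "nrm (w - q) < \<epsilon> / c"
        using w ec unfolding S_def by blast
      have "nrm (a *\<^sub>R u + b *\<^sub>R w - (a *\<^sub>R p + b *\<^sub>R q)) = nrm (a *\<^sub>R (u - p) + b *\<^sub>R (w - q))"
        by (simp add: algebra_simps)
      also have "\<dots> \<le> nrm (a *\<^sub>R (u - p)) + nrm (b *\<^sub>R (w - q))"
        by (rule nrm_triangle) (use uD p q in auto)
      also have "\<dots> = \<bar>a\<bar> * nrm (u - p) + \<bar>b\<bar> * nrm (w - q)"
        using uD p q by (simp add: nrm_scale)
      also have "\<dots> \<le> \<bar>a\<bar> * (\<epsilon> / c) + \<bar>b\<bar> * (\<epsilon> / c)"
        using p q by (intro add_mono mult_left_mono) auto
      also have "\<dots> = (c - 1) * (\<epsilon> / c)" unfolding c_def by argo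
      also have "\<dots> < c * (\<epsilon> / c)" using ec by (intro mult_strict_right_mono) auto
      also have "\<dots> = \<epsilon>" using c by simp
      finally show ?thesis using p q van_lincomb by (intro bexI[of _ "a *\<^sub>R p + b *\<^sub>R q"]) auto
    qed
    then show ?thesis using uD by (auto simp: S_def)
  qed
  have S_closed: "u \<in> S" if u: "u \<in> D" and v: "\<And>n. v n \<in> D \<and> v n \<in> S"
    and lim: "(\<lambda>n. nrm (v n - u)) \<longlonglongrightarrow> 0" for u and v :: "nat \<Rightarrow> 'a \<Rightarrow> real"
  proof -
    have "\<exists>p\<in>D. van p \<and> nrm (u - p) < \<epsilon>" if e: "\<epsilon> > 0" for \<epsilon>
    proof -
      obtain n where n: "nrm (v n - u) < \<epsilon> / 2"
        using order_tendstoD(2)[OF lim, of "\<epsilon> / 2"] e by (auto simp: eventually_sequentially)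
      have "v n \<in> S" using v by blast
      then have "\<exists>p\<in>D. van p \<and> nrm (v n - p) < \<epsilon> / 2" using half_gt_zero[OF e] unfolding S_def by blast
      then obtain p where p: "p \<in> D" "van p" "nrm (v n - p) < \<epsilon> / 2" by blast
      have "v n \<in> D" using v by blast
      then have "nrm (u - p) \<le> nrm (u - v n) + nrm (v n - p)" "nrm (u - v n) = nrm (v n - u)"
        using nrm_triangle_diff[of u "v n" p] nrm_diff_commute[of u "v n"] u p by auto
      then show ?thesis using n p by (intro bexI[of _ p]) auto
    qed
    then show ?thesis using u by (auto simp: S_def)
  qed
  have van_S: "v \<in> S" if "v \<in> D" "van v" for v
    using that by (auto simp: S_def intro!: bexI[of _ v])
  have half: "(1/2) *\<^sub>R (p + q) = (1/2) *\<^sub>R p + (1/2) *\<^sub>R q" for p q :: "'a \<Rightarrow> real"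
    by (simp add: scaleR_add_right)
  note red0 = red_Compl_null(1)[OF inc lim]
  have trunc_S: "(\<lambda>x. min (u x) (r * h x)) \<in> S" if u: "u \<in> D" "AE x in m. 0 \<le> u x" and r: "0 \<le> r" for u r
  proof -
    define t where "t = (\<lambda>x. min (u x) (r * h x))"
    have "t = (\<lambda>x. min (u x) ((r *\<^sub>R h) x))" by (simp add: t_def fun_eq_iff)
    then have tD: "t \<in> D" using V_min[of u "r *\<^sub>R h"] u h_D by auto
    have h0: "AE x in m. 0 \<le> h x" by (rule excessive_nonneg[OF excessive_h])
    define q where "q k = t - r *\<^sub>R (h - red (- F k))" for k
    define v where "v k = t - pos_part (q k)" for k
    have qD: "q k \<in> D" for k using tD h_D red_D by (auto simp: q_def)
    have vD: "v k \<in> D" for k using tD qD by (auto simp: v_def intro: V_pos_part)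
    have v_min: "v k x = min (t x) (r * (h x - red (- F k) x))" for k x
      by (auto simp: v_def q_def min_def max_def)
    have "\<exists>p. (\<forall>n::nat. p n \<in> D \<and> van (p n)) \<and> (\<lambda>n. nrm (p n - t)) \<longlonglongrightarrow> 0"
    proof (rule Mazur_AE[OF vD])
      show "van (v k)" for k
        unfolding van_def
      proof (rule exI[of _ k])
        show "AE x in m. x \<notin> F k \<longrightarrow> v k x = 0"
          using red_eq[of "- F k"] h0 u(2) by eventually_elim (auto simp: v_min t_def r)
      qed
      show "van ((1/2) *\<^sub>R (a + b))" if "van a" "van b" for a b
        unfolding half by (rule van_lincomb[OF that])
      show "nrm (v k) \<le> nrm t + sector_const * (nrm t + r * (nrm h + sector_const * nrm h))" for k
      proof -
        have "nrm (v k) \<le> nrm t + nrm (pos_part (q k))"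
          using nrm_triangle[of t "- pos_part (q k)"] tD V_pos_part[OF qD] by (simp add: v_def)
        also have "nrm (pos_part (q k)) \<le> sector_const * nrm (q k)" by (rule nrm_pos_part_le[OF qD])
        also have "nrm (q k) \<le> nrm t + r * nrm (h - red (- F k))"
          using nrm_triangle[of t "- (r *\<^sub>R (h - red (- F k)))"] tD h_D red_D r
          by (simp add: q_def nrm_scale)
        also have "nrm (h - red (- F k)) \<le> nrm h + nrm (red (- F k))"
          using nrm_triangle[of h "- red (- F k)"] h_D red_D by simp
        also have "nrm (red (- F k)) \<le> sector_const * nrm h"
          by (rule balayage_nrm[OF excessive_h balayage_red])
        finally show ?thesis using K_pos r by (simp add: mult_left_mono)
      qed
      show "t \<in> borel_measurable m" by (rule V_measurable[OF tD])
      show "u \<in> L2 m" using u by auto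
      show "AE x in m. \<bar>v k x\<bar> \<le> u x" for k
        using h0 u(2) red_le[of "- F k"]
      proof eventually_elim
        case (elim x)
        have "0 \<le> r * (h x - red (- F k) x)" "0 \<le> r * h x" using r elim by auto
        then show ?case using elim by (auto simp: v_min t_def)
      qed
      show "AE x in m. (\<lambda>k. v k x) \<longlonglongrightarrow> t x"
        using red0
      proof eventually_elim
        case (elim x)
        have "(\<lambda>k. min (t x) (r * (h x - red (- F k) x))) \<longlonglongrightarrow> min (t x) (r * (h x - 0))"
          by (intro tendsto_intros elim)
        then show ?case by (simp add: v_min t_def)
      qed
    qed
    then obtain p where p: "\<And>n::nat. p n \<in> D \<and> van (p n)" "(\<lambda>n. nrm (p n - t)) \<longlonglongrightarrow> 0" by blast
    have "t \<in> S" by (rule S_closed[OF tD _ p(2)]) (use p(1) van_S in blast)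
    then show ?thesis by (simp add: t_def)
  qed
  have pos_S: "u \<in> S" if u: "u \<in> D" "AE x in m. 0 \<le> u x" for u
  proof -
    define v where "v n = u - pos_part (u - real n *\<^sub>R h)" for n
    have vD: "v n \<in> D" for n using u h_D by (auto simp: v_def intro: V_pos_part)
    have v_min: "v n = (\<lambda>x. min (u x) (real n * h x))" for n
      by (auto simp: v_def fun_eq_iff min_def max_def)
    have "\<exists>p. (\<forall>n::nat. p n \<in> D \<and> p n \<in> S) \<and> (\<lambda>n. nrm (p n - u)) \<longlonglongrightarrow> 0"
    proof (rule Mazur_AE[OF vD])
      show "v n \<in> S" for n unfolding v_min by (rule trunc_S[OF u]) simp
      show "(1/2) *\<^sub>R (a + b) \<in> S" if "a \<in> S" "b \<in> S" for a b
        unfolding half by (rule S_lincomb[OF that])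
      show "nrm (v n) \<le> nrm u + sector_const * nrm u" for n
        using nrm_triangle[of u "- pos_part (u - real n *\<^sub>R h)"] nrm_excess_le(1)[OF u(1) excessive_h, of "real n"]
          V_pos_part[of "u - real n *\<^sub>R h"] u h_D by (simp add: v_def)
      show "u \<in> borel_measurable m" "u \<in> L2 m" using u V_measurable by auto
      show "AE x in m. \<bar>v n x\<bar> \<le> u x" for n
        using u(2) excessive_nonneg[OF excessive_h] by eventually_elim (auto simp: v_min)
      show "AE x in m. (\<lambda>n. v n x) \<longlonglongrightarrow> u x"
        using excess_over_h_AE_null[of u]
      proof eventually_elim
        case (elim x)
        show ?case using tendsto_diff[OF tendsto_const elim, of "u x"] by (simp add: v_def)
      qed
    qed
    then obtain p where p: "\<And>n::nat. p n \<in> D \<and> p n \<in> S" "(\<lambda>n. nrm (p n - u)) \<longlonglongrightarrow> 0" by blast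
    show ?thesis by (rule S_closed[OF u(1) p])
  qed
  have "u \<in> S" if u: "u \<in> D" for u
  proof -
    have "pos_part u \<in> S" "pos_part (- u) \<in> S"
      by (rule pos_S; use u in \<open>auto intro: V_pos_part\<close>)+
    from S_lincomb[OF this, of 1 "-1"] show ?thesis using pos_neg_decomp[of u] by simp
  qed
  then show ?thesis
    using inc cl unfolding nest_def by (auto simp: S_def van_def nrm_eq_norm1 fun_diff_def)
qed

text \<open>Members of the \<open>i\<close>-th nest whose complements have capacity below \<open>2\<^sup>-\<^sup>i 2\<^sup>-\<^sup>k\<close> are intersected over
  \<open>i\<close>.\<close>

lemma common_nest:
  assumes F: "\<And>i::nat. enest (F i)"
  obtains G where "enest G" "\<forall>k i. \<exists>j. G k \<subseteq> F i j"
proof -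
  have "\<exists>M. \<forall>j\<ge>M. ocap (- F i j) < (1/2)^i * (1/2)^k" for i k :: nat
    using order_tendstoD(2)[OF ocap_nest[OF F[of i]], of "(1/2)^i * (1/2)^k"]
    by (simp add: eventually_sequentially)
  then obtain M where M: "\<And>i k j. j \<ge> M i k \<Longrightarrow> ocap (- F i j) < (1/2)^i * (1/2)^k" by metis
  define N where "N i k = (\<Sum>l\<le>k. M i l)" for i k
  have NM: "M i k \<le> N i k" for i k unfolding N_def by (rule member_le_sum) auto
  have Nmono: "N i k \<le> N i l" if "k \<le> l" for i k l
    unfolding N_def by (rule sum_mono2) (use that in auto)
  define G where "G k = (\<Inter>i. F i (N i k))" for k
  have "enest G"
  proof (rule nest_of_ocap)
    show "incseq G"
    proof (rule monoI)
      fix k l :: nat assume "k \<le> l"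
      then have "F i (N i k) \<subseteq> F i (N i l)" for i by (intro incseqD[OF nestD(1)[OF F]] Nmono)
      then show "G k \<subseteq> G l" unfolding G_def by (rule INT_anti_mono[OF subset_refl])
    qed
    show "closed (G k)" for k unfolding G_def using nestD(2)[OF F] by auto
    have bd: "ocap (- G k) \<le> 2 * (1/2)^k" for k
    proof -
      have sums: "(\<lambda>i. (1/2)^i * (1/2)^k) sums (2 * (1/2::real)^k)"
        using sums_mult2[OF geometric_sums[of "1/2::real"], of "(1/2)^k"] by simp
      have "- G k = (\<Union>i. - F i (N i k))" by (auto simp: G_def)
      moreover have "ocap (\<Union>i. - F i (N i k)) \<le> (\<Sum>i. (1/2)^i * (1/2)^k)"
        by (rule ocap_UN_le[OF less_imp_le[OF M[OF NM]] sums_summable[OF sums]])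
      ultimately have "ocap (- G k) \<le> (\<Sum>i. (1/2)^i * (1/2)^k)" by simp
      then show ?thesis using sums_unique[OF sums] by simp
    qed
    show "(\<lambda>k. ocap (- G k)) \<longlonglongrightarrow> 0"
    proof (rule tendsto_sandwich[OF _ _ tendsto_const])
      show "(\<lambda>k. 2 * (1/2)^k) \<longlonglongrightarrow> (0::real)"
        by (intro tendsto_mult_right_zero LIMSEQ_realpow_zero) auto
    qed (use bd ocap_nonneg in auto)
  qed
  moreover have "\<forall>k i. \<exists>j. G k \<subseteq> F i j" by (auto simp: G_def)
  ultimately show ?thesis by (rule that)
qed

abbreviation qcont where "qcont \<equiv> quasi_continuous m D \<E>"

abbreviation qcv where "qcv \<equiv> qc_version m D \<E>"

lemma common_qc_nest:
  assumes w: "\<And>i::nat. qcont (w i)" and F0: "enest F0"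
  obtains G where "enest G" "\<forall>k. \<exists>j. G k \<subseteq> F0 j" "\<forall>k i. continuous_on (G k) (w i)"
proof -
  obtain F where F: "\<And>i. enest (F i)" "\<And>i k. continuous_on (F i k) (w i)"
    using w unfolding quasi_continuous_def by metis
  define F' where "F' i = (case i of 0 \<Rightarrow> F0 | Suc j \<Rightarrow> F j)" for i
  have F': "enest (F' i)" for i using F F0 by (cases i) (auto simp: F'_def)
  obtain G where G: "enest G" "\<forall>k i. \<exists>j. G k \<subseteq> F' i j" by (rule common_nest[OF F'])
  show ?thesis
  proof (rule that[OF G(1)])
    show "\<forall>k. \<exists>j. G k \<subseteq> F0 j"
    proof
      fix k show "\<exists>j. G k \<subseteq> F0 j" using G(2)[rule_format, of k 0] by (simp add: F'_def)
    qed
    show "\<forall>k i. continuous_on (G k) (w i)"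
    proof (intro allI)
      fix k i
      obtain j where "G k \<subseteq> F i j" using G(2)[rule_format, of k "Suc i"] by (auto simp: F'_def)
      then show "continuous_on (G k) (w i)" using F(2) continuous_on_subset by blast
    qed
  qed
qed

lemma qcv_compose2:
  assumes "qcv u w" "qcv u' w'" and f: "\<And>(S :: 'a set) p q. continuous_on S p \<Longrightarrow> continuous_on S q \<Longrightarrow> continuous_on S (\<lambda>x. f (p x) (q x))"
  shows "qcv (\<lambda>x. f (u x) (u' x)) (\<lambda>x. f (w x) (w' x))"
proof -
  obtain F where F: "enest F" "\<forall>k. continuous_on (F k) w"
    using assms(1) by (auto simp: qc_version_def quasi_continuous_def)
  have *: "qcont (if i = 0 then w else w')" for i :: nat
    using assms by (auto simp: qc_version_def)
  obtain G where G: "enest G" "\<forall>k i. continuous_on (G k) (if i = (0::nat) then w else w')"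
    by (rule common_qc_nest[OF * F(1)])
  have cw: "continuous_on (G k) w" "continuous_on (G k) w'" for k
    using G(2)[rule_format, of k 0] G(2)[rule_format, of k 1] by auto
  have "continuous_on (G k) (\<lambda>x. f (w x) (w' x))" for k by (rule f[OF cw])
  then have "qcont (\<lambda>x. f (w x) (w' x))"
    unfolding quasi_continuous_def by (intro exI[of _ G] conjI allI G(1))
  moreover have "AE x in m. f (w x) (w' x) = f (u x) (u' x)"
  proof -
    have "AE x in m. w x = u x" "AE x in m. w' x = u' x" using assms by (auto simp: qc_version_def)
    then show ?thesis by eventually_elim simp
  qed
  ultimately show ?thesis by (simp add: qc_version_def)
qed

lemma qcv_add: "qcv u w \<Longrightarrow> qcv u' w' \<Longrightarrow> qcv (u + u') (w + w')"
  and qcv_diff: "qcv u w \<Longrightarrow> qcv u' w' \<Longrightarrow> qcv (u - u') (w - w')"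
  and qcv_scale: "qcv u w \<Longrightarrow> qcv (c *\<^sub>R u) (c *\<^sub>R w)"
  and qcv_pos_part: "qcv u w \<Longrightarrow> qcv (pos_part u) (pos_part w)"
  and qcv_min_1: "qcv u w \<Longrightarrow> qcv (\<lambda>x. min (u x) 1) (\<lambda>x. min (w x) 1)"
  unfolding plus_fun_def fun_diff_def scaleR_fun_def pos_part_def
  by (rule qcv_compose2; (assumption | (intro continuous_intros; assumption)))+

lemma qcv_D_cong: "qcv u w \<Longrightarrow> qcv u' w \<Longrightarrow> AE x in m. u x = u' x"
  unfolding qc_version_def by (auto elim: eventually_elim2)

lemma AE_in_nest: "enest F \<Longrightarrow> AE x in m. x \<in> (\<Union>k. F k)"
proof -
  assume F: "enest F"
  have "ocap (\<Inter>k. - F k) \<le> 0"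
    by (rule LIMSEQ_le_const[OF ocap_nest[OF F]]) (auto intro!: ocap_mono)
  from AE_notin_of_ocap_zero[OF this] show ?thesis by eventually_elim auto
qed

section \<open>Quasi-continuous versions\<close>

lemma ocap_abs_Chebyshev:
  assumes v: "v \<in> D" and c: "0 < c" and le: "AE x in m. x \<in> U \<longrightarrow> c \<le> \<bar>v x\<bar>"
  shows "c * ocap U \<le> 2 * cap_const * nrm v"
proof -
  define P where "P = U \<inter> {x. 0 \<le> v x}"
  define N where "N = U \<inter> {x. v x < 0}"
  have "c * ocap P \<le> cap_const * nrm v"
  proof (rule ocap_Chebyshev[OF v])
    show "AE x in m. x \<in> P \<longrightarrow> c * h x \<le> v x"
      using le h_le_1
    proof eventually_elim
      case (elim x)
      have "c * h x \<le> c" using elim(2) c by (simp add: mult_left_le)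
      then show ?case using elim(1) by (auto simp: P_def)
    qed
  qed (use c in simp)
  moreover have "c * ocap N \<le> cap_const * nrm (- v)"
  proof (rule ocap_Chebyshev)
    show "AE x in m. x \<in> N \<longrightarrow> c * h x \<le> (- v) x"
      using le h_le_1
    proof eventually_elim
      case (elim x)
      have "c * h x \<le> c" using elim(2) c by (simp add: mult_left_le)
      then show ?case using elim(1) by (auto simp: N_def)
    qed
  qed (use c v in auto)
  moreover have "ocap U \<le> ocap P + ocap N"
  proof -
    have "U = P \<union> N" by (auto simp: P_def N_def)
    then show ?thesis using ocap_Un[of P N] by simp
  qed
  then have "c * ocap U \<le> c * ocap P + c * ocap N" using c by (simp flip: distrib_left)
  ultimately show ?thesis using v by simp
qed

text \<open>The energy of a truncation is at most its pairing with \<open>h\<close>, which tends to zero by weak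
  convergence; for these functions weak convergence is therefore strong.\<close>

lemma truncated_h_nrm: "(\<lambda>n. nrm (\<lambda>x. min (max (h x) 0) (1 / real (Suc n)))) \<longlonglongrightarrow> 0"
proof -
  define Q where "Q n = (\<lambda>x. min (max (h x) 0) (1 / real (Suc n)))" for n
  have Q: "Q n \<in> D" for n unfolding Q_def by (rule unit_truncation_D[OF h_D]) simp
  have bound: "nrm (Q n) \<le> sector_const * nrm h" for n by (rule truncation_nrm(2)[OF h_D _ Q_def]) simp
  have le: "AE x in m. \<bar>Q n x\<bar> \<le> h x" for n
    using h_pos by eventually_elim (auto simp: Q_def)
  have "AE x in m. (\<lambda>n. Q n x) \<longlonglongrightarrow> 0 x"
  proof (rule AE_I2)
    fix x
    have "(\<lambda>n. Q n x) \<longlonglongrightarrow> 0"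
      by (rule tendsto_sandwich[OF _ _ tendsto_const LIMSEQ_inverse_real_of_nat])
        (auto simp: Q_def inverse_eq_divide)
    then show "(\<lambda>n. Q n x) \<longlonglongrightarrow> 0 x" by simp
  qed
  from weak_limit(2)[OF Q bound _ D_L2[OF h_D] le this bdd_linear_left[OF h_D]]
  have "(\<lambda>n. B (Q n) h) \<longlonglongrightarrow> B (\<lambda>x. 0 x) h"
    by (simp add: zero_fun_def)
  then have lim: "(\<lambda>n. B (Q n) h) \<longlonglongrightarrow> 0" using zero_left[OF h_D] by (simp add: zero_fun_def)
  have "(\<lambda>n. (nrm (Q n))\<^sup>2) \<longlonglongrightarrow> 0"
  proof (rule tendsto_sandwich[OF _ _ tendsto_const lim])
    show "\<forall>\<^sub>F n in sequentially. (nrm (Q n))\<^sup>2 \<le> B (Q n) h"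
      using truncation_nrm(1)[OF h_D _ Q_def] by (intro always_eventually) auto
  qed auto
  then have "(\<lambda>n. sqrt ((nrm (Q n))\<^sup>2)) \<longlonglongrightarrow> sqrt 0" by (intro tendsto_intros)
  then show ?thesis using Q by (simp add: Q_def)
qed

text \<open>Where \<open>w\<close> is small, \<open>h\<close> coincides with one of its truncations at a low level, and these have small
  norm.\<close>

lemma h_bounded_below_nest:
  assumes F: "enest F" and cont: "\<And>k. continuous_on (F k) w" and w: "AE x in m. w x = h x"
  shows "enest (\<lambda>k. {x \<in> F k. 1 / real (Suc k) \<le> w x})"
proof (rule nest_of_ocap)
  let ?H = "\<lambda>k. {x \<in> F k. 1 / real (Suc k) \<le> w x}"
  show "incseq ?H"
  proof (rule monoI, safe)
    fix k l :: nat and x assume kl: "k \<le> l" and x: "x \<in> F k" "1 / real (Suc k) \<le> w x"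
    show "x \<in> F l" using incseqD[OF nestD(1)[OF F] kl] x by auto
    have "1 / real (Suc l) \<le> 1 / real (Suc k)" using kl by (intro frac_le) auto
    then show "1 / real (Suc l) \<le> w x" using x by linarith
  qed
  show "closed (?H k)" for k
    by (rule continuous_on_closed_Collect_le[OF continuous_on_const cont nestD(2)[OF F]])
  have bd: "ocap (- ?H k) \<le> ocap (- F k) + cap_const * nrm (\<lambda>x. min (max (h x) 0) (1 / real (Suc k)))" for k
  proof -
    let ?Q = "\<lambda>x. min (max (h x) 0) (1 / real (Suc k))" and ?U = "{x. w x < 1 / real (Suc k)}"
    have "ocap (- ?H k) \<le> ocap (- F k \<union> ?U)" by (rule ocap_mono) auto
    also have "\<dots> \<le> ocap (- F k) + ocap ?U" by (rule ocap_Un)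
    also have "ocap ?U \<le> cap_const * nrm ?Q"
    proof -
      have "1 * ocap ?U \<le> cap_const * nrm ?Q"
      proof (rule ocap_Chebyshev)
        show "?Q \<in> D" by (rule unit_truncation_D[OF h_D]) simp
        show "AE x in m. x \<in> ?U \<longrightarrow> 1 * h x \<le> ?Q x"
          using w by eventually_elim auto
      qed simp
      then show ?thesis by simp
    qed
    finally show ?thesis by simp
  qed
  show "(\<lambda>k. ocap (- ?H k)) \<longlonglongrightarrow> 0"
  proof (rule tendsto_sandwich[OF _ _ tendsto_const])
    show "(\<lambda>k. ocap (- F k) + cap_const * nrm (\<lambda>x. min (max (h x) 0) (1 / real (Suc k)))) \<longlonglongrightarrow> 0"
      by (rule tendsto_eq_intros ocap_nest[OF F] truncated_h_nrm refl | simp)+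
  qed (use bd ocap_nonneg in auto)
qed

end

locale quasi_regular_form = reference_form m D \<E> \<phi>
  for m :: "'a::topological_space measure" and D :: "('a \<Rightarrow> real) set"
    and \<E> :: "('a \<Rightarrow> real) \<Rightarrow> ('a \<Rightarrow> real) \<Rightarrow> real" and \<phi> :: "'a \<Rightarrow> real" +
  assumes qr: "quasi_regular m D \<E>"
begin

lemma compact_nest: obtains F where "enest F" "\<And>k. compact (F k)"
  using qr unfolding quasi_regular_def by metis

text \<open>Egorov's argument for capacity: in a sequence of quasi-continuous functions converging fast in
  norm, the successive differences are uniformly small off sets of small capacity, so the limit is
  continuous on the complements of these sets.\<close>

lemma qcv_exists:
  assumes v: "v \<in> D" shows "\<exists>w. qcv v w"
proof -
  obtain D0 where D0: "D0 \<subseteq> D" "\<And>u \<epsilon>. u \<in> D \<Longrightarrow> \<epsilon> > 0 \<Longrightarrow> \<exists>v\<in>D0. nrm (u - v) < \<epsilon>"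
    "\<And>v. v \<in> D0 \<Longrightarrow> \<exists>w. qcv v w"
    using qr unfolding quasi_regular_def nrm_eq_norm1 fun_diff_def by metis
  have "\<exists>u\<in>D0. nrm (v - u) < (1/4)^j" for j :: nat using D0(2)[OF v, of "(1/4)^j"] by simp
  then obtain u where u0: "\<And>j. u j \<in> D0" and u_near: "\<And>j. nrm (v - u j) < (1/4)^j" by metis
  have uD: "u j \<in> D" for j using u0 D0(1) by auto
  obtain w where w: "\<And>j. qcv (u j) (w j)" using D0(3)[OF u0] by metis
  obtain F0 where F0: "enest F0" using compact_nest by blast
  have wqc: "qcont (w i)" for i using w by (auto simp: qc_version_def)
  obtain G where G: "enest G" "\<forall>k i. continuous_on (G k) (w i)"
    by (rule common_qc_nest[OF wqc F0])
  have "\<exists>k. ocap (- G k) < (1/2)^j" for j :: nat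
    using order_tendstoD(2)[OF ocap_nest[OF G(1)], of "(1/2)^j"] by (auto simp: eventually_sequentially)
  then obtain k where k: "\<And>j. ocap (- G (k j)) < (1/2)^j" by metis
  define A where "A j = {x \<in> G (k j). \<bar>w (Suc j) x - w j x\<bar> \<le> (1/2)^j}" for j
  define H where "H l = (\<Inter>j\<in>{l..}. A j)" for l
  define C where "C = 4 * cap_const + 1"
  have capA: "ocap (- A j) \<le> C * (1/2)^j" for j
  proof -
    let ?U = "{x. (1/2)^j < \<bar>w (Suc j) x - w j x\<bar>}"
    have "ocap (- A j) \<le> ocap (- G (k j) \<union> ?U)" by (rule ocap_mono) (auto simp: A_def)
    also have "\<dots> \<le> ocap (- G (k j)) + ocap ?U" by (rule ocap_Un)
    finally have 1: "ocap (- A j) \<le> (1/2)^j + ocap ?U" using k[of j] by simp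
    have "(1/2)^j * ocap ?U \<le> 2 * cap_const * nrm (u (Suc j) - u j)"
    proof (rule ocap_abs_Chebyshev)
      have "AE x in m. w j x = u j x" "AE x in m. w (Suc j) x = u (Suc j) x"
        using w by (auto simp: qc_version_def)
      then show "AE x in m. x \<in> ?U \<longrightarrow> (1/2)^j \<le> \<bar>(u (Suc j) - u j) x\<bar>"
        by eventually_elim auto
    qed (use uD in auto)
    also have "\<dots> \<le> 2 * cap_const * (2 * (1/4)^j)"
    proof -
      have "nrm (u (Suc j) - u j) \<le> nrm (u (Suc j) - v) + nrm (v - u j)"
        by (rule nrm_triangle_diff[OF uD v uD])
      also have "\<dots> \<le> (1/4)^Suc j + (1/4)^j"
        using u_near[of j] u_near[of "Suc j"] nrm_diff_commute[OF uD v, of "Suc j"] by linarith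
      also have "\<dots> \<le> 2 * (1/4)^j" by simp
      finally show ?thesis using cap_const_pos by simp
    qed
    also have "\<dots> = (1/2)^j * (4 * cap_const * (1/2)^j)"
      by (simp add: power_mult_distrib[symmetric] mult.assoc mult.left_commute)
    finally have "ocap ?U \<le> 4 * cap_const * (1/2)^j" by (simp add: mult_le_cancel_left)
    with 1 show ?thesis by (simp add: C_def algebra_simps)
  qed
  have Hnest: "enest H"
  proof (rule nest_of_ocap)
    show "incseq H" unfolding H_def by (intro monoI INF_superset_mono) auto
    show "closed (H l)" for l
    proof -
      have "closed (A j)" for j
        unfolding A_def
        by (intro continuous_on_closed_Collect_le[OF _ continuous_on_const nestD(2)[OF G(1)]] continuous_intros G(2)[rule_format])
      then show ?thesis unfolding H_def by auto
    qed
    have bd: "ocap (- H l) \<le> 2 * C * (1/2)^l" for l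
    proof -
      have sums: "(\<lambda>i. C * (1/2)^(i + l)) sums (C * (1/2)^l * 2)"
        using sums_mult[OF geometric_sums[of "1/2::real"], of "C * (1/2)^l"] by (simp add: power_add ac_simps)
      have "- H l = (\<Union>i. - A (i + l))"
      proof -
        have "range (\<lambda>i. i + l) = {l..}" by (auto simp: image_iff) (metis le_add_diff_inverse2)
        then have "H l = (\<Inter>i. A (i + l))" unfolding H_def by (metis image_image)
        then show ?thesis by auto
      qed
      moreover have "ocap (\<Union>i. - A (i + l)) \<le> (\<Sum>i. C * (1/2)^(i + l))"
        by (rule ocap_UN_le[OF capA sums_summable[OF sums]])
      ultimately show ?thesis using sums_unique[OF sums] by simp
    qed
    show "(\<lambda>l. ocap (- H l)) \<longlonglongrightarrow> 0"
    proof (rule tendsto_sandwich[OF _ _ tendsto_const])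
      show "(\<lambda>l. 2 * C * (1/2)^l) \<longlonglongrightarrow> 0"
        by (intro tendsto_mult_right_zero LIMSEQ_realpow_zero) auto
    qed (use bd ocap_nonneg in auto)
  qed
  define z where "z x = lim (\<lambda>n. w n x)" for x
  have limit: "continuous_on (H l) z \<and> (\<forall>x\<in>H l. (\<lambda>n. w n x) \<longlonglongrightarrow> z x)" for l
  proof -
    define s where "s x = (\<Sum>i. w (Suc (i + l)) x - w (i + l) x)" for x
    have "uniform_limit (H l) (\<lambda>n x. \<Sum>i<n. w (Suc (i + l)) x - w (i + l) x) s sequentially"
      unfolding s_def
    proof (rule Weierstrass_m_test)
      show "norm (w (Suc (i + l)) x - w (i + l) x) \<le> (1/2)^(i + l)" if "x \<in> H l" for i x
        using that by (auto simp: H_def A_def)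
      show "summable (\<lambda>i. (1/2::real)^(i + l))"
        using summable_geometric[of "1/2::real"] by (intro summable_ignore_initial_segment) simp
    qed
    moreover have "(\<Sum>i<n. w (Suc (i + l)) x - w (i + l) x) = w (n + l) x - w l x" for n x
      by (induction n) auto
    ultimately have ul: "uniform_limit (H l) (\<lambda>n x. w (n + l) x - w l x) s sequentially" by simp
    have contw: "continuous_on (H l) (w i)" for i
    proof (rule continuous_on_subset)
      show "continuous_on (G (k l)) (w i)" using G(2) by blast
      show "H l \<subseteq> G (k l)" by (auto simp: H_def A_def)
    qed
    have s: "continuous_on (H l) s"
      by (rule uniform_limit_theorem[OF _ ul]) (auto intro!: always_eventually continuous_intros contw)
    have lim: "(\<lambda>n. w n x) \<longlonglongrightarrow> s x + w l x" if "x \<in> H l" for x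
    proof -
      have "(\<lambda>n. (w (n + l) x - w l x) + w l x) \<longlonglongrightarrow> s x + w l x"
        by (intro tendsto_intros tendsto_uniform_limitI[OF ul that])
      then have "(\<lambda>n. w (n + l) x) \<longlonglongrightarrow> s x + w l x" by simp
      then show ?thesis by (rule LIMSEQ_offset)
    qed
    have z: "z x = s x + w l x" if "x \<in> H l" for x
      unfolding z_def by (rule limI[OF lim[OF that]])
    have "continuous_on (H l) (\<lambda>x. s x + w l x)" by (intro continuous_intros s contw)
    then have "continuous_on (H l) z" by (rule continuous_on_eq) (rule z[symmetric])
    moreover have "(\<lambda>n. w n x) \<longlonglongrightarrow> z x" if "x \<in> H l" for x
      unfolding z[OF that] by (rule lim[OF that])
    ultimately show ?thesis by blast
  qed
  have "AE x in m. z x = v x"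
  proof -
    have "(\<lambda>n. nrm (u n - v)) \<longlonglongrightarrow> 0"
    proof (rule tendsto_sandwich[OF _ _ tendsto_const])
      show "(\<lambda>n. (1/4)^n) \<longlonglongrightarrow> (0::real)" by (rule LIMSEQ_realpow_zero) auto
      show "\<forall>\<^sub>F n in sequentially. nrm (u n - v) \<le> (1/4)^n"
        using u_near uD v nrm_diff_commute[OF v uD] by (intro always_eventually allI less_imp_le) simp
    qed (use uD v in auto)
    then obtain r :: "nat \<Rightarrow> nat" where r: "strict_mono r" "AE x in m. (\<lambda>n. u (r n) x) \<longlonglongrightarrow> v x"
      by (rule AE_subsequence[OF uD v])
    have "AE x in m. \<forall>j. w j x = u j x"
      unfolding AE_all_countable using w by (auto simp: qc_version_def)
    with r(2) AE_in_nest[OF Hnest] show ?thesis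
    proof eventually_elim
      case (elim x)
      then obtain l where "x \<in> H l" by blast
      then have "(\<lambda>n. w n x) \<longlonglongrightarrow> z x" using limit by blast
      then have "(\<lambda>n. w (r n) x) \<longlonglongrightarrow> z x" using LIMSEQ_subseq_LIMSEQ[OF _ r(1)] by (auto simp: o_def)
      then show ?case using elim LIMSEQ_unique by auto
    qed
  qed
  then have "qcv v z"
    using Hnest limit unfolding qc_version_def quasi_continuous_def by blast
  then show ?thesis by (rule exI[of _ z])
qed

definition hq where "hq = (SOME w. qcv h w)"

lemma qcv_hq: "qcv h hq"
  unfolding hq_def by (rule someI_ex[OF qcv_exists[OF h_D]])

lemma good_nest:
  assumes w: "\<And>i::nat. qcont (w i)" and F1: "enest F1"
  obtains F where "enest F" "\<forall>k. \<exists>j. F k \<subseteq> F1 j" "\<forall>k. compact (F k)" "\<forall>k i. continuous_on (F k) (w i)"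
    "\<forall>k. continuous_on (F k) hq" "\<forall>k. \<forall>x\<in>F k. 1 / real (Suc k) \<le> hq x"
proof -
  obtain F2 where F2: "enest F2" "\<And>k. compact (F2 k)" using compact_nest by blast
  define F' where "F' i = (if i = (0::nat) then F1 else F2)" for i
  have "enest (F' i)" for i using F1 F2 by (simp add: F'_def)
  then obtain F0 where F0: "enest F0" "\<forall>k i. \<exists>j. F0 k \<subseteq> F' i j" by (rule common_nest)
  have F01: "\<exists>j. F0 k \<subseteq> F1 j" for k using F0(2)[rule_format, of k 0] by (simp add: F'_def)
  have F02: "\<exists>j. F0 k \<subseteq> F2 j" for k using F0(2)[rule_format, of k 1] by (simp add: F'_def)
  define w' where "w' i = (case i of 0 \<Rightarrow> hq | Suc j \<Rightarrow> w j)" for i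
  have w': "qcont (w' i)" for i
    using w qcv_hq by (cases i) (auto simp: w'_def qc_version_def)
  obtain G where G: "enest G" "\<forall>k. \<exists>j. G k \<subseteq> F0 j" "\<forall>k i. continuous_on (G k) (w' i)"
    by (rule common_qc_nest[OF w' F0(1)])
  have cont: "continuous_on (G k) hq" "continuous_on (G k) (w i)" for k i
    using G(3)[rule_format, of k 0] G(3)[rule_format, of k "Suc i"] by (auto simp: w'_def)
  let ?H = "\<lambda>k. {x \<in> G k. 1 / real (Suc k) \<le> hq x}"
  have H: "enest ?H"
    by (rule h_bounded_below_nest[OF G(1) cont(1)]) (use qcv_hq in \<open>auto simp: qc_version_def\<close>)
  have sub: "?H k \<subseteq> G k" for k by auto
  show ?thesis
  proof (rule that[OF H])
    show "\<forall>k. \<exists>j. ?H k \<subseteq> F1 j"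
    proof
      fix k
      obtain i where "G k \<subseteq> F0 i" using G(2) by blast
      moreover obtain j where "F0 i \<subseteq> F1 j" using F01 by blast
      ultimately have "?H k \<subseteq> F1 j" by auto
      then show "\<exists>j. ?H k \<subseteq> F1 j" ..
    qed
    show "\<forall>k. compact (?H k)"
    proof
      fix k
      obtain i where "G k \<subseteq> F0 i" using G(2) by blast
      moreover obtain j where "F0 i \<subseteq> F2 j" using F02 by blast
      ultimately have "?H k = F2 j \<inter> ?H k" by auto
      moreover have "compact (F2 j \<inter> ?H k)" by (rule compact_Int_closed[OF F2(2) nestD(2)[OF H]])
      ultimately show "compact (?H k)" by simp
    qed
  qed (use continuous_on_subset[OF cont(1) sub] continuous_on_subset[OF cont(2) sub] in auto)
qed

end

section \<open>Suslin sets and capacitability\<close>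

definition suslin :: "'a::metric_space set \<Rightarrow> bool" where
  "suslin A \<longleftrightarrow> (\<exists>C :: ('a \<times> (nat \<Rightarrow> nat)) set. closed C \<and> A = fst ` C)"

lemma suslin_closed: "closed A \<Longrightarrow> suslin A"
  unfolding suslin_def by (intro exI[of _ "A \<times> UNIV"]) (auto intro: closed_Times)

lemma continuous_on_snd_coordinate: "continuous_on UNIV (\<lambda>p :: 'a::topological_space \<times> (nat \<Rightarrow> nat). snd p k)"
  by (rule continuous_on_product_then_coordinatewise[OF continuous_on_snd[OF continuous_on_id]])

text \<open>The first coordinate of the new sequence names the set of the union, the remaining ones are a
  sequence for that set.\<close>

lemma suslin_UN:
  assumes "\<And>n::nat. suslin (A n)" shows "suslin (\<Union>n. A n)"
proof -
  obtain C :: "nat \<Rightarrow> ('a \<times> (nat \<Rightarrow> nat)) set" where C: "\<And>n. closed (C n)" "\<And>n. A n = fst ` C n"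
    using assms unfolding suslin_def by metis
  define f :: "'a \<times> (nat \<Rightarrow> nat) \<Rightarrow> 'a \<times> (nat \<Rightarrow> nat)" where "f p = (fst p, \<lambda>k. snd p (Suc k))" for p
  have f: "continuous_on UNIV f"
    unfolding f_def
    by (rule continuous_on_Pair[OF continuous_on_fst[OF continuous_on_id]
          continuous_on_coordinatewise_then_product[OF continuous_on_snd_coordinate]])
  have coord: "continuous_on UNIV (\<lambda>p :: 'a \<times> (nat \<Rightarrow> nat). snd p 0)"
    by (rule continuous_on_snd_coordinate)
  define E where "E = {p. f p \<in> C (snd p 0)}"
  have "- E = (\<Union>n. (\<lambda>p. snd p 0) -` {n} \<inter> f -` (- C n))" by (auto simp: E_def)
  also have "open \<dots>"
    using C(1) by (intro open_UN ballI open_Int open_vimage[OF _ coord] open_vimage[OF _ f])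
      (auto intro: open_discrete)
  finally have "closed E" by (simp add: closed_def)
  moreover have "(\<Union>n. A n) = fst ` E"
  proof
    show "fst ` E \<subseteq> (\<Union>n. A n)" by (force simp: E_def C(2) f_def)
    show "(\<Union>n. A n) \<subseteq> fst ` E"
    proof
      fix x assume "x \<in> (\<Union>n. A n)"
      then obtain n s where "(x, s) \<in> C n" unfolding C(2) by auto
      then have "(x, case_nat n s) \<in> E" by (simp add: E_def f_def)
      then show "x \<in> fst ` E" by force
    qed
  qed
  ultimately show ?thesis unfolding suslin_def by blast
qed

text \<open>One sequence carries countably many, interleaved by \<open>prod_encode\<close>.\<close>

lemma suslin_INT:
  assumes "\<And>n::nat. suslin (A n)" shows "suslin (\<Inter>n. A n)"
proof -
  obtain C :: "nat \<Rightarrow> ('a \<times> (nat \<Rightarrow> nat)) set" where C: "\<And>n. closed (C n)" "\<And>n. A n = fst ` C n"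
    using assms unfolding suslin_def by metis
  define f :: "nat \<Rightarrow> 'a \<times> (nat \<Rightarrow> nat) \<Rightarrow> 'a \<times> (nat \<Rightarrow> nat)"
    where "f n p = (fst p, \<lambda>k. snd p (prod_encode (n, k)))" for n p
  have f: "continuous_on UNIV (f n)" for n
    unfolding f_def
    by (rule continuous_on_Pair[OF continuous_on_fst[OF continuous_on_id]
          continuous_on_coordinatewise_then_product[OF continuous_on_snd_coordinate]])
  define E where "E = (\<Inter>n. f n -` C n)"
  have "closed E"
    unfolding E_def using C(1) by (intro closed_INT ballI closed_vimage[OF _ f])
  moreover have "(\<Inter>n. A n) = fst ` E"
  proof
    show "fst ` E \<subseteq> (\<Inter>n. A n)" by (force simp: E_def C(2) f_def)
    show "(\<Inter>n. A n) \<subseteq> fst ` E"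
    proof
      fix x assume "x \<in> (\<Inter>n. A n)"
      then have "x \<in> fst ` C n" for n unfolding C(2) by blast
      then have "\<forall>n. \<exists>s. (x, s) \<in> C n" by (metis imageE prod.collapse)
      then obtain s where s: "\<And>n. (x, s n) \<in> C n" by metis
      define t where "t i = s (fst (prod_decode i)) (snd (prod_decode i))" for i
      have "(x, t) \<in> E" using s by (simp add: E_def f_def t_def)
      then show "x \<in> fst ` E" by force
    qed
  qed
  ultimately show ?thesis unfolding suslin_def by blast
qed

lemma suslin_open:
  assumes "open U" shows "suslin U"
proof -
  have "fsigma_in euclidean U"
    by (rule open_imp_fsigma_in[OF metrizable_space_euclidean iffD1[OF open_openin assms]])
  then obtain C :: "nat \<Rightarrow> 'a set" where C: "\<forall>n. closedin euclidean (C n)" and U: "\<Union>(range C) = U"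
    unfolding fsigma_in_ascending by (elim exE conjE)
  have "suslin (\<Union>n. C n)" using C by (intro suslin_UN suslin_closed) (simp flip: closed_closedin)
  then show ?thesis unfolding U .
qed

text \<open>The sets that are Suslin together with their complement form a sigma-algebra.\<close>

theorem suslin_borel:
  assumes "A \<in> sets borel" shows "suslin A"
proof -
  have "A \<in> sigma_sets UNIV (Collect closed)" using assms by (simp add: borel_eq_closed)
  then have "suslin A \<and> suslin (- A)"
  proof induction
    case (Basic A)
    then show ?case by (auto intro: suslin_closed suslin_open)
  next
    case Empty
    show ?case by (simp add: suslin_closed)
  next
    case (Compl A)
    then show ?case by (simp add: Compl_eq_Diff_UNIV[symmetric])
  next
    case (Union A)
    then show ?case using suslin_UN[of A] suslin_INT[of "\<lambda>n. - A n"] by simp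
  qed
  then show ?thesis ..
qed

lemma compact_bounded_sequences: "compact {s :: nat \<Rightarrow> nat. \<forall>i. s i \<le> n i}"
proof -
  have "compactin (product_topology (\<lambda>_. euclidean) UNIV) (PiE UNIV (\<lambda>i. {..n i}))"
    unfolding compactin_PiE by (simp add: finite_imp_compact)
  moreover have "PiE UNIV (\<lambda>i. {..n i}) = {s. \<forall>i. s i \<le> n i}" by (auto simp: PiE_def Pi_def)
  ultimately show ?thesis by (simp add: euclidean_product_topology)
qed

lemma tendsto_coordinatewise:
  fixes f :: "nat \<Rightarrow> 'i \<Rightarrow> 'b::topological_space"
  shows "f \<longlonglongrightarrow> l \<longleftrightarrow> (\<forall>i. (\<lambda>n. f n i) \<longlonglongrightarrow> l i)"
  using limitin_componentwise[of "\<lambda>_. euclidean :: 'b topology" UNIV f l sequentially]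
  by (simp add: euclidean_product_topology)

text \<open>Choquet's theorem. By continuity from below, the coordinates of the Baire space can be bounded one
  after the other without the capacity dropping to \<open>c\<close>. The points of \<open>A\<close> that arise from sequences
  obeying all the bounds form a compact set \<open>K\<close>. By compactness every open \<open>U \<supseteq> K\<close> already contains the
  points arising from finitely many bounds, which is why outer regularity transfers the lower bound
  to \<open>K\<close>.\<close>

lemma capacitability:
  fixes F :: "'a::metric_space set" and cp :: "'a set \<Rightarrow> real"
  assumes mono: "\<And>A A'. A \<subseteq> A' \<Longrightarrow> cp A \<le> cp A'"
    and inc: "\<And>A c. incseq A \<Longrightarrow> (\<And>n::nat. cp (A n) \<le> c) \<Longrightarrow> cp (\<Union>n. A n) \<le> c"
    and outer: "\<And>A c. (\<And>U. open U \<Longrightarrow> A \<subseteq> U \<Longrightarrow> c \<le> cp U) \<Longrightarrow> c \<le> cp A"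
    and F: "compact F" and A: "A \<in> sets borel" "A \<subseteq> F" and c: "c < cp A"
  obtains K where "compact K" "K \<subseteq> A" "c \<le> cp K"
proof -
  obtain C :: "('a \<times> (nat \<Rightarrow> nat)) set" where C: "closed C" "A = fst ` C"
    using suslin_borel[OF A(1)] unfolding suslin_def by blast
  define S where "S L = {x. \<exists>s. (x, s) \<in> C \<and> (\<forall>i<length L. s i \<le> L ! i)}" for L :: "nat list"
  have step: "\<exists>a. c < cp (S (L @ [a]))" if L: "c < cp (S L)" for L
  proof (rule ccontr)
    assume "\<not> ?thesis"
    then have "cp (S (L @ [a])) \<le> c" for a by (simp add: not_less)
    moreover have "incseq (\<lambda>a. S (L @ [a]))"
    proof (intro monoI subsetI)
      fix a b :: nat and x assume ab: "a \<le> b" and "x \<in> S (L @ [a])"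
      then obtain s where s: "(x, s) \<in> C" "\<forall>i<Suc (length L). s i \<le> (L @ [a]) ! i" by (auto simp: S_def)
      have "(L @ [a]) ! i \<le> (L @ [b]) ! i" if "i < Suc (length L)" for i
        using that ab by (auto simp: nth_append less_Suc_eq)
      then have "\<forall>i<length (L @ [b]). s i \<le> (L @ [b]) ! i" using s(2) by (auto intro: order_trans)
      then show "x \<in> S (L @ [b])" using s(1) unfolding S_def by blast
    qed
    ultimately have "cp (\<Union>a. S (L @ [a])) \<le> c" by (intro inc)
    moreover have "S L \<subseteq> (\<Union>a. S (L @ [a]))"
    proof
      fix x assume "x \<in> S L"
      then obtain s where s: "(x, s) \<in> C" "\<forall>i<length L. s i \<le> L ! i" by (auto simp: S_def)
      have "\<forall>i<length (L @ [s (length L)]). s i \<le> (L @ [s (length L)]) ! i"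
        using s(2) by (auto simp: nth_append less_Suc_eq)
      then have "x \<in> S (L @ [s (length L)])" using s(1) unfolding S_def by blast
      then show "x \<in> (\<Union>a. S (L @ [a]))" by blast
    qed
    ultimately show False using L mono[of "S L"] by (meson not_le order_trans)
  qed
  have "S [] = A" by (force simp: S_def C(2))
  then obtain f where f: "\<And>k::nat. length (f k) = k \<and> c < cp (S (f k))" "\<And>k. \<exists>a. f (Suc k) = f k @ [a]"
    using dependent_nat_choice[of "\<lambda>k L. length L = k \<and> c < cp (S L)" "\<lambda>k L L'. \<exists>a. L' = L @ [a]"]
      c step by (metis length_0_conv length_append_singleton)
  define n where "n i = f (Suc i) ! i" for i
  have fn: "f k ! i = n i" if "i < k" for i k
    using that
  proof (induction k)
    case (Suc k)
    show ?case
    proof (cases "i = k")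
      case False
      then have "i < k" using Suc by simp
      moreover obtain a where "f (Suc k) = f k @ [a]" using f(2) by blast
      ultimately show ?thesis using Suc f(1)[of k] by (simp add: nth_append)
    qed (simp add: n_def)
  qed simp
  define P where "P = {s :: nat \<Rightarrow> nat. \<forall>i. s i \<le> n i}"
  define K where "K = fst ` (C \<inter> (F \<times> P))"
  have FP: "compact (F \<times> P)" unfolding P_def by (intro compact_Times F compact_bounded_sequences)
  have "compact (C \<inter> (F \<times> P))" by (rule closed_Int_compact[OF C(1) FP])
  then have "compact K"
    unfolding K_def by (intro compact_continuous_image continuous_intros)
  moreover have "K \<subseteq> A" by (auto simp: K_def C(2))
  moreover have "c \<le> cp K"
  proof (rule outer)
    fix U assume U: "open U" "K \<subseteq> U"
    have "\<exists>k. S (f k) \<subseteq> U"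
    proof (rule ccontr)
      assume "\<not> ?thesis"
      then have "\<forall>k. \<exists>x s. x \<notin> U \<and> (x, s) \<in> C \<and> (\<forall>i<k. s i \<le> n i)"
        using f(1) fn unfolding S_def by (simp add: subset_eq) metis
      then obtain x s where xs: "\<And>k. x k \<notin> U" "\<And>k. (x k, s k) \<in> C" "\<And>k i. i < k \<Longrightarrow> s k i \<le> n i"
        by metis
      define t where "t k i = (if i < k then s k i else 0)" for k i
      have "x k \<in> F" for k using xs(2)[of k] A(2) C(2) by force
      then have "(x k, t k) \<in> F \<times> P" for k using xs(3) by (auto simp: P_def t_def)
      then obtain l r where l: "l \<in> F \<times> P" and r: "strict_mono (r :: nat \<Rightarrow> nat)"
        and lim: "((\<lambda>k. (x k, t k)) \<circ> r) \<longlonglongrightarrow> l"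
        using seq_compactE[OF compact_imp_seq_compact[OF FP], of "\<lambda>k. (x k, t k)"] by blast
      have x: "(\<lambda>j. x (r j)) \<longlonglongrightarrow> fst l" using tendsto_fst[OF lim] by (simp add: o_def)
      have t: "(\<lambda>j. t (r j)) \<longlonglongrightarrow> snd l" using tendsto_snd[OF lim] by (simp add: o_def)
      have "(\<lambda>j. s (r j)) \<longlonglongrightarrow> snd l"
        unfolding tendsto_coordinatewise
      proof
        fix i
        have ti: "(\<lambda>j. t (r j) i) \<longlonglongrightarrow> snd l i" using t unfolding tendsto_coordinatewise by blast
        have "t (r j) i = s (r j) i" if "j \<ge> Suc i" for j
          using seq_suble[OF r, of j] that by (simp add: t_def)
        then have "\<forall>\<^sub>F j in sequentially. t (r j) i = s (r j) i"
          by (auto simp: eventually_sequentially)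
        then show "(\<lambda>j. s (r j) i) \<longlonglongrightarrow> snd l i" using ti by (rule Lim_transform_eventually[rotated])
      qed
      then have "(\<lambda>j. (x (r j), s (r j))) \<longlonglongrightarrow> (fst l, snd l)" by (intro tendsto_Pair x)
      from closed_sequentially[OF C(1) xs(2) this] have "(fst l, snd l) \<in> C" .
      then have "l \<in> C \<inter> (F \<times> P)" using l by simp
      then have "fst l \<in> K" unfolding K_def by blast
      moreover have "fst l \<in> - U"
        using closed_sequentially[OF _ _ x, of "- U"] U(1) xs(1) by (auto simp: closed_def)
      ultimately show False using U(2) by auto
    qed
    then obtain k where "S (f k) \<subseteq> U" by blast
    then show "c \<le> cp U" using f(1)[of k] mono[of "S (f k)" U] by linarith
  qed
  ultimately show ?thesis by (rule that)
qed

section \<open>The Daniell-Stone theorem\<close>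

text \<open>All order relations are required on \<open>X\<close> only, so that the representing measure will be carried
  by \<open>X\<close>.\<close>

locale daniell_functional =
  fixes W :: "('a \<Rightarrow> real) set" and L :: "('a \<Rightarrow> real) \<Rightarrow> real" and X :: "'a set"
  assumes subspace_W: "subspace W"
    and L_add: "\<And>u v. u \<in> W \<Longrightarrow> v \<in> W \<Longrightarrow> L (u + v) = L u + L v"
    and L_scale: "\<And>c u. u \<in> W \<Longrightarrow> L (c *\<^sub>R u) = c * L u"
    and W_pos_part: "\<And>u. u \<in> W \<Longrightarrow> pos_part u \<in> W"
    and W_min_1: "\<And>u. u \<in> W \<Longrightarrow> (\<lambda>x. min (u x) 1) \<in> W"
    and L_nonneg: "\<And>u. u \<in> W \<Longrightarrow> (\<And>x. x \<in> X \<Longrightarrow> 0 \<le> u x) \<Longrightarrow> 0 \<le> L u"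
    and L_continuous: "\<And>u. (\<And>n::nat. u n \<in> W) \<Longrightarrow> (\<And>n x. x \<in> X \<Longrightarrow> u (Suc n) x \<le> u n x) \<Longrightarrow>
          (\<And>x. x \<in> X \<Longrightarrow> (\<lambda>n. u n x) \<longlonglongrightarrow> 0) \<Longrightarrow> (\<lambda>n. L (u n)) \<longlonglongrightarrow> 0"
begin

lemma W_add: "u \<in> W \<Longrightarrow> v \<in> W \<Longrightarrow> u + v \<in> W"
  and W_diff: "u \<in> W \<Longrightarrow> v \<in> W \<Longrightarrow> u - v \<in> W"
  and W_scale: "u \<in> W \<Longrightarrow> c *\<^sub>R u \<in> W"
  and W_zero: "0 \<in> W"
  and W_minus: "u \<in> W \<Longrightarrow> - u \<in> W"
  using subspace_W by (auto simp: subspace_add subspace_diff subspace_scale subspace_0 subspace_neg)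

lemma L_diff: "u \<in> W \<Longrightarrow> v \<in> W \<Longrightarrow> L (u - v) = L u - L v"
  using L_add[of u "(-1) *\<^sub>R v"] L_scale[of v "-1"] W_scale[of v "-1"] by simp

lemma L_zero: "L 0 = 0"
  using L_scale[OF W_zero, of 0] by simp

lemma L_mono: "u \<in> W \<Longrightarrow> v \<in> W \<Longrightarrow> (\<And>x. x \<in> X \<Longrightarrow> u x \<le> v x) \<Longrightarrow> L u \<le> L v"
  using L_nonneg[of "v - u"] W_diff[of v u] L_diff[of v u] by simp

lemma W_sum: "(\<And>i. i \<in> I \<Longrightarrow> f i \<in> W) \<Longrightarrow> sum f I \<in> W"
  by (rule subspace_sum[OF subspace_W])

lemma L_sum: "(\<And>i. i \<in> I \<Longrightarrow> f i \<in> W) \<Longrightarrow> L (sum f I) = (\<Sum>i\<in>I. L (f i))"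
proof (induction I rule: infinite_finite_induct)
  case (insert i I)
  have "sum f I \<in> W" "f i \<in> W" using insert.prems by (blast intro: W_sum)+
  then have "L (sum f (insert i I)) = L (f i) + L (sum f I)"
    unfolding sum.insert[OF insert.hyps] by (intro L_add)
  also have "L (sum f I) = (\<Sum>i\<in>I. L (f i))" using insert.prems by (intro insert.IH) blast
  finally show ?case unfolding sum.insert[OF insert.hyps] .
qed (simp_all add: L_zero)

lemma W_min:
  assumes "u \<in> W" "v \<in> W" shows "(\<lambda>x. min (u x) (v x)) \<in> W"
proof -
  have "u - pos_part (u - v) \<in> W" using assms by (intro W_diff W_pos_part)
  moreover have "u - pos_part (u - v) = (\<lambda>x. min (u x) (v x))" by (auto simp: fun_eq_iff)
  ultimately show ?thesis by simp
qed

lemma W_min_const: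
  assumes u: "u \<in> W" and c: "0 < c" shows "(\<lambda>x. min (u x) c) \<in> W"
proof -
  have "c *\<^sub>R (\<lambda>x. min (((1 / c) *\<^sub>R u) x) 1) \<in> W" by (intro W_scale W_min_1 u)
  moreover have "c *\<^sub>R (\<lambda>x. min (((1 / c) *\<^sub>R u) x) 1) = (\<lambda>x. min (u x) c)"
    using c by (auto simp: fun_eq_iff min_def field_simps)
  ultimately show ?thesis by simp
qed

text \<open>Increasing sequences stand for their limits: \<open>s\<close> covers \<open>A\<close> if \<open>lim s \<ge> 1\<close> on \<open>A \<inter> X\<close>.\<close>

definition covers :: "(nat \<Rightarrow> 'a \<Rightarrow> real) \<Rightarrow> 'a set \<Rightarrow> bool" where
  "covers s A \<longleftrightarrow> (\<forall>n. s n \<in> W) \<and> (\<forall>n. \<forall>x\<in>X. 0 \<le> s n x \<and> s n x \<le> s (Suc n) x) \<and>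
     (\<forall>x\<in>A \<inter> X. \<forall>c<1. \<exists>n. c < s n x)"

definition total :: "(nat \<Rightarrow> 'a \<Rightarrow> real) \<Rightarrow> ennreal" where
  "total s = (SUP n. ennreal (L (s n)))"

definition outer :: "'a set \<Rightarrow> ennreal" where
  "outer A = (INF s\<in>{s. covers s A}. total s)"

lemma coversD:
  assumes "covers s A"
  shows "s n \<in> W" "x \<in> X \<Longrightarrow> 0 \<le> s n x" "x \<in> X \<Longrightarrow> n \<le> k \<Longrightarrow> s n x \<le> s k x"
    "x \<in> A \<Longrightarrow> x \<in> X \<Longrightarrow> c < 1 \<Longrightarrow> \<exists>n. c < s n x" "0 \<le> L (s n)" "n \<le> k \<Longrightarrow> L (s n) \<le> L (s k)"
proof -
  show W: "s n \<in> W" for n using assms by (simp add: covers_def)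
  show nn: "x \<in> X \<Longrightarrow> 0 \<le> s n x" for n x using assms by (simp add: covers_def)
  show mono: "x \<in> X \<Longrightarrow> n \<le> k \<Longrightarrow> s n x \<le> s k x" for n k x
    using lift_Suc_mono_le[of "\<lambda>n. s n x" n k] assms by (simp add: covers_def)
  show "x \<in> A \<Longrightarrow> x \<in> X \<Longrightarrow> c < 1 \<Longrightarrow> \<exists>n. c < s n x" using assms by (simp add: covers_def)
  show "0 \<le> L (s n)" by (rule L_nonneg[OF W nn])
  show "n \<le> k \<Longrightarrow> L (s n) \<le> L (s k)" by (rule L_mono[OF W W mono])
qed

lemma outer_le: "covers s A \<Longrightarrow> outer A \<le> total s"
  unfolding outer_def by (rule INF_lower) simp

lemma outer_less_ex: "outer A < c \<Longrightarrow> \<exists>s. covers s A \<and> total s < c"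
  unfolding outer_def by (auto simp: INF_less_iff)

lemma outer_mono: "A \<subseteq> A' \<Longrightarrow> outer A \<le> outer A'"
  unfolding outer_def by (rule INF_superset_mono) (auto simp: covers_def)

lemma outer_le_L:
  assumes u: "u \<in> W" and nn: "\<And>x. x \<in> X \<Longrightarrow> 0 \<le> u x" and A: "\<And>x. x \<in> X \<Longrightarrow> x \<in> A \<Longrightarrow> 1 \<le> u x"
  shows "outer A \<le> ennreal (L u)"
proof -
  have "covers (\<lambda>_. u) A" using assms by (force simp: covers_def)
  from outer_le[OF this] show ?thesis by (simp add: total_def)
qed

lemma outer_disjoint: "A \<inter> X = {} \<Longrightarrow> outer A = 0"
  using outer_le_L[OF W_zero, of A] by (auto simp: L_zero)

text \<open>If \<open>s\<close> covers \<open>A\<close>, then \<open>(u - s n)\<^sup>+\<close> decreases to zero on \<open>X\<close>, and Daniell's continuity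
  condition applies to this sequence.\<close>

lemma L_le_outer:
  assumes u: "u \<in> W" and le: "\<And>x. x \<in> X \<Longrightarrow> u x \<le> indicator A x"
  shows "ennreal (L u) \<le> outer A"
  unfolding outer_def
proof (rule INF_greatest)
  fix s assume "s \<in> {s. covers s A}"
  then have s: "covers s A" by simp
  define v where "v n = pos_part (u - s n)" for n
  have v: "v n \<in> W" for n unfolding v_def by (intro W_pos_part W_diff u coversD(1)[OF s])
  have lim: "(\<lambda>n. L (v n)) \<longlonglongrightarrow> 0"
  proof (rule L_continuous[OF v])
    show "v (Suc n) x \<le> v n x" if "x \<in> X" for n x
      using coversD(3)[OF s that, of n "Suc n"] by (simp add: v_def)
    show "(\<lambda>n. v n x) \<longlonglongrightarrow> 0" if x: "x \<in> X" for x
    proof (rule LIMSEQ_I)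
      fix r :: real assume r: "r > 0"
      have "\<exists>N. u x - s N x < r"
      proof (cases "x \<in> A")
        case True
        then obtain N where "1 - r < s N x" using coversD(4)[OF s True x, of "1 - r"] r by auto
        then show ?thesis using le[OF x] True by (intro exI[of _ N]) simp
      next
        case False
        then show ?thesis using le[OF x] coversD(2)[OF s x, of 0] r by (intro exI[of _ 0]) simp
      qed
      then obtain N where N: "u x - s N x < r" ..
      have "norm (v n x - 0) < r" if "n \<ge> N" for n
        using N coversD(3)[OF s x that] r by (simp add: v_def)
      then show "\<exists>N. \<forall>n\<ge>N. norm (v n x - 0) < r" by blast
    qed
  qed
  show "ennreal (L u) \<le> total s"
  proof (cases "total s")
    case (real t)
    have "L u \<le> L (v n) + t" for n
    proof -
      have "L u \<le> L (v n + s n)"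
        by (rule L_mono[OF u W_add[OF v coversD(1)[OF s]]]) (simp add: v_def)
      also have "\<dots> = L (v n) + L (s n)" by (rule L_add[OF v coversD(1)[OF s]])
      also have "L (s n) \<le> t"
      proof -
        have "ennreal (L (s n)) \<le> total s" unfolding total_def by (rule SUP_upper) simp
        then show ?thesis using real by simp
      qed
      finally show ?thesis by simp
    qed
    moreover have "(\<lambda>n. L (v n) + t) \<longlonglongrightarrow> 0 + t" by (intro tendsto_intros lim)
    ultimately have "L u \<le> 0 + t" by (intro LIMSEQ_le_const) auto
    then show ?thesis using real by (simp add: ennreal_leI)
  qed simp
qed

lemma outer_countably_subadditive: "outer (\<Union>i. A i) \<le> (\<Sum>i. outer (A i))"
proof (cases "(\<Sum>i. outer (A i)) = top")
  case False
  show ?thesis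
  proof (rule ennreal_le_epsilon)
    fix e :: real assume e: "0 < e"
    have fin: "outer (A i) < top" for i
      using False by (metis ennreal_suminf_lessD top.not_eq_extremum)
    have "\<exists>s. covers s (A i) \<and> total s < outer (A i) + ennreal (e * (1/2)^Suc i)" for i
    proof (rule outer_less_ex)
      have "0 < ennreal (e * (1/2)^Suc i)" using e by simp
      then show "outer (A i) < outer (A i) + ennreal (e * (1/2)^Suc i)"
        using fin[of i] by (simp add: ennreal_add_left_cancel_less[of "outer (A i)" 0, simplified])
    qed
    then obtain s where s: "\<And>i. covers (s i) (A i)"
      and tot: "\<And>i. total (s i) < outer (A i) + ennreal (e * (1/2)^Suc i)" by metis
    define t where "t n = (\<Sum>i<n. s i n)" for n
    have t_apply: "t n x = (\<Sum>i<n. s i n x)" for n x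
    proof -
      have "(\<Sum>i<k. s i n) x = (\<Sum>i<k. s i n x)" for k by (induction k) auto
      then show ?thesis by (simp add: t_def)
    qed
    have tW: "t n \<in> W" for n
      unfolding t_def by (rule subspace_sum[OF subspace_W]) (rule coversD(1)[OF s])
    have Lt: "L (t n) = (\<Sum>i<n. L (s i n))" for n
      unfolding t_def by (rule L_sum) (rule coversD(1)[OF s])
    have "covers t (\<Union>i. A i)"
      unfolding covers_def
    proof (intro conjI allI ballI impI)
      fix n x assume x: "x \<in> X"
      show "0 \<le> t n x" unfolding t_apply by (intro sum_nonneg coversD(2)[OF s x])
      have "t n x \<le> (\<Sum>i<n. s i (Suc n) x)"
        unfolding t_apply by (intro sum_mono coversD(3)[OF s x]) simp
      also have "\<dots> \<le> t (Suc n) x" unfolding t_apply using coversD(2)[OF s x] by simp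
      finally show "t n x \<le> t (Suc n) x" .
    next
      fix x and c :: real assume x: "x \<in> (\<Union>i. A i) \<inter> X" and c: "c < 1"
      then obtain j where j: "x \<in> A j" and xX: "x \<in> X" by auto
      obtain n where n: "c < s j n x" using coversD(4)[OF s j xX c] by blast
      define N where "N = max n (Suc j)"
      have "s j n x \<le> s j N x" by (rule coversD(3)[OF s xX]) (simp add: N_def)
      also have "\<dots> \<le> t N x"
        unfolding t_apply by (rule member_le_sum) (auto simp: N_def coversD(2)[OF s xX])
      finally show "\<exists>n. c < t n x" using n by (intro exI[of _ N]) simp
    qed (rule tW)
    then have "outer (\<Union>i. A i) \<le> total t" by (rule outer_le)
    also have "\<dots> \<le> (\<Sum>i. total (s i))"
      unfolding total_def[of t]
    proof (rule SUP_least)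
      fix n
      have "ennreal (L (t n)) = (\<Sum>i<n. ennreal (L (s i n)))"
        unfolding Lt by (rule sum_ennreal[symmetric]) (rule coversD(5)[OF s])
      also have "\<dots> \<le> (\<Sum>i<n. total (s i))"
        unfolding total_def by (intro sum_mono SUP_upper) simp
      also have "\<dots> \<le> (\<Sum>i. total (s i))" by (rule sum_le_suminf) auto
      finally show "ennreal (L (t n)) \<le> (\<Sum>i. total (s i))" .
    qed
    also have "\<dots> \<le> (\<Sum>i. outer (A i) + ennreal (e * (1/2)^Suc i))"
      by (intro suminf_le less_imp_le[OF tot]) auto
    also have "\<dots> = (\<Sum>i. outer (A i)) + (\<Sum>i. ennreal (e * (1/2)^Suc i))"
      by (rule suminf_add[symmetric]) auto
    also have "(\<Sum>i. ennreal (e * (1/2)^Suc i)) = ennreal e"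
    proof -
      have sums: "(\<lambda>i. e * (1/2)^Suc i) sums (e * 1)" by (rule sums_mult[OF power_half_series])
      have "0 \<le> e * (1/2)^Suc i" for i using e by simp
      from suminf_ennreal2[OF this sums_summable[OF sums]] show ?thesis
        unfolding sums_unique[OF sums, symmetric] mult_1_right .
    qed
    finally show "outer (\<Union>i. A i) \<le> (\<Sum>i. outer (A i)) + ennreal e" .
  qed
qed simp

lemma outer_empty: "outer {} = 0"
  by (rule outer_disjoint) simp

lemma outer_Un: "outer (A \<union> A') \<le> outer A + outer A'"
proof -
  define T where "T i = (if i = 0 then A else if i = Suc 0 then A' else {})" for i
  have "(\<Union>i. T i) = A \<union> A'" by (auto simp: T_def split: if_splits)
  moreover have "(\<Sum>i. outer (T i)) = (\<Sum>i\<in>{0, Suc 0}. outer (T i))"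
    by (rule suminf_finite) (auto simp: T_def outer_empty)
  ultimately show ?thesis using outer_countably_subadditive[of T] by (simp add: T_def)
qed

abbreviation "\<Lambda> \<equiv> lambda_system UNIV UNIV outer"

text \<open>With \<open>p n = min (n (w - 1)\<^sup>+) 1\<close>, which increases to the indicator of \<open>{w > 1}\<close>, a cover \<open>s\<close> of \<open>T\<close>
  splits into \<open>min (s n) (p n)\<close>, covering \<open>T \<inter> {w > 1}\<close>, and for each fixed \<open>n\<close> into
  \<open>s k - min (s k) (p n)\<close>, which covers the rest of \<open>T\<close> as \<open>k\<close> grows. The values of the two parts
  add up to at most the value of \<open>s\<close>.\<close>

lemma superlevel_measurable:
  assumes w: "w \<in> W" shows "{x. 1 < w x} \<in> \<Lambda>"
proof -
  let ?A = "{x. 1 < w x}"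
  have split: "outer (?A \<inter> T) + outer ((UNIV - ?A) \<inter> T) \<le> outer T" for T
    unfolding outer_def[of T]
  proof (rule INF_greatest)
    fix s assume "s \<in> {s. covers s T}"
    then have s: "covers s T" by simp
    define q where "q = w - (\<lambda>x. min (w x) 1)"
    have q: "q \<in> W" unfolding q_def by (intro W_diff w W_min_1)
    define p where "p n = (\<lambda>x. min ((real n *\<^sub>R q) x) 1)" for n :: nat
    have p: "p n \<in> W" for n unfolding p_def by (intro W_min_1 W_scale q)
    have q0: "0 \<le> q x" for x by (simp add: q_def)
    have p0: "0 \<le> p n x" for n x using q0 by (simp add: p_def)
    have p_mono: "p n x \<le> p k x" if "n \<le> k" for n k x
      using mult_right_mono[of "real n" "real k" "q x"] that q0 by (simp add: p_def min_def)
    have p_zero: "p n x = 0" if "x \<notin> ?A" for n x using that by (simp add: p_def q_def min_def)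
    define c where "c n = (\<lambda>x. min (s n x) (p n x))" for n
    have cW: "c n \<in> W" for n unfolding c_def by (intro W_min p coversD(1)[OF s])
    have c_cov: "covers c (?A \<inter> T)"
      unfolding covers_def
    proof (intro conjI allI ballI impI cW)
      fix n x assume x: "x \<in> X"
      show "0 \<le> c n x" using coversD(2)[OF s x] p0 by (simp add: c_def)
      show "c n x \<le> c (Suc n) x"
        using coversD(3)[OF s x, of n "Suc n"] p_mono[of n "Suc n" x] by (auto simp: c_def)
    next
      fix x and r :: real assume x: "x \<in> ?A \<inter> T \<inter> X" and r: "r < 1"
      then obtain n where n: "r < s n x" using coversD(4)[OF s, of x r] by auto
      have qx: "0 < q x" using x by (simp add: q_def min_def)
      obtain k where k: "1 / q x \<le> real k" using real_arch_simple by blast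
      define N where "N = max n k"
      have "1 / q x \<le> real N" using k by (simp add: N_def)
      then have "1 \<le> real N * q x" using qx by (simp add: divide_le_eq)
      then have "p N x = 1" by (simp add: p_def)
      moreover have "s n x \<le> s N x" by (rule coversD(3)[OF s]) (use x in \<open>auto simp: N_def\<close>)
      ultimately show "\<exists>n. r < c n x" using n r by (intro exI[of _ N]) (simp add: c_def)
    qed
    define d where "d n k = s k - (\<lambda>x. min (s k x) (p n x))" for n k
    have dW: "d n k \<in> W" for n k unfolding d_def by (intro W_diff W_min p coversD(1)[OF s])
    have d_mono: "d n k x \<le> d n l x" if "k \<le> l" "x \<in> X" for n k l x
      using coversD(3)[OF s that(2,1)] by (auto simp: d_def)
    have d_cov: "covers (d n) ((UNIV - ?A) \<inter> T)" for n
      unfolding covers_def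
    proof (intro conjI allI ballI impI dW)
      fix k x assume x: "x \<in> X"
      show "0 \<le> d n k x" by (simp add: d_def)
      show "d n k x \<le> d n (Suc k) x" by (rule d_mono) (use x in auto)
    next
      fix x and r :: real assume x: "x \<in> (UNIV - ?A) \<inter> T \<inter> X" and r: "r < 1"
      then obtain k where k: "r < s k x" using coversD(4)[OF s, of x r] by auto
      have "d n k x = s k x" using p_zero[of x n] coversD(2)[OF s, of x k] x by (simp add: d_def)
      then show "\<exists>k. r < d n k x" using k by (intro exI[of _ k]) simp
    qed
    have key: "ennreal (L (c n)) + ennreal (L (d n k)) \<le> total s" for n k
    proof -
      define l where "l = max n k"
      have "L (c n) + L (d n k) \<le> L (\<lambda>x. min (s l x) (p n x)) + L (d n l)"
      proof (rule add_mono)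
        show "L (c n) \<le> L (\<lambda>x. min (s l x) (p n x))"
          by (rule L_mono[OF cW W_min[OF coversD(1)[OF s] p]])
            (use coversD(3)[OF s, of _ n l] in \<open>auto simp: c_def l_def intro: min.coboundedI1\<close>)
        show "L (d n k) \<le> L (d n l)"
          by (rule L_mono[OF dW dW d_mono]) (auto simp: l_def)
      qed
      also have "\<dots> = L (s l)"
        unfolding d_def by (simp add: L_diff coversD(1)[OF s] W_min p)
      finally have "ennreal (L (c n) + L (d n k)) \<le> ennreal (L (s l))" by (rule ennreal_leI)
      also have "\<dots> \<le> total s" unfolding total_def by (rule SUP_upper) simp
      finally show ?thesis
        using coversD(5)[OF c_cov, of n] coversD(5)[OF d_cov, of n k] by (simp add: ennreal_plus)
    qed
    have "outer (?A \<inter> T) + outer ((UNIV - ?A) \<inter> T) \<le> total c + outer ((UNIV - ?A) \<inter> T)"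
      by (intro add_right_mono outer_le c_cov)
    also have "\<dots> = (SUP n. ennreal (L (c n)) + outer ((UNIV - ?A) \<inter> T))"
      unfolding total_def by (rule ennreal_SUP_add_left[symmetric]) simp
    also have "\<dots> \<le> total s"
    proof (rule SUP_least)
      fix n
      have "ennreal (L (c n)) + outer ((UNIV - ?A) \<inter> T) \<le> ennreal (L (c n)) + total (d n)"
        by (intro add_left_mono outer_le d_cov)
      also have "\<dots> = (SUP k. ennreal (L (c n)) + ennreal (L (d n k)))"
        unfolding total_def by (rule ennreal_SUP_add_right) simp
      also have "\<dots> \<le> total s" by (rule SUP_least) (rule key)
      finally show "ennreal (L (c n)) + outer ((UNIV - ?A) \<inter> T) \<le> total s" .
    qed
    finally show "outer (?A \<inter> T) + outer ((UNIV - ?A) \<inter> T) \<le> total s" .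
  qed
  have "outer (?A \<inter> T) + outer ((UNIV - ?A) \<inter> T) = outer T" for T
  proof (rule antisym[OF split])
    have "T = (?A \<inter> T) \<union> ((UNIV - ?A) \<inter> T)" by auto
    then show "outer T \<le> outer (?A \<inter> T) + outer ((UNIV - ?A) \<inter> T)" using outer_Un by metis
  qed
  then show ?thesis by (simp add: lambda_system_def)
qed

lemma null_measurable: "outer A = 0 \<Longrightarrow> A \<in> \<Lambda>"
proof -
  assume A: "outer A = 0"
  have "outer (A \<inter> T) + outer ((UNIV - A) \<inter> T) = outer T" for T
  proof (rule antisym)
    have "outer (A \<inter> T) \<le> outer A" "outer ((UNIV - A) \<inter> T) \<le> outer T" by (auto intro!: outer_mono)
    then show "outer (A \<inter> T) + outer ((UNIV - A) \<inter> T) \<le> outer T" using A by simp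
    have "T = (A \<inter> T) \<union> ((UNIV - A) \<inter> T)" by auto
    then show "outer T \<le> outer (A \<inter> T) + outer ((UNIV - A) \<inter> T)" using outer_Un by metis
  qed
  then show "A \<in> \<Lambda>" by (simp add: lambda_system_def)
qed

definition M :: "'a measure" where "M = measure_of UNIV \<Lambda> outer"

lemma M_space: "measure_space UNIV \<Lambda> outer"
proof -
  interpret sigma_algebra UNIV "UNIV :: 'a set set"
    using sigma_algebra_Pow[of "UNIV :: 'a set"] by simp
  show ?thesis
  proof (rule caratheodory_lemma)
    show "outer_measure_space UNIV outer"
      unfolding outer_measure_space_def positive_def increasing_def countably_subadditive_def
      using outer_empty outer_mono outer_countably_subadditive by auto
  qed
qed

lemma sets_M: "sets M = \<Lambda>" and space_M: "space M = UNIV"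
  and emeasure_M: "A \<in> \<Lambda> \<Longrightarrow> emeasure M A = outer A"
proof -
  have sa: "sigma_algebra UNIV \<Lambda>" and pos: "positive \<Lambda> outer" "countably_additive \<Lambda> outer"
    using M_space by (auto simp: measure_space_def)
  show "sets M = \<Lambda>" unfolding M_def by (rule sigma_algebra.sets_measure_of_eq[OF sa])
  show "space M = UNIV" unfolding M_def by (rule space_measure_of_conv)
  show "A \<in> \<Lambda> \<Longrightarrow> emeasure M A = outer A"
    unfolding M_def by (rule emeasure_measure_of_sigma[OF sa pos])
qed

lemma W_measurable:
  assumes w: "w \<in> W" shows "w \<in> borel_measurable M"
proof -
  have nonneg: "v \<in> borel_measurable M" if v: "v \<in> W" and nn: "\<And>x. 0 \<le> v x" for v
  proof (rule borel_measurableI_greater)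
    have pos: "{x \<in> space M. a < v x} \<in> sets M" if a: "a > 0" for a
    proof -
      have "{x. 1 < ((1 / a) *\<^sub>R v) x} \<in> \<Lambda>" by (intro superlevel_measurable W_scale v)
      moreover have "{x. 1 < ((1 / a) *\<^sub>R v) x} = {x. a < v x}" using a by (auto simp: field_simps)
      ultimately show ?thesis by (simp add: sets_M space_M)
    qed
    fix a :: real
    consider "a < 0" | "a = 0" | "a > 0" by linarith
    then show "{x \<in> space M. a < v x} \<in> sets M"
    proof cases
      case 1
      then have "{x \<in> space M. a < v x} = space M" using nn by (auto intro: less_le_trans)
      then show ?thesis by simp
    next
      case 2
      have "{x \<in> space M. a < v x} = (\<Union>n. {x \<in> space M. 1 / real (Suc n) < v x})"
      proof (intro set_eqI iffI)
        fix x assume "x \<in> {x \<in> space M. a < v x}"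
        then show "x \<in> (\<Union>n. {x \<in> space M. 1 / real (Suc n) < v x})"
          using reals_Archimedean[of "v x"] 2 by (simp add: inverse_eq_divide)
      next
        fix x assume "x \<in> (\<Union>n. {x \<in> space M. 1 / real (Suc n) < v x})"
        then obtain n where "x \<in> space M" "1 / real (Suc n) < v x" by auto
        moreover have "0 < 1 / real (Suc n)" by simp
        ultimately have "x \<in> space M" "0 < v x" by (blast, linarith)
        then show "x \<in> {x \<in> space M. a < v x}" using 2 by simp
      qed
      also have "\<dots> \<in> sets M" by (intro sets.countable_UN image_subsetI pos) auto
      finally show ?thesis .
    qed (rule pos)
  qed
  have "pos_part w \<in> borel_measurable M" "pos_part (- w) \<in> borel_measurable M"
    by (rule nonneg[OF W_pos_part[OF w]], simp) (rule nonneg[OF W_pos_part[OF W_minus[OF w]]], simp)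
  then have "(\<lambda>x. pos_part w x - pos_part (- w) x) \<in> borel_measurable M"
    by (rule borel_measurable_diff)
  moreover have "(\<lambda>x. pos_part w x - pos_part (- w) x) = w" by (auto simp: fun_eq_iff)
  ultimately show ?thesis by simp
qed

text \<open>\<open>w\<close> is cut into slices \<open>\<delta> q k\<close> between the levels \<open>k \<delta>\<close> and \<open>(k + 1) \<delta>\<close>. The set \<open>{w > (k + 1) \<delta>}\<close>
  lies between the slices \<open>q (k + 1)\<close> and \<open>q k\<close>, so the integral of \<open>q (k + 1)\<close> is at most
  \<open>L (q k)\<close>, and \<open>L (q (k + 1))\<close> is at most the integral of \<open>q k\<close>. Summation over \<open>1 \<le> k\<close> leaves out the lowest slice, below which
  \<open>w\<close> may be positive on a set of infinite measure, and shifts the index; the error disappears as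
  \<open>\<delta>\<close> tends to zero.\<close>

theorem nn_integral_M:
  assumes w: "w \<in> W" and nn: "\<And>x. 0 \<le> w x"
  shows "(\<integral>\<^sup>+x. ennreal (w x) \<partial>M) = ennreal (L w)"
proof -
  note [measurable] = W_measurable[OF w]
  define g where "g j = (\<lambda>x. min (w x) (real (Suc j))) - (\<lambda>x. min (w x) (1 / real (Suc j)))" for j
  have gW: "g j \<in> W" for j unfolding g_def by (intro W_diff W_min_const w) auto
  have g_le: "g j x \<le> w x" and g0: "0 \<le> g j x" for j x
  proof -
    have "1 / real (Suc j) \<le> 1" by simp
    also have "1 \<le> real (Suc j)" by simp
    finally have "1 / real (Suc j) \<le> real (Suc j)" .
    moreover have "0 \<le> min (w x) (1 / real (Suc j))" using nn[of x] by simp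
    moreover have "min (w x) (real (Suc j)) \<le> w x" by simp
    ultimately have "min (w x) (real (Suc j)) - min (w x) (1 / real (Suc j)) \<le> w x"
      "min (w x) (1 / real (Suc j)) \<le> min (w x) (real (Suc j))"
      by (linarith, intro min.mono order_refl)
    then show "g j x \<le> w x" "0 \<le> g j x" by (simp_all add: g_def)
  qed
  have g_mono: "g j x \<le> g (Suc j) x" for j x
  proof -
    have "1 / real (Suc (Suc j)) \<le> 1 / real (Suc j)" by (intro frac_le) auto
    then have "min (w x) (1 / real (Suc (Suc j))) \<le> min (w x) (1 / real (Suc j))" by auto
    moreover have "min (w x) (real (Suc j)) \<le> min (w x) (real (Suc (Suc j)))" by auto
    ultimately show ?thesis by (simp add: g_def)
  qed
  have g_lim: "(\<lambda>j. g j x) \<longlonglongrightarrow> w x" for x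
  proof -
    obtain N where N: "w x \<le> real N" using real_arch_simple by blast
    have "(\<lambda>j. w x - min (w x) (1 / real (Suc j))) \<longlonglongrightarrow> w x - min (w x) 0"
      by (intro tendsto_intros LIMSEQ_inverse_real_of_nat[unfolded inverse_eq_divide])
    then have "(\<lambda>j. w x - min (w x) (1 / real (Suc j))) \<longlonglongrightarrow> w x" using nn[of x] by simp
    then show ?thesis
      by (rule Lim_transform_eventually)
        (use N in \<open>auto simp: g_def eventually_sequentially intro!: exI[of _ N]\<close>)
  qed
  have slices: "(\<integral>\<^sup>+x. ennreal (g j x) \<partial>M) \<le> ennreal (L w) \<and> ennreal (L (g j)) \<le> (\<integral>\<^sup>+x. ennreal (w x) \<partial>M)" for j
  proof -
    define \<delta> where "\<delta> = 1 / real (Suc j)"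
    have \<delta>: "0 < \<delta>" by (simp add: \<delta>_def)
    \<comment> \<open>the top level \<open>(n + 1) \<delta>\<close> is \<open>j + 1\<close>\<close>
    define n where "n = Suc j * Suc j - 1"
    have "Suc n = Suc j * Suc j" by (simp add: n_def)
    then have "real (Suc n) = real (Suc j) * real (Suc j)" by (metis of_nat_mult)
    moreover have "a * a * (1 / a) = a" if "a \<noteq> 0" for a :: real using that by simp
    ultimately have n: "real (Suc n) * \<delta> = real (Suc j)"
      unfolding \<delta>_def by (metis of_nat_eq_0_iff nat.simps(3))
    define q where "q k = (1 / \<delta>) *\<^sub>R ((\<lambda>x. min (w x) (real (Suc k) * \<delta>)) - (\<lambda>x. min (w x) (real k * \<delta>)))" for k
    have min0: "(\<lambda>x. min (w x) (real k * \<delta>)) \<in> W" for k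
    proof (cases k)
      case 0
      then have "(\<lambda>x. min (w x) (real k * \<delta>)) = 0" using nn by (simp add: fun_eq_iff)
      then show ?thesis by (simp add: W_zero)
    qed (use \<delta> in \<open>auto intro!: W_min_const w\<close>)
    have qW: "q k \<in> W" for k unfolding q_def by (intro W_scale W_diff min0)
    have step: "real k * \<delta> < real (Suc k) * \<delta>" for k using \<delta> by simp
    have q_eq: "q k x = (min (w x) (real (Suc k) * \<delta>) - min (w x) (real k * \<delta>)) / \<delta>" for k x
      by (simp add: q_def)
    have q01: "0 \<le> q k x \<and> q k x \<le> 1" for k x
      using step[of k] \<delta> unfolding q_eq by (auto simp: min_def field_simps)
    have q1: "q k x = 1" if "real (Suc k) * \<delta> \<le> w x" for k x
      using that step[of k] \<delta> unfolding q_eq by (auto simp: min_def field_simps)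
    have q0: "q k x = 0" if "w x \<le> real k * \<delta>" for k x
      using that step[of k] \<delta> unfolding q_eq by (auto simp: min_def field_simps)
    define A where "A k = {x. real (Suc k) * \<delta> < w x}" for k
    have A_sets: "A k \<in> sets M" for k
    proof -
      have "A k = {x \<in> space M. real (Suc k) * \<delta> < w x}" by (simp add: A_def space_M)
      then show ?thesis by simp
    qed
    have A_meas: "emeasure M (A k) = outer (A k)" for k
      using A_sets emeasure_M by (simp add: sets_M)
    have [measurable]: "q k \<in> borel_measurable M" for k by (rule W_measurable[OF qW])
    have sum_apply: "(\<Sum>k<i. f k) x = (\<Sum>k<i. f k x)" for f :: "nat \<Rightarrow> 'a \<Rightarrow> real" and i x
      by (induction i) auto
    have \<delta>q: "\<delta> * q k x = min (w x) (real (Suc k) * \<delta>) - min (w x) (real k * \<delta>)" for k x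
      unfolding q_eq using \<delta> by simp
    have sum_q: "\<delta> *\<^sub>R (\<Sum>k<i. q (Suc k)) = (\<lambda>x. min (w x) (real (Suc i) * \<delta>)) - (\<lambda>x. min (w x) (1 * \<delta>))" for i
    proof
      fix x
      have "\<delta> * (\<Sum>k<i. q (Suc k) x) = min (w x) (real (Suc i) * \<delta>) - min (w x) (1 * \<delta>)"
        by (induction i) (simp_all only: sum.lessThan_Suc distrib_left \<delta>q, simp_all)
      then show "(\<delta> *\<^sub>R (\<Sum>k<i. q (Suc k))) x = ((\<lambda>x. min (w x) (real (Suc i) * \<delta>)) - (\<lambda>x. min (w x) (1 * \<delta>))) x"
        by (simp add: sum_apply)
    qed
    have sum_q': "\<delta> *\<^sub>R (\<Sum>k<i. q k) = (\<lambda>x. min (w x) (real i * \<delta>))" for i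
    proof
      fix x
      have "\<delta> * (\<Sum>k<i. q k x) = min (w x) (real i * \<delta>)"
        using nn[of x] by (induction i) (simp_all only: sum.lessThan_Suc distrib_left \<delta>q, simp_all)
      then show "(\<delta> *\<^sub>R (\<Sum>k<i. q k)) x = min (w x) (real i * \<delta>)"
        by (simp add: sum_apply)
    qed
    have Lq: "0 \<le> L (q k)" for k by (rule L_nonneg[OF qW]) (simp add: q01)
    have int_sum: "(\<integral>\<^sup>+x. ennreal ((\<delta> *\<^sub>R (\<Sum>k<i. q (f k))) x) \<partial>M) = ennreal \<delta> * (\<Sum>k<i. \<integral>\<^sup>+x. ennreal (q (f k) x) \<partial>M)"
      for f :: "nat \<Rightarrow> nat" and i
    proof -
      have "ennreal ((\<delta> *\<^sub>R (\<Sum>k<i. q (f k))) x) = ennreal \<delta> * (\<Sum>k<i. ennreal (q (f k) x))" for x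
        using \<delta> q01 by (simp add: sum_apply ennreal_mult sum_nonneg)
      then show ?thesis by (simp add: nn_integral_cmult nn_integral_sum)
    qed
    have gj: "g j = \<delta> *\<^sub>R (\<Sum>k<n. q (Suc k))"
      unfolding sum_q n g_def by (simp add: \<delta>_def)
    have upper: "(\<integral>\<^sup>+x. ennreal (q (Suc k) x) \<partial>M) \<le> ennreal (L (q k))" for k
    proof -
      have "(\<integral>\<^sup>+x. ennreal (q (Suc k) x) \<partial>M) \<le> (\<integral>\<^sup>+x. indicator (A k) x \<partial>M)"
        by (rule nn_integral_mono) (use q01 q0 in \<open>auto simp: A_def indicator_def not_less\<close>)
      also have "\<dots> = outer (A k)" using A_sets A_meas by simp
      also have "\<dots> \<le> ennreal (L (q k))"
        by (rule outer_le_L[OF qW]) (use q01 q1 in \<open>auto simp: A_def\<close>)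
      finally show ?thesis .
    qed
    have lower: "ennreal (L (q (Suc k))) \<le> (\<integral>\<^sup>+x. ennreal (q k x) \<partial>M)" for k
    proof -
      have "ennreal (L (q (Suc k))) \<le> outer (A k)"
        by (rule L_le_outer[OF qW]) (use q01 q0 in \<open>auto simp: A_def indicator_def not_less\<close>)
      also have "\<dots> = (\<integral>\<^sup>+x. indicator (A k) x \<partial>M)" using A_sets A_meas by simp
      also have "\<dots> \<le> (\<integral>\<^sup>+x. ennreal (q k x) \<partial>M)"
        by (rule nn_integral_mono) (use q1 in \<open>auto simp: A_def indicator_def\<close>)
      finally show ?thesis .
    qed
    have "(\<integral>\<^sup>+x. ennreal (g j x) \<partial>M) = ennreal \<delta> * (\<Sum>k<n. \<integral>\<^sup>+x. ennreal (q (Suc k) x) \<partial>M)"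
      unfolding gj by (rule int_sum)
    also have "\<dots> \<le> ennreal \<delta> * (\<Sum>k<n. ennreal (L (q k)))"
      by (intro mult_left_mono sum_mono upper) simp
    also have "\<dots> = ennreal (L (\<delta> *\<^sub>R (\<Sum>k<n. q k)))"
      using \<delta> Lq W_sum[of "{..<n}" q] by (simp add: L_scale L_sum qW ennreal_mult sum_nonneg)
    also have "\<dots> \<le> ennreal (L w)"
      unfolding sum_q' by (intro ennreal_leI L_mono min0 w) simp
    finally have 1: "(\<integral>\<^sup>+x. ennreal (g j x) \<partial>M) \<le> ennreal (L w)" .
    have "ennreal (L (g j)) = ennreal \<delta> * (\<Sum>k<n. ennreal (L (q (Suc k))))"
      unfolding gj using \<delta> Lq W_sum[of "{..<n}" "\<lambda>k. q (Suc k)"] by (simp add: L_scale L_sum qW ennreal_mult sum_nonneg)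
    also have "\<dots> \<le> ennreal \<delta> * (\<Sum>k<n. \<integral>\<^sup>+x. ennreal (q k x) \<partial>M)"
      by (intro mult_left_mono sum_mono lower) simp
    also have "\<dots> = (\<integral>\<^sup>+x. ennreal ((\<delta> *\<^sub>R (\<Sum>k<n. q k)) x) \<partial>M)"
      by (rule int_sum[symmetric])
    also have "\<dots> \<le> (\<integral>\<^sup>+x. ennreal (w x) \<partial>M)"
      unfolding sum_q' by (intro nn_integral_mono ennreal_leI) simp
    finally show ?thesis using 1 by simp
  qed
  show ?thesis
  proof (rule antisym)
    have "(\<lambda>j. \<integral>\<^sup>+x. ennreal (g j x) \<partial>M) \<longlonglongrightarrow> (\<integral>\<^sup>+x. ennreal (w x) \<partial>M)"
    proof (rule nn_integral_LIMSEQ)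
      show "incseq (\<lambda>j x. ennreal (g j x))"
        by (intro incseq_SucI le_funI ennreal_leI g_mono)
      show "(\<lambda>j. ennreal (g j x)) \<longlonglongrightarrow> ennreal (w x)" for x
        by (intro tendsto_ennrealI g_lim)
      show "(\<lambda>x. ennreal (g j x)) \<in> borel_measurable M" for j using W_measurable[OF gW] by measurable
    qed
    then show "(\<integral>\<^sup>+x. ennreal (w x) \<partial>M) \<le> ennreal (L w)"
      by (rule LIMSEQ_le_const2) (use slices in auto)
    have "(\<lambda>j. L (w - g j)) \<longlonglongrightarrow> 0"
    proof (rule L_continuous)
      show "w - g j \<in> W" for j by (intro W_diff w gW)
      show "(w - g (Suc j)) x \<le> (w - g j) x" for j x using g_mono by simp
      show "(\<lambda>j. (w - g j) x) \<longlonglongrightarrow> 0" for x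
        using tendsto_diff[OF tendsto_const g_lim[of x], of "w x"] by simp
    qed
    then have "(\<lambda>j. L w - L (w - g j)) \<longlonglongrightarrow> L w - 0" by (intro tendsto_intros)
    then have "(\<lambda>j. L (g j)) \<longlonglongrightarrow> L w" using L_diff[OF w gW] by simp
    then have "(\<lambda>j. ennreal (L (g j))) \<longlonglongrightarrow> ennreal (L w)" by (rule tendsto_ennrealI)
    then show "ennreal (L w) \<le> (\<integral>\<^sup>+x. ennreal (w x) \<partial>M)"
      by (rule LIMSEQ_le_const2) (use slices in auto)
  qed
qed

lemma emeasure_outside: "A \<inter> X = {} \<Longrightarrow> A \<in> sets M \<and> emeasure M A = 0"
  using null_measurable[OF outer_disjoint] outer_disjoint emeasure_M by (auto simp: sets_M)

end

section \<open>The co-equilibrium functional of a set\<close>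

context reference_form
begin

text \<open>\<open>g\<close> is the limit of the co-balayaged functions on open sets \<open>U n\<close> whose capacities tend to that of
  \<open>X\<close>. Replacing \<open>U n\<close> by \<open>U n \<inter> S\<close> for a neighbourhood \<open>S\<close> of \<open>X\<close> gives a smaller limit with the same
  pairing with \<open>\<phi> > 0\<close>, hence the same limit; so \<open>g\<close> inherits the positivity on functions that are
  nonnegative on \<open>S\<close>.\<close>

lemma co_equilibrium:
  obtains g where "g \<in> D" "AE x in m. g x \<le> h' x" "inner_L2 m \<phi> g = ucap X"
    "\<forall>U v. open U \<longrightarrow> X \<subseteq> U \<longrightarrow> v \<in> D \<longrightarrow> (AE x in m. x \<in> U \<longrightarrow> 0 \<le> v x) \<longrightarrow> 0 \<le> B v g"
proof -
  have "\<exists>V. open V \<and> X \<subseteq> V \<and> ocap V < ucap X + 1 / real (Suc n)" for n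
    by (rule ucap_less_ex) simp
  then obtain V where V: "\<And>n. open (V n)" "\<And>n. X \<subseteq> V n" "\<And>n. ocap (V n) < ucap X + 1 / real (Suc n)"
    by metis
  define U where "U n = (\<Inter>i\<le>n. V i)" for n
  have U: "open (U n)" "X \<subseteq> U n" for n using V(1,2) by (auto simp: U_def)
  have dec: "decseq (\<lambda>n. U n \<inter> S)" for S
    by (rule antimonoI) (auto simp: U_def)
  have limit: "\<exists>w. w \<in> D \<and> (AE x in m. (\<lambda>n. cored (U n \<inter> S) x) \<longlonglongrightarrow> w x) \<and>
      (AE x in m. 0 \<le> w x \<and> w x \<le> h' x) \<and>
      (\<forall>l. bdd_linear l \<longrightarrow> (\<lambda>n. l (cored (U n \<inter> S))) \<longlonglongrightarrow> l w) \<and> inner_L2 m \<phi> w = ucap X"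
    if S: "open S" "X \<subseteq> S" for S
  proof -
    obtain w where w: "w \<in> D" "AE x in m. (\<lambda>n. cored (U n \<inter> S) x) \<longlonglongrightarrow> w x"
      "AE x in m. 0 \<le> w x \<and> w x \<le> h' x"
      "\<forall>l. bdd_linear l \<longrightarrow> (\<lambda>n. l (cored (U n \<inter> S))) \<longlonglongrightarrow> l w"
      by (rule co.balayage_monotone_limit[OF coexcessive_h' balayage_cored disjI2[OF dec]])
    have "(\<lambda>n. ocap (U n \<inter> S)) \<longlonglongrightarrow> inner_L2 m \<phi> w"
      unfolding ocap_cored using w(4) bdd_linear_\<phi> by blast
    moreover have "(\<lambda>n. ocap (U n \<inter> S)) \<longlonglongrightarrow> ucap X"
    proof (rule tendsto_sandwich)
      show "\<forall>\<^sub>F n in sequentially. ucap X \<le> ocap (U n \<inter> S)"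
        using U S by (intro always_eventually allI ucap_le_ocap) auto
      have "ocap (U n \<inter> S) \<le> ucap X + 1 / real (Suc n)" for n
      proof -
        have "ocap (U n \<inter> S) \<le> ocap (V n)" by (rule ocap_mono) (auto simp: U_def)
        then show ?thesis using V(3)[of n] by linarith
      qed
      then show "\<forall>\<^sub>F n in sequentially. ocap (U n \<inter> S) \<le> ucap X + 1 / real (Suc n)" by simp
      have "(\<lambda>n. ucap X + 1 / real (Suc n)) \<longlonglongrightarrow> ucap X + 0"
        by (intro tendsto_intros LIMSEQ_inverse_real_of_nat[unfolded inverse_eq_divide])
      then show "(\<lambda>n. ucap X + 1 / real (Suc n)) \<longlonglongrightarrow> ucap X" by simp
    qed simp
    ultimately have "inner_L2 m \<phi> w = ucap X" using LIMSEQ_unique by blast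
    with w show ?thesis by blast
  qed
  obtain g where g: "g \<in> D" "AE x in m. (\<lambda>n. cored (U n \<inter> UNIV) x) \<longlonglongrightarrow> g x"
    "AE x in m. 0 \<le> g x \<and> g x \<le> h' x" "inner_L2 m \<phi> g = ucap X"
    using limit[OF open_UNIV subset_UNIV] by blast
  have pos: "0 \<le> B v g"
    if S: "open S" "X \<subseteq> S" and v: "v \<in> D" "AE x in m. x \<in> S \<longrightarrow> 0 \<le> v x" for S v
  proof -
    obtain w where w: "w \<in> D" "AE x in m. (\<lambda>n. cored (U n \<inter> S) x) \<longlonglongrightarrow> w x"
      and weak: "\<forall>l. bdd_linear l \<longrightarrow> (\<lambda>n. l (cored (U n \<inter> S))) \<longlonglongrightarrow> l w"
      and \<phi>w: "inner_L2 m \<phi> w = ucap X"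
      using limit[OF S] by blast
    have "AE x in m. cored (U n \<inter> S) x \<le> cored (U n \<inter> UNIV) x" for n
      by (rule co.balayage_mono[OF coexcessive_h' balayage_cored balayage_cored]) auto
    then have "AE x in m. \<forall>n. cored (U n \<inter> S) x \<le> cored (U n \<inter> UNIV) x" by (simp add: AE_all_countable)
    with w(2) g(2) have wg: "AE x in m. w x \<le> g x" by eventually_elim (auto intro: LIMSEQ_le)
    have "AE x in m. (g - w) x = 0"
    proof (rule AE_zero_of_inner_\<phi>)
      show "g - w \<in> D" using g w by auto
      show "AE x in m. 0 \<le> (g - w) x" using wg by eventually_elim simp
      show "inner_L2 m \<phi> (g - w) \<le> 0"
        using bdd_linear_diff[OF bdd_linear_\<phi> g(1) w(1)] g(4) \<phi>w by simp
    qed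
    then have "AE x in m. w x = g x" by eventually_elim simp
    then have eq: "B v w = B v g" by (intro bdd_linear_cong_AE[OF bdd_linear_right[OF v(1)] w(1) g(1)])
    have lim: "(\<lambda>n. B v (cored (U n \<inter> S))) \<longlonglongrightarrow> B v w" using weak bdd_linear_right[OF v(1)] by blast
    have "0 \<le> B v (cored (U n \<inter> S))" for n
      by (rule cored_test_nonneg[OF v(1)]) (use v(2) in eventually_elim, simp)
    then have "0 \<le> B v w" by (intro LIMSEQ_le_const[OF lim]) auto
    then show ?thesis unfolding eq .
  qed
  have "AE x in m. g x \<le> h' x" using g(3) by eventually_elim simp
  moreover have "\<forall>U v. open U \<longrightarrow> X \<subseteq> U \<longrightarrow> v \<in> D \<longrightarrow> (AE x in m. x \<in> U \<longrightarrow> 0 \<le> v x) \<longrightarrow> 0 \<le> B v g"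
    by (intro allI impI pos)
  ultimately show ?thesis by (rule that[OF g(1) _ g(4)])
qed

end

section \<open>The measure representing a carried functional\<close>

lemma Dini_null:
  fixes S :: "'a::metric_space set"
  assumes S: "compact S" and cont: "\<And>n::nat. continuous_on S (u n)"
    and dec: "\<And>n x. x \<in> S \<Longrightarrow> u (Suc n) x \<le> u n x"
    and lim: "\<And>x. x \<in> S \<Longrightarrow> (\<lambda>n. u n x) \<longlonglongrightarrow> (0::real)" and e: "0 < e"
  shows "\<exists>N. \<forall>n\<ge>N. \<forall>x\<in>S. u n x < e"
proof (rule ccontr)
  assume no: "\<not> ?thesis"
  have mono: "u k x \<le> u n x" if "n \<le> k" "x \<in> S" for n k x
    using lift_Suc_antimono_le[of "\<lambda>n. u n x" n k] dec that by auto
  have "\<exists>x\<in>S. e \<le> u n x" for n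
  proof -
    have "\<forall>N. \<exists>n\<ge>N. \<exists>x\<in>S. e \<le> u n x" using no by (simp add: not_less)
    then obtain k x where "n \<le> k" "x \<in> S" "e \<le> u k x" by blast
    then show ?thesis using mono order_trans by blast
  qed
  then obtain x where x: "\<And>n. x n \<in> S" "\<And>n. e \<le> u n (x n)" by metis
  obtain y r where y: "y \<in> S" and r: "strict_mono (r :: nat \<Rightarrow> nat)" and xy: "(x \<circ> r) \<longlonglongrightarrow> y"
    using seq_compactE[OF compact_imp_seq_compact[OF S], of x] x(1) by blast
  have "e \<le> u n y" for n
  proof (rule LIMSEQ_le_const)
    show "(\<lambda>j. u n ((x \<circ> r) j)) \<longlonglongrightarrow> u n y"
      by (rule continuous_on_tendsto_compose[OF cont xy y]) (simp add: x)
    have "e \<le> u n ((x \<circ> r) j)" if "j \<ge> n" for j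
    proof -
      have "n \<le> r j" using seq_suble[OF r, of j] that by simp
      from mono[OF this x(1)] x(2) show ?thesis by (auto intro: order_trans)
    qed
    then show "\<exists>N. \<forall>j\<ge>N. e \<le> u n ((x \<circ> r) j)" by blast
  qed
  then have "e \<le> 0" by (intro LIMSEQ_le_const[OF lim[OF y]]) auto
  with e show False by simp
qed

text \<open>\<open>hq\<close> is a quasi-continuous version of \<open>h\<close>. Its lower bound \<open>c\<close> on \<open>X\<close> allows small constants to be
  dominated on \<open>X\<close> by small multiples of \<open>hq\<close>, whose value under \<open>l\<close> is small.\<close>

locale carried_functional = quasi_regular_form m D \<E> \<phi>
  for m :: "'a::metric_space measure" and D :: "('a \<Rightarrow> real) set"
    and \<E> :: "('a \<Rightarrow> real) \<Rightarrow> ('a \<Rightarrow> real) \<Rightarrow> real" and \<phi> :: "'a \<Rightarrow> real" +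
  fixes X :: "'a set" and c :: real and g :: "'a \<Rightarrow> real"
  assumes closed_X: "closed X" and c_pos: "0 < c" and hq_X: "\<And>x. x \<in> X \<Longrightarrow> c \<le> hq x"
    and g_D: "g \<in> D"
    and carried: "\<And>U v. open U \<Longrightarrow> X \<subseteq> U \<Longrightarrow> v \<in> D \<Longrightarrow> AE x in m. x \<in> U \<longrightarrow> 0 \<le> v x \<Longrightarrow> 0 \<le> B v g"
begin

abbreviation l where "l v \<equiv> B v g"

lemma l_linear: "bdd_linear l"
  by (rule bdd_linear_left[OF g_D])

lemma l_nonneg: "v \<in> D \<Longrightarrow> AE x in m. 0 \<le> v x \<Longrightarrow> 0 \<le> l v"
  by (rule carried[of UNIV]) auto

text \<open>The points of \<open>F\<close> where \<open>w\<close> is negative, together with the complement of \<open>F\<close>, are an open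
  neighbourhood of \<open>X\<close>, on which \<open>C red (- F) - v\<close> is nonnegative a.e.\<close>

lemma l_le_red:
  assumes v: "v \<in> D" and w: "AE x in m. w x = v x" and F: "closed F" "continuous_on F w"
    and neg: "\<And>x. x \<in> X \<Longrightarrow> x \<in> F \<Longrightarrow> w x < 0" and C: "0 \<le> C" and le: "AE x in m. v x \<le> C * h x"
  shows "l v \<le> C * l (red (- F))"
proof -
  define U where "U = - {x \<in> F. 0 \<le> w x}"
  have "open U"
    unfolding U_def using continuous_on_closed_Collect_le[OF continuous_on_const F(2,1)] by (simp add: closed_def)
  moreover have "X \<subseteq> U" using neg by (force simp: U_def)
  moreover have "C *\<^sub>R red (- F) - v \<in> D" using v red_D by auto
  moreover have "AE x in m. x \<in> U \<longrightarrow> 0 \<le> (C *\<^sub>R red (- F) - v) x"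
    using w le red_eq[of "- F"] red_nonneg[of "- F"]
  proof eventually_elim
    case (elim x)
    have "0 \<le> C * red (- F) x" using C elim by simp
    then show ?case using elim by (cases "x \<in> F") (auto simp: U_def)
  qed
  ultimately have "0 \<le> l (C *\<^sub>R red (- F) - v)" by (rule carried)
  then show ?thesis using v red_D g_D by (simp add: diff_left scale_left)
qed

lemma l_h_nonneg: "0 \<le> l h"
  by (rule l_nonneg[OF h_D excessive_nonneg[OF excessive_h]])

text \<open>\<open>l_le_red\<close> applied to \<open>min v (n h) - \<delta> h\<close>: subtracting \<open>\<delta> h\<close> makes the version strictly negative on
  \<open>X \<inter> F\<close>, since \<open>hq \<ge> c\<close> on \<open>X\<close>.\<close>

lemma l_truncation_le:
  assumes v: "v \<in> D" and w: "qcv v w" and F: "closed F" "continuous_on F w" "continuous_on F hq"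
    and \<delta>: "0 < \<delta>" and small: "\<And>x. x \<in> X \<Longrightarrow> x \<in> F \<Longrightarrow> w x < \<delta> * c"
  shows "l v - l (pos_part (v - real n *\<^sub>R h)) \<le> real n * l (red (- F)) + \<delta> * l h"
proof -
  define p where "p = pos_part (v - real n *\<^sub>R h)"
  define t where "t = (v - p) - \<delta> *\<^sub>R h"
  define tq where "tq = (w - pos_part (w - real n *\<^sub>R hq)) - \<delta> *\<^sub>R hq"
  have pD: "p \<in> D" using v h_D by (auto simp: p_def intro: V_pos_part)
  have tD: "t \<in> D" using v pD h_D by (auto simp: t_def)
  have t: "qcv t tq" unfolding t_def tq_def p_def by (intro qcv_diff qcv_pos_part qcv_scale w qcv_hq)
  have "l t \<le> real n * l (red (- F))"
  proof (rule l_le_red[OF tD _ F(1)])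
    show "AE x in m. tq x = t x" using t by (simp add: qc_version_def)
    have "continuous_on F (\<lambda>x. (w x - max (w x - real n * hq x) 0) - \<delta> * hq x)"
      using F(2,3) by (intro continuous_intros)
    moreover have "tq = (\<lambda>x. (w x - max (w x - real n * hq x) 0) - \<delta> * hq x)"
      by (simp add: tq_def fun_eq_iff)
    ultimately show "continuous_on F tq" by simp
    show "tq x < 0" if "x \<in> X" "x \<in> F" for x
    proof -
      have "\<delta> * c \<le> \<delta> * hq x" using \<delta> hq_X[OF that(1)] by simp
      then show ?thesis using small[OF that] by (simp add: tq_def)
    qed
    show "AE x in m. t x \<le> real n * h x"
      using h_pos
    proof eventually_elim
      case (elim x)
      then have "0 \<le> \<delta> * h x" using \<delta> by simp
      then show ?case by (simp add: t_def p_def)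
    qed
  qed simp
  moreover have "l t = l v - l p - \<delta> * l h"
    unfolding t_def using v pD h_D g_D by (simp only: diff_left scale_left V_diff V_scale)
  ultimately show ?thesis by (simp add: p_def)
qed

lemma l_le_zero:
  assumes v: "v \<in> D" and w: "qcv v w" and le: "\<And>x. x \<in> X \<Longrightarrow> w x \<le> 0"
  shows "l v \<le> 0"
proof -
  obtain F1 where F1: "enest F1" using compact_nest by blast
  have "qcont w" using w by (simp add: qc_version_def)
  then obtain F where F: "enest F" "\<forall>k. continuous_on (F k) w" "\<forall>k. continuous_on (F k) hq"
    by (rule good_nest[of "\<lambda>_. w", OF _ F1]) blast
  have trunc: "l v - l (pos_part (v - real n *\<^sub>R h)) \<le> \<delta> * l h" if \<delta>: "0 < \<delta>" for n \<delta>
  proof -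
    have "(\<lambda>k. real n * l (red (- F k)) + \<delta> * l h) \<longlonglongrightarrow> real n * 0 + \<delta> * l h"
      by (intro tendsto_intros red_weakly_null F l_linear)
    moreover have "l v - l (pos_part (v - real n *\<^sub>R h)) \<le> real n * l (red (- F k)) + \<delta> * l h" for k
    proof (rule l_truncation_le[OF v w nestD(2)[OF F(1)] _ _ \<delta>])
      show "w x < \<delta> * c" if "x \<in> X" for x
      proof -
        have "0 < \<delta> * c" using \<delta> c_pos by simp
        with le[OF that] show ?thesis by linarith
      qed
    qed (use F in auto)
    ultimately have "l v - l (pos_part (v - real n *\<^sub>R h)) \<le> real n * 0 + \<delta> * l h"
      by (intro LIMSEQ_le_const) auto
    then show ?thesis by simp
  qed
  have main: "l v \<le> \<delta> * l h" if \<delta>: "0 < \<delta>" for \<delta>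
  proof -
    have "(\<lambda>n. l v - l (pos_part (v - real n *\<^sub>R h))) \<longlonglongrightarrow> l v - 0"
      by (intro tendsto_intros excess_over_h_weakly_null v l_linear)
    then have "l v - 0 \<le> \<delta> * l h" by (rule LIMSEQ_le_const2) (use trunc[OF \<delta>] in auto)
    then show ?thesis by simp
  qed
  show ?thesis
  proof (rule field_le_epsilon)
    fix e :: real assume e: "0 < e"
    have "l v \<le> e / (l h + 1) * l h" using l_h_nonneg e by (intro main) simp
    also have "\<dots> \<le> e / (l h + 1) * (l h + 1)" using l_h_nonneg e by (intro mult_left_mono) auto
    also have "\<dots> = e" using l_h_nonneg by simp
    finally show "l v \<le> 0 + e" by simp
  qed
qed

text \<open>On a compact member of a nest the functions are uniformly small for large \<open>n\<close> by Dini's theorem;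
  off it, the truncations at a multiple of \<open>h\<close> are controlled by the balayaged function of the
  complement. What the truncation cuts off is small uniformly in \<open>n\<close> since the sequence decreases.\<close>

lemma l_Daniell:
  assumes v: "\<And>n::nat. v n \<in> D" and u: "\<And>n. qcv (v n) (u n)"
    and dec: "\<And>n x. x \<in> X \<Longrightarrow> u (Suc n) x \<le> u n x"
    and lim: "\<And>x. x \<in> X \<Longrightarrow> (\<lambda>n. u n x) \<longlonglongrightarrow> 0" and e: "0 < e"
  shows "\<exists>N. \<forall>n\<ge>N. l (v n) < e"
proof -
  obtain F1 where F1: "enest F1" using compact_nest by blast
  have "qcont (u i)" for i using u by (simp add: qc_version_def)
  then obtain F where F: "enest F" "\<forall>k. compact (F k)" "\<forall>k i. continuous_on (F k) (u i)"
      "\<forall>k. continuous_on (F k) hq"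
    by (rule good_nest[of u, OF _ F1]) blast
  have mono: "u k x \<le> u n x" if "n \<le> k" "x \<in> X" for n k x
    using lift_Suc_antimono_le[of "\<lambda>n. u n x" n k] dec that by auto
  note lh = l_h_nonneg
  obtain C where C: "l (pos_part (v 0 - real C *\<^sub>R h)) < e / 3"
    using order_tendstoD(2)[OF excess_over_h_weakly_null[OF v l_linear, of 0], of "e / 3"] e
    by (auto simp: eventually_sequentially)
  have excess: "l (pos_part (v n - real C *\<^sub>R h)) < e / 3" for n
  proof -
    let ?p = "\<lambda>n. pos_part (v n - real C *\<^sub>R h)"
    have pD: "?p n \<in> D" for n using v h_D by (auto intro: V_pos_part)
    have "l (?p n - ?p 0) \<le> 0"
    proof (rule l_le_zero)
      show "qcv (?p n - ?p 0) (pos_part (u n - real C *\<^sub>R hq) - pos_part (u 0 - real C *\<^sub>R hq))"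
        by (intro qcv_diff qcv_pos_part qcv_scale u qcv_hq)
      show "(pos_part (u n - real C *\<^sub>R hq) - pos_part (u 0 - real C *\<^sub>R hq)) x \<le> 0" if "x \<in> X" for x
        using mono[of 0 n x] that by simp
    qed (intro V_diff pD)
    then have "l (?p n) \<le> l (?p 0)" using pD g_D by (simp only: diff_left)
    with C show ?thesis by simp
  qed
  obtain k where k: "real C * l (red (- F k)) < e / 3"
  proof -
    have "(\<lambda>k. real C * l (red (- F k))) \<longlonglongrightarrow> real C * 0"
      by (intro tendsto_intros red_weakly_null F l_linear)
    then have "\<forall>\<^sub>F k in sequentially. real C * l (red (- F k)) < e / 3"
      by (rule order_tendstoD) (use e in simp)
    then show ?thesis using that by (auto simp: eventually_sequentially)
  qed
  define \<delta> where "\<delta> = e / 3 / (l h + 1)"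
  have \<delta>: "0 < \<delta>" "\<delta> * l h \<le> e / 3"
  proof -
    show "0 < \<delta>" using e lh by (simp add: \<delta>_def)
    then have "\<delta> * l h \<le> \<delta> * (l h + 1)" by simp
    also have "\<dots> = e / 3"
    proof -
      have "a / b * b = a" if "b \<noteq> 0" for a b :: real using that by simp
      moreover have "l h + 1 \<noteq> 0" using lh by linarith
      ultimately show ?thesis unfolding \<delta>_def by blast
    qed
    finally show "\<delta> * l h \<le> e / 3" .
  qed
  have "compact (F k \<inter> X)" using F(2) closed_X by (intro compact_Int_closed) auto
  then have "\<exists>N. \<forall>n\<ge>N. \<forall>x\<in>F k \<inter> X. u n x < \<delta> * c"
    by (rule Dini_null) (use F(3) dec lim \<delta> c_pos in \<open>auto intro: continuous_on_subset\<close>)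
  then obtain N where N: "\<And>n x. n \<ge> N \<Longrightarrow> x \<in> F k \<Longrightarrow> x \<in> X \<Longrightarrow> u n x < \<delta> * c" by auto
  have "l (v n) < e" if n: "n \<ge> N" for n
  proof -
    have "l (v n) - l (pos_part (v n - real C *\<^sub>R h)) \<le> real C * l (red (- F k)) + \<delta> * l h"
      by (rule l_truncation_le[OF v u nestD(2)[OF F(1)] _ _ \<delta>(1)]) (use F(3,4) N[OF n] in auto)
    then show ?thesis using excess[of n] k \<delta>(2) by linarith
  qed
  then show ?thesis by blast
qed

definition W where "W = {w. \<exists>v\<in>D. qcv v w}"

text \<open>A quasi-continuous function may fail to be Borel, hence to lie in \<open>D\<close>, although it is a version of
  some \<open>v\<close> in \<open>D\<close>; \<open>l v\<close> is the same for all these \<open>v\<close>.\<close>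

definition L where "L w = l (SOME v. v \<in> D \<and> qcv v w)"

lemma L_eq:
  assumes "v \<in> D" "qcv v w" shows "L w = l v"
proof -
  have *: "\<exists>v. v \<in> D \<and> qcv v w" using assms by blast
  note sm = someI_ex[OF *]
  show ?thesis
    unfolding L_def
    by (rule bdd_linear_cong_AE[OF l_linear]) (use sm assms qcv_D_cong in blast)+
qed

lemma W_I: "v \<in> D \<Longrightarrow> qcv v w \<Longrightarrow> w \<in> W"
  by (auto simp: W_def)

lemma W_E: "w \<in> W \<Longrightarrow> (\<And>v. v \<in> D \<Longrightarrow> qcv v w \<Longrightarrow> L w = l v \<Longrightarrow> P) \<Longrightarrow> P"
  by (auto simp: W_def L_eq)

text \<open>Quasi-continuity puts no constraint on values in an exceptional set. This is how exceptional sets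
  become null sets of the representing measure.\<close>

lemma qcv_exceptional: "exceptional m D \<E> N \<Longrightarrow> qcv 0 (indicator N)"
proof -
  assume "exceptional m D \<E> N"
  then obtain F where F: "enest F" "N \<subseteq> (\<Inter>k. - F k)" by (auto simp: exceptional_def)
  have zero: "indicator N x = (0::real)" if "x \<in> F k" for x k using F(2) that by (auto simp: indicator_def)
  have "continuous_on (F k) (indicator N :: 'a \<Rightarrow> real)" for k
    by (rule continuous_on_eq[OF continuous_on_const[of _ 0]]) (simp add: zero)
  moreover have "AE x in m. indicator N x = (0::real)"
    using AE_in_nest[OF F(1)] zero by (auto elim!: eventually_mono)
  ultimately show ?thesis using F(1) by (auto simp: qc_version_def quasi_continuous_def)
qed

lemma exceptional_zero: "exceptional m D \<E> {}"
  using compact_nest by (auto simp: exceptional_def)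

sublocale da: daniell_functional W L X
proof
  have "(0::'a \<Rightarrow> real) \<in> W"
  proof (rule W_I[OF V_zero])
    have "(indicator {} :: 'a \<Rightarrow> real) = 0" by (simp add: fun_eq_iff)
    then show "qcv 0 0" using qcv_exceptional[OF exceptional_zero] by metis
  qed
  then show "subspace W"
    unfolding subspace_def by (auto simp: W_def intro: qcv_add qcv_scale)
  show "L (u + v) = L u + L v" if "u \<in> W" "v \<in> W" for u v
    using that
  proof (elim W_E)
    fix p q assume "p \<in> D" "qcv p u" "L u = l p" "q \<in> D" "qcv q v" "L v = l q"
    then show "L (u + v) = L u + L v"
      using L_eq[OF V_add qcv_add, of p q u v] by (simp add: add_left g_D)
  qed
  show "L (r *\<^sub>R u) = r * L u" if "u \<in> W" for r u
    using that
  proof (elim W_E)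
    fix p assume "p \<in> D" "qcv p u" "L u = l p"
    then show "L (r *\<^sub>R u) = r * L u"
      using L_eq[OF V_scale qcv_scale, of p u r] by (simp add: scale_left g_D)
  qed
  show "pos_part u \<in> W" if "u \<in> W" for u
    using that by (elim W_E) (rule W_I[OF V_pos_part qcv_pos_part])
  show "(\<lambda>x. min (u x) 1) \<in> W" if "u \<in> W" for u
    using that
  proof (elim W_E)
    fix v assume v: "v \<in> D" "qcv v u"
    have "(\<lambda>x. min (max (v x) 0) 1) - pos_part (- v) \<in> D"
      by (intro V_diff unit_contraction_in_D V_pos_part V_minus v(1))
    moreover have "(\<lambda>x. min (max (v x) 0) 1) - pos_part (- v) = (\<lambda>x. min (v x) 1)"
      by (auto simp: fun_eq_iff)
    ultimately show ?thesis using W_I[OF _ qcv_min_1[OF v(2)]] by simp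
  qed
  show nonneg: "0 \<le> L u" if "u \<in> W" "\<And>x. x \<in> X \<Longrightarrow> 0 \<le> u x" for u
    using that(1)
  proof (elim W_E)
    fix v assume v: "v \<in> D" "qcv v u" "L u = l v"
    have "l ((-1) *\<^sub>R v) \<le> 0"
      by (rule l_le_zero[OF _ qcv_scale[OF v(2)]]) (use v that(2) in auto)
    moreover have "l ((-1) *\<^sub>R v) = (-1) * l v" by (rule scale_left[OF v(1) g_D])
    ultimately show "0 \<le> L u" using v by simp
  qed
  show "(\<lambda>n. L (u n)) \<longlonglongrightarrow> 0"
    if u: "\<And>n::nat. u n \<in> W" "\<And>n x. x \<in> X \<Longrightarrow> u (Suc n) x \<le> u n x"
      "\<And>x. x \<in> X \<Longrightarrow> (\<lambda>n. u n x) \<longlonglongrightarrow> 0" for u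
  proof (rule LIMSEQ_I)
    fix e :: real assume e: "0 < e"
    have "\<exists>v. v \<in> D \<and> qcv v (u n)" for n using u(1) by (auto simp: W_def)
    then obtain v where v: "\<And>n. v n \<in> D" "\<And>n. qcv (v n) (u n)" by metis
    obtain N where N: "\<And>n. n \<ge> N \<Longrightarrow> l (v n) < e"
      using l_Daniell[OF v u(2,3) e] by auto
    have "0 \<le> u n x" if "x \<in> X" for n x
    proof (rule LIMSEQ_le_const2[OF u(3)[OF that]])
      have "u k x \<le> u n x" if "k \<ge> n" for k
        using lift_Suc_antimono_le[of "\<lambda>n. u n x" n k] u(2)[OF \<open>x \<in> X\<close>] that by auto
      then show "\<exists>N. \<forall>k\<ge>N. u k x \<le> u n x" by blast
    qed
    then have nn: "0 \<le> L (u n)" for n by (intro nonneg u(1))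
    have "norm (L (u n) - 0) < e" if "n \<ge> N" for n
      using N[OF that] L_eq[OF v(1) v(2), of n] nn[of n] by simp
    then show "\<exists>N. \<forall>n\<ge>N. norm (L (u n) - 0) < e" by blast
  qed
qed

lemma exceptional_null: "exceptional m D \<E> N \<Longrightarrow> N \<in> sets da.M \<and> emeasure da.M N = 0"
proof -
  assume N: "exceptional m D \<E> N"
  have i: "indicator N \<in> W" by (rule W_I[OF V_zero qcv_exceptional[OF N]])
  have "L (indicator N) = l 0" by (rule L_eq[OF V_zero qcv_exceptional[OF N]])
  then have L0: "L (indicator N) = 0" using g_D by simp
  have [measurable]: "(indicator N :: 'a \<Rightarrow> real) \<in> borel_measurable da.M" by (rule da.W_measurable[OF i])
  have level: "{x \<in> space da.M. (1/2 :: real) < indicator N x} = N"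
    by (auto simp: indicator_def da.space_M split: if_splits)
  have "{x \<in> space da.M. (1/2 :: real) < indicator N x} \<in> sets da.M" by measurable
  then have sets: "N \<in> sets da.M" unfolding level .
  have "(\<integral>\<^sup>+x. ennreal (indicator N x) \<partial>da.M) = ennreal 0"
    using da.nn_integral_M[OF i] L0 by simp
  then have "emeasure da.M N = 0" using sets by (simp add: ennreal_indicator)
  with sets show ?thesis by simp
qed

text \<open>On the union \<open>Y\<close> of a suitable nest of compacts, the map \<open>\<Phi>\<close> into the sequence space given by the
  separating functions is injective, and continuous on each \<open>F k\<close>. For closed \<open>G\<close> this makes
  \<open>G \<inter> F k\<close> the preimage in \<open>Y\<close> of a compact set. Everything outside \<open>Y\<close> is exceptional.\<close>

lemma borel_sets_M: "sets borel \<subseteq> sets da.M"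
proof -
  obtain v :: "nat \<Rightarrow> 'a \<Rightarrow> real" and w N where vw: "\<forall>n. v n \<in> D \<and> qcv (v n) (w n)"
    and N: "exceptional m D \<E> N"
    and sep: "\<forall>x y. x \<notin> N \<longrightarrow> y \<notin> N \<longrightarrow> x \<noteq> y \<longrightarrow> (\<exists>n. w n x \<noteq> w n y)"
    using qr unfolding quasi_regular_def by (elim conjE exE) (rule that)
  obtain F1 where F1: "enest F1" "N \<subseteq> (\<Inter>k. - F1 k)" using N by (auto simp: exceptional_def)
  have "qcont (w i)" for i using vw by (simp add: qc_version_def)
  then obtain F where F: "enest F" "\<forall>k. \<exists>j. F k \<subseteq> F1 j" "\<forall>k. compact (F k)"
      "\<forall>k i. continuous_on (F k) (w i)"
    by (rule good_nest[of w, OF _ F1(1)]) blast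
  have FN: "x \<notin> N" if "x \<in> F k" for x k
    using F(2)[rule_format, of k] F1(2) that by blast
  define Y where "Y = (\<Union>k. F k)"
  define \<Phi> where "\<Phi> x = (\<lambda>n. w n x)" for x
  have "w n \<in> borel_measurable da.M" for n using vw by (intro da.W_measurable) (auto intro: W_I)
  then have \<Phi>_meas: "\<Phi> \<in> borel_measurable da.M"
    unfolding \<Phi>_def by (rule measurable_coordinatewise_then_product)
  have exc: "A - Y \<in> sets da.M" for A
  proof -
    have "exceptional m D \<E> (A - Y)"
      unfolding exceptional_def using F(1) by (intro exI[of _ F]) (auto simp: Y_def)
    from exceptional_null[OF this] show ?thesis by (rule conjunct1)
  qed
  have "UNIV - (UNIV - Y) \<in> sets da.M" using exc[of UNIV] da.space_M by (metis sets.compl_sets)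
  then have Y: "Y \<in> sets da.M" by (simp add: Diff_Diff_Int)
  have closed: "G \<in> sets da.M" if G: "closed G" for G
  proof -
    have part: "G \<inter> F k \<in> sets da.M" for k
    proof -
      have "continuous_on (F k) \<Phi>"
        unfolding \<Phi>_def using F(4) by (intro continuous_on_coordinatewise_then_product) auto
      then have "compact (\<Phi> ` (G \<inter> F k))"
        using F(3) G by (intro compact_continuous_image closed_Int_compact) (auto intro: continuous_on_subset)
      then have "\<Phi> ` (G \<inter> F k) \<in> sets borel" by (intro borel_closed compact_imp_closed)
      then have "\<Phi> -` (\<Phi> ` (G \<inter> F k)) \<inter> space da.M \<in> sets da.M"
        by (rule measurable_sets[OF \<Phi>_meas])
      then have "\<Phi> -` (\<Phi> ` (G \<inter> F k)) \<inter> Y \<in> sets da.M" using Y by (simp add: da.space_M sets.Int)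
      moreover have "\<Phi> -` (\<Phi> ` (G \<inter> F k)) \<inter> Y = G \<inter> F k"
      proof (intro set_eqI iffI)
        fix x assume "x \<in> \<Phi> -` (\<Phi> ` (G \<inter> F k)) \<inter> Y"
        then obtain y i where y: "\<Phi> x = \<Phi> y" "y \<in> G" "y \<in> F k" and x: "x \<in> F i" by (auto simp: Y_def)
        have "x = y"
        proof (rule ccontr)
          assume "x \<noteq> y"
          with sep FN[OF x] FN[OF y(3)] obtain n where "w n x \<noteq> w n y" by blast
          with y(1) show False by (simp add: \<Phi>_def fun_eq_iff)
        qed
        with y show "x \<in> G \<inter> F k" by simp
      qed (auto simp: Y_def)
      ultimately show ?thesis by simp
    qed
    have "G = (\<Union>k. G \<inter> F k) \<union> (G - Y)" by (auto simp: Y_def)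
    also have "\<dots> \<in> sets da.M" by (intro sets.Un sets.countable_UN exc image_subsetI part)
    finally show ?thesis .
  qed
  have "sigma_sets (space da.M) (Collect closed) \<subseteq> sets da.M"
    by (rule sets.sigma_sets_subset) (use closed in auto)
  then show ?thesis by (simp add: da.space_M borel_eq_closed)
qed

definition \<mu> :: "'a measure" where "\<mu> = distr da.M borel (\<lambda>x. x)"

lemma id_measurable: "(\<lambda>x. x) \<in> measurable da.M borel"
  by (rule measurableI) (use borel_sets_M da.space_M in auto)

lemma sets_\<mu>: "sets \<mu> = sets borel" and space_\<mu>: "space \<mu> = UNIV"
  and emeasure_\<mu>: "A \<in> sets borel \<Longrightarrow> emeasure \<mu> A = emeasure da.M A"
  by (simp_all add: \<mu>_def emeasure_distr[OF id_measurable] da.space_M)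

lemma exceptional_null_\<mu>: "N \<in> sets borel \<Longrightarrow> exceptional m D \<E> N \<Longrightarrow> emeasure \<mu> N = 0"
  using exceptional_null by (simp add: emeasure_\<mu>)

lemma borel_version:
  assumes w: "qcv v w"
  obtains w' where "qcv v w'" "w' \<in> borel_measurable borel" "AE x in \<mu>. w x = w' x"
proof -
  obtain F where F: "enest F" "\<And>k. continuous_on (F k) w"
    using w by (auto simp: qc_version_def quasi_continuous_def)
  define Y where "Y = (\<Union>k. F k)"
  have cl: "closed (F k)" for k by (rule nestD(2)[OF F(1)])
  have Y: "Y \<in> sets borel" unfolding Y_def using cl by auto
  define w' where "w' x = (if x \<in> Y then w x else 0)" for x
  have cont: "continuous_on (F k) w'" for k
    by (rule continuous_on_eq[OF F(2)[of k]]) (auto simp: w'_def Y_def)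
  have "w' \<in> borel_measurable borel"
  proof (rule borel_measurableI)
    fix S :: "real set" assume S: "open S"
    have "w' -` S \<inter> F k \<in> sets borel" for k
    proof -
      obtain T where T: "open T" "F k \<inter> w' -` S = F k \<inter> T"
        using cont[of k] S unfolding continuous_on_open_invariant by (metis Int_commute)
      have "F k \<inter> T \<in> sets borel" using cl T by auto
      then show ?thesis using T by (simp add: Int_commute)
    qed
    then have 1: "(\<Union>k. w' -` S \<inter> F k) \<in> sets borel" by blast
    have eq: "w' -` S = (\<Union>k. w' -` S \<inter> F k) \<union> (if 0 \<in> S then - Y else {})"
      by (auto simp: w'_def Y_def split: if_splits)
    have 2: "(if 0 \<in> S then - Y else {}) \<in> sets borel" using Y by auto
    have "w' -` S \<in> sets borel" by (subst eq) (rule sets.Un[OF 1 2])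
    then show "w' -` S \<inter> space borel \<in> sets borel" by simp
  qed
  moreover have "AE x in m. w' x = v x"
  proof -
    have "AE x in m. w x = v x" using w by (simp add: qc_version_def)
    with AE_in_nest[OF F(1)] show ?thesis by eventually_elim (simp add: w'_def Y_def)
  qed
  then have "qcv v w'" using F(1) cont unfolding qc_version_def quasi_continuous_def by blast
  moreover have "AE x in \<mu>. w x = w' x"
  proof (rule AE_I)
    show "{x \<in> space \<mu>. w x \<noteq> w' x} \<subseteq> - Y" by (auto simp: w'_def)
    have "exceptional m D \<E> (- Y)"
      unfolding exceptional_def using F(1) by (intro exI[of _ F]) (auto simp: Y_def)
    then show "emeasure \<mu> (- Y) = 0" using Y by (intro exceptional_null_\<mu>) auto
    show "- Y \<in> sets \<mu>" using Y by (simp add: sets_\<mu>)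
  qed
  ultimately show ?thesis using that by blast
qed

lemma nn_integral_\<mu>:
  assumes v: "v \<in> D" and w: "qcv v w" "w \<in> borel_measurable borel" "\<And>x. 0 \<le> w x"
  shows "(\<integral>\<^sup>+x. ennreal (w x) \<partial>\<mu>) = ennreal (l v)"
proof -
  have "(\<integral>\<^sup>+x. ennreal (w x) \<partial>\<mu>) = (\<integral>\<^sup>+x. ennreal (w x) \<partial>da.M)"
    unfolding \<mu>_def by (rule nn_integral_distr[OF id_measurable]) (use w in measurable)
  also have "\<dots> = ennreal (L w)" by (rule da.nn_integral_M[OF W_I[OF v w(1)] w(3)])
  finally show ?thesis using L_eq[OF v w(1)] by simp
qed

lemma l_pos_part_nonneg: "v \<in> D \<Longrightarrow> 0 \<le> l (pos_part v)"
  by (intro l_nonneg V_pos_part) auto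

lemma integral_\<mu>:
  assumes v: "v \<in> D" and w: "qcv v w"
  shows "(\<integral>x. w x \<partial>completion \<mu>) = l v"
proof -
  obtain w' where w': "qcv v w'" "w' \<in> borel_measurable borel" and ae: "AE x in \<mu>. w x = w' x"
    by (rule borel_version[OF w])
  have meas': "w' \<in> borel_measurable \<mu>" using w'(2) by (simp add: measurable_cong_sets[OF sets_\<mu> refl])
  have part: "has_bochner_integral \<mu> (pos_part u') (l (pos_part u))"
    if "u \<in> D" "qcv u u'" "u' \<in> borel_measurable borel" for u u'
  proof (rule has_bochner_integral_nn_integral)
    have p: "pos_part u' \<in> borel_measurable borel" unfolding pos_part_def using that(3) by measurable
    then show "pos_part u' \<in> borel_measurable \<mu>" by (simp add: measurable_cong_sets[OF sets_\<mu> refl])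
    show "0 \<le> l (pos_part u)" by (rule l_pos_part_nonneg[OF that(1)])
    show "(\<integral>\<^sup>+x. ennreal (pos_part u' x) \<partial>\<mu>) = ennreal (l (pos_part u))"
      by (rule nn_integral_\<mu>[OF V_pos_part[OF that(1)] qcv_pos_part[OF that(2)] p]) simp
  qed simp
  have neg: "qcv (- v) (- w')" using qcv_scale[OF w'(1), of "-1"] by simp
  have negm: "- w' \<in> borel_measurable borel"
    using borel_measurable_uminus[OF w'(2)] by (simp add: fun_Compl_def)
  have "has_bochner_integral \<mu> (\<lambda>x. pos_part w' x - pos_part (- w') x) (l (pos_part v) - l (pos_part (- v)))"
    by (intro has_bochner_integral_diff part v w' neg negm V_minus)
  moreover have "(\<lambda>x. pos_part w' x - pos_part (- w') x) = w'" by (auto simp: fun_eq_iff)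
  moreover have "l (pos_part v) - l (pos_part (- v)) = l v"
  proof -
    have "l v = l (pos_part v - pos_part (- v))" using pos_neg_decomp[of v] by simp
    also have "\<dots> = l (pos_part v) - l (pos_part (- v))"
      by (intro diff_left V_pos_part V_minus v g_D)
    finally show ?thesis by simp
  qed
  ultimately have i: "integral\<^sup>L \<mu> w' = l v" by (simp add: has_bochner_integral_iff)
  have mc': "w' \<in> borel_measurable (completion \<mu>)" by (rule measurable_completion[OF meas'])
  have aec: "AE x in completion \<mu>. w x = w' x" by (rule AE_completion[OF ae])
  have mc: "w \<in> borel_measurable (completion \<mu>)"
  proof (rule measurableI)
    fix S :: "real set" assume "S \<in> sets borel"
    from measurable_sets[OF mc' this]
    have "w' -` S \<inter> space (completion \<mu>) \<in> sets (completion \<mu>)" .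
    moreover have "AE x in completion \<mu>. x \<in> w' -` S \<inter> space (completion \<mu>) \<longleftrightarrow> x \<in> w -` S \<inter> space (completion \<mu>)"
      using aec by eventually_elim auto
    ultimately show "w -` S \<inter> space (completion \<mu>) \<in> sets (completion \<mu>)"
      using completion.in_sets_AE by blast
  qed simp
  have "(\<integral>x. w x \<partial>completion \<mu>) = (\<integral>x. w' x \<partial>completion \<mu>)"
    by (rule integral_cong_AE[OF mc mc' aec])
  also have "\<dots> = l v" using integral_completion[OF meas'] i by simp
  finally show ?thesis .
qed

lemma \<mu>_in_S0: "\<mu> \<in> S0 m D \<E>"
proof -
  define C where "C = sector_const * (2 * sector_const) * nrm g + 1"
  have Cp: "C > 0" using K_pos g_D by (auto simp: C_def intro!: add_nonneg_pos mult_nonneg_nonneg)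
  have "(\<integral>\<^sup>+x. ennreal \<bar>w x\<bar> \<partial>completion \<mu>) \<le> ennreal (C * norm1 m \<E> v)"
    if v: "v \<in> D" and w: "qcv v w" for v w
  proof -
    obtain w' where w': "qcv v w'" "w' \<in> borel_measurable borel" and ae: "AE x in \<mu>. w x = w' x"
      by (rule borel_version[OF w])
    define p where "p = pos_part v + pos_part (- v)"
    define q where "q = pos_part w' + pos_part (- w')"
    have pD: "p \<in> D" using v by (auto simp: p_def intro: V_pos_part)
    have pq: "qcv p q"
      unfolding p_def q_def using qcv_scale[OF w'(1), of "-1"] by (intro qcv_add qcv_pos_part w') simp
    have q: "q x = \<bar>w' x\<bar>" for x by (auto simp: q_def)
    have "(\<integral>\<^sup>+x. ennreal \<bar>w x\<bar> \<partial>completion \<mu>) = (\<integral>\<^sup>+x. ennreal \<bar>w x\<bar> \<partial>\<mu>)"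
      by (rule nn_integral_completion)
    also have "\<dots> = (\<integral>\<^sup>+x. ennreal (q x) \<partial>\<mu>)"
      by (rule nn_integral_cong_AE) (use ae in eventually_elim, simp add: q)
    also have "\<dots> = ennreal (l p)"
    proof (rule nn_integral_\<mu>[OF pD pq])
      have "q = (\<lambda>x. \<bar>w' x\<bar>)" by (simp add: fun_eq_iff q)
      then show "q \<in> borel_measurable borel" using w'(2) by simp
    qed (simp add: q)
    also have "\<dots> \<le> ennreal (C * norm1 m \<E> v)"
    proof (rule ennreal_leI)
      have "l p \<le> sector_const * nrm p * nrm g" using sector_nrm[OF pD g_D] by simp
      also have "nrm p \<le> nrm (pos_part v) + nrm (pos_part (- v))"
        unfolding p_def by (rule nrm_triangle) (use v in \<open>auto intro: V_pos_part\<close>)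
      also have "\<dots> \<le> 2 * sector_const * nrm v"
        using nrm_pos_part_le[OF v] nrm_pos_part_le[of "- v"] v by simp
      finally have "l p \<le> sector_const * (2 * sector_const * nrm v) * nrm g"
        using K_pos g_D by (simp add: mult_left_mono mult_right_mono)
      also have "\<dots> \<le> C * nrm v" using v by (simp add: C_def algebra_simps)
      finally show "l p \<le> C * norm1 m \<E> v" by (simp add: nrm_eq_norm1)
    qed
    finally show ?thesis .
  qed
  then show ?thesis
    unfolding S0_def using sets_\<mu> exceptional_null_\<mu> Cp by blast
qed

text \<open>Every function in \<open>D\<close> has a quasi-continuous version, so the defining property determines the
  co-potential almost everywhere, and \<open>g\<close> has this property.\<close>

lemma co_potential_\<mu>: "AE x in m. co_potential m D \<E> \<mu> x = g x"
proof -
  let ?P = "\<lambda>g'. g' \<in> D \<and> (\<forall>v\<in>D. \<forall>w. qcv v w \<longrightarrow> B v g' = (\<integral>x. w x \<partial>completion \<mu>))"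
  have "?P g" using g_D integral_\<mu> by simp
  then have *: "?P (co_potential m D \<E> \<mu>)" unfolding co_potential_def by (rule someI[of ?P g])
  define p where "p = co_potential m D \<E> \<mu>"
  have p: "p \<in> D" using * by (simp add: p_def)
  have eq: "B v p = B v g" if v: "v \<in> D" for v
  proof -
    obtain w where w: "qcv v w" using qcv_exists[OF v] by blast
    have "B v p = (\<integral>x. w x \<partial>completion \<mu>)" using * v w unfolding p_def by blast
    also have "\<dots> = B v g" by (rule integral_\<mu>[OF v w])
    finally show ?thesis .
  qed
  have "B (p - g) (p - g) \<le> 0" using eq[of "p - g"] p g_D by (simp add: diff_right)
  from AE_zero_of_B_zero[OF _ this] p g_D show ?thesis by (auto simp: p_def)
qed

text \<open>\<open>\<mu>\<close> is carried by \<open>X\<close> and the integral of a Borel version of \<open>h\<close> is \<open>l h\<close>.\<close>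

lemma \<mu>_charges:
  assumes "0 < l h" shows "emeasure \<mu> X \<noteq> 0"
proof
  assume X0: "emeasure \<mu> X = 0"
  have X: "X \<in> sets borel" using closed_X by auto
  have "emeasure \<mu> (- X) = 0"
    using da.emeasure_outside[of "- X"] X by (simp add: emeasure_\<mu>)
  then have "emeasure \<mu> (X \<union> - X) \<le> 0"
    using emeasure_subadditive[of X \<mu> "- X"] X X0 by (simp add: sets_\<mu>)
  then have zero: "emeasure \<mu> (space \<mu>) = 0" by (simp add: space_\<mu>)
  obtain w' where w': "qcv h w'" "w' \<in> borel_measurable borel"
    by (rule borel_version[OF qcv_hq])
  have "(\<integral>\<^sup>+x. ennreal (pos_part w' x) \<partial>\<mu>) = ennreal (l (pos_part h))"
  proof (rule nn_integral_\<mu>[OF V_pos_part[OF h_D] qcv_pos_part[OF w'(1)]])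
    show "pos_part w' \<in> borel_measurable borel" unfolding pos_part_def using w'(2) by measurable
  qed simp
  moreover have "(\<integral>\<^sup>+x. ennreal (pos_part w' x) \<partial>\<mu>) = 0"
  proof -
    have "AE x in \<mu>. False"
      by (rule AE_I[of _ _ "space \<mu>"]) (use zero in auto)
    then have "(\<integral>\<^sup>+x. ennreal (pos_part w' x) \<partial>\<mu>) = (\<integral>\<^sup>+x. 0 \<partial>\<mu>)"
      by (intro nn_integral_cong_AE) (auto elim: eventually_mono)
    then show ?thesis by simp
  qed
  ultimately have "l (pos_part h) \<le> 0" by (metis ennreal_eq_0_iff order_refl)
  moreover have "l (pos_part h) = l h"
    by (rule bdd_linear_cong_AE[OF l_linear V_pos_part[OF h_D] h_D])
      (use h_pos in \<open>auto elim: eventually_mono\<close>)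
  ultimately show False using assms by simp
qed

end

section \<open>Sets not charged by measures with dominated co-potential\<close>

theorem theorem5p3:
  fixes m :: "'a::metric_space measure"
    and D :: "('a \<Rightarrow> real) set"
    and \<E> :: "('a \<Rightarrow> real) \<Rightarrow> ('a \<Rightarrow> real) \<Rightarrow> real"
    and \<phi> :: "'a \<Rightarrow> real"
    and e :: "'a \<Rightarrow> 'p::polish_space"
    and A :: "'a set"
  assumes "lusin_embedding e"
    and "semi_dirichlet_form m D \<E>"
    and "quasi_regular m D \<E>"
    and "\<phi> \<in> L2 m"
    and "AE x in m. 0 < \<phi> x \<and> \<phi> x \<le> 1"
    and "A \<in> sets borel"
    and "\<And>\<mu>. \<mu> \<in> S00_hat m D \<E> \<phi> \<Longrightarrow> emeasure \<mu> A = 0"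
  shows "cap m D \<E> \<phi> A = 0"
proof -
  interpret semi_dirichlet_form m D \<E> by fact
  interpret quasi_regular_form m D \<E> \<phi> by unfold_locales (use assms in auto)
  show ?thesis
  proof (rule ccontr)
    assume "ucap A \<noteq> 0"
    then have pos: "0 < ucap A" using ucap_nonneg[of A] by linarith
    obtain F1 where F1: "enest F1" using compact_nest by blast
    have "qcont hq" using qcv_hq by (simp add: qc_version_def)
    then obtain F where F: "enest F" "\<forall>k. compact (F k)" "\<forall>k. \<forall>x\<in>F k. 1 / real (Suc k) \<le> hq x"
      by (rule good_nest[of "\<lambda>_. hq", OF _ F1]) blast
    obtain k where k: "ocap (- F k) < ucap A"
      using order_tendstoD(2)[OF ocap_nest[OF F(1)] pos] by (auto simp: eventually_sequentially)
    have "ucap A \<le> ucap ((A \<inter> F k) \<union> - F k)" by (rule ucap_mono) auto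
    also have "\<dots> \<le> ucap (A \<inter> F k) + ocap (- F k)"
      by (rule ucap_Un_open) (use nestD(2)[OF F(1)] in auto)
    finally have posk: "0 < ucap (A \<inter> F k)" using k by linarith
    have compF: "compact (F k)" using F(2) by blast
    obtain X where X: "compact X" "X \<subseteq> A \<inter> F k" "ucap (A \<inter> F k) / 2 \<le> ucap X"
    proof (rule capacitability[of ucap "F k" "A \<inter> F k" "ucap (A \<inter> F k) / 2"])
      show "c \<le> ucap S" if "\<And>U. open U \<Longrightarrow> S \<subseteq> U \<Longrightarrow> c \<le> ucap U" for S c
      proof (rule le_ucapI)
        fix U assume U: "open U" "S \<subseteq> U"
        from that[OF this] ucap_le_ocap[OF U(1) subset_refl] show "c \<le> ocap U" by (rule order_trans)
      qed
      show "A \<inter> F k \<in> sets borel" using assms(6) nestD(2)[OF F(1)] by auto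
      show "ucap (\<Union>n. S n) \<le> c" if "incseq S" "\<And>n::nat. ucap (S n) \<le> c" for S c
        by (rule ucap_incseq_le[OF that])
    qed (use ucap_mono compF posk in simp_all)
    obtain g where g: "g \<in> D" "AE x in m. g x \<le> h' x" "inner_L2 m \<phi> g = ucap X"
      "\<forall>U v. open U \<longrightarrow> X \<subseteq> U \<longrightarrow> v \<in> D \<longrightarrow> (AE x in m. x \<in> U \<longrightarrow> 0 \<le> v x) \<longrightarrow> 0 \<le> B v g"
      by (rule co_equilibrium[of X])
    interpret carried_functional m D \<E> \<phi> X "1 / real (Suc k)" g
    proof
      show "closed X" by (rule compact_imp_closed[OF X(1)])
      show "1 / real (Suc k) \<le> hq x" if "x \<in> X" for x using F(3) X(2) that by blast
    qed (use g in auto)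
    have "\<mu> \<in> S00_hat m D \<E> \<phi>"
    proof -
      have "AE x in m. co_potential m D \<E> \<mu> x \<le> 1 * coresolvent m D \<E> 1 \<phi> x"
        using co_potential_\<mu> g(2) by eventually_elim (simp add: h'_def)
      then show ?thesis using \<mu>_in_S0 unfolding S00_hat_def by (auto intro!: exI[of _ 1])
    qed
    then have "emeasure \<mu> A = 0" by (rule assms(7))
    moreover have "emeasure \<mu> X \<le> emeasure \<mu> A"
      using X(2) assms(6) by (intro emeasure_mono) (auto simp: sets_\<mu>)
    moreover have "emeasure \<mu> X \<noteq> 0"
    proof (rule \<mu>_charges)
      show "0 < B h g" using B_h[OF g(1)] g(3) X(3) posk by simp
    qed
    ultimately show False by simp
  qed
qed

end
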